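(* Let $(W,S)$ be a finite Coxeter system. For a ciliated surface $\Sigma$ of genus $g$ with $k$ punctures (marked points) and $n$ boundary components equipped with labels $(h_1,\dots,h_n)\in\mathcal H^n$, the polynomial invariant is $$P_{\Sigma,W}(q)=\sum_\lambda(\dim V_\lambda)^k\,s_\lambda(q)^{2g-2+k+n}\,\chi_\lambda(h_1)\cdots\chi_\lambda(h_n),$$ where the sum runs over all (isomorphism classes of) irreducible representations $V_\lambda$ of the Hecke algebra, $\chi_\lambda$ is the character of $V_\lambda$ and $s_\lambda$ is the Schur element of $V_\lambda$.
   Context: Hecke algebra. $\mathcal H$ is the unital $\mathbb Z[v^{\pm1}]$-algebra generated by $h_s$ ($s\in S$) with $h_s^2=(v^{-1}-v)h_s+1$ and braid relations $h_sh_th_s\cdots=h_th_sh_t\cdots$ ($m_{st}$ factors on each side); $q=v^{-2}$. $h_w=h_{s_1}\cdots h_{s_k}$ for a reduced expression of $w\in W$; $\{h_w\}$ is a basis. The standard trace $\mathrm{tr}$ is linear with $\mathrm{tr}(h_w)=\delta_{w,e}$; it is symmetric and non-degenerate. Irreducible representations are those of $\mathcal H$ after extending scalars to a splitting field such as $\mathbb C(v)$, over which $\mathcal H\cong\bigoplus_\lambda\mathrm{End}(V_\lambda)$. The Schur elements $s_\lambda$ are defined by $\mathrm{tr}=\sum_\lambda\frac1{s_\lambda}\chi_\lambda$. Ciliated surface: an oriented genus $g$ surface with $k$ punctures and $n$ open disks removed, with $p_i\ge1$ marked points (cilia) on the $i$-th boundary circle; $c=\sum p_i$; it is assumed that $k+n\ge1$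 and, if $g=0$, that $k+n\ge3$, or $k+n=2,\ c\ge1$, or $k+n=1,\ c\ge3$. Boundary segments connect adjacent cilia. Each boundary segment, with the orientation induced from $\Sigma$, is labeled by an element of $\mathcal H$; $h_i\in\mathcal H$ is the product of the labels along the $i$-th boundary component following the orientation (well defined up to cyclic permutation of the factors). Invariant. For boundary labels $h_w$ ($w\in W$): choose a triangulation $\mathsf T$ of $\Sigma$ with vertices at cilia and punctures; $P_{\Sigma,W}=\sum\prod_f\mathrm{tr}(h_xh_yh_z)$, the sum over labelings of the internal oriented edges by elements of $W$ (external edges carrying the boundary labels), the product over faces $f$, with $x,y,z\in W$ the labels of the sides of $f$ in cyclic order, a label being replaced by its inverse whenever the edge orientation is opposite to that induced by $f$. This does not depend on $\mathsf T$. For general boundary labels in $\mathcal H$ it is extended multilinearly. *)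

theory Defs
  imports
    "HOL-Algebra.Multiplicative_Group"
    "HOL-Algebra.QuotRing"
    "HOL-Library.Poly_Mapping"
    "HOL-Library.FuncSet"
    "Jordan_Normal_Form.VS_Connect"
begin

section \<open>Coxeter systems\<close>

definition word_prod :: "('w, 'b) monoid_scheme \<Rightarrow> 'w list \<Rightarrow> 'w" where
  "word_prod W u = foldr (\<lambda>s x. s \<otimes>\<^bsub>W\<^esub> x) u \<one>\<^bsub>W\<^esub>"

definition cox_m :: "('w, 'b) monoid_scheme \<Rightarrow> 'w \<Rightarrow> 'w \<Rightarrow> nat" where
  "cox_m W s t = group.ord W (s \<otimes>\<^bsub>W\<^esub> t)"

text \<open>The congruence on words in \<open>S\<close> generated by \<open>(st)^m(s,t) = 1\<close>. The case \<open>s = t\<close> gives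
  \<open>s^2 = 1\<close>, so the quotient of the free monoid is already the group presented by these
  relations. \<^const>\<open>group.ord\<close> is \<open>0\<close> for elements of infinite order, for which the relation is
  then empty, as it should be.\<close>

inductive cox_cong :: "('w, 'b) monoid_scheme \<Rightarrow> 'w set \<Rightarrow> 'w list \<Rightarrow> 'w list \<Rightarrow> bool"
  for W S where
  relator: "\<lbrakk>s \<in> S; t \<in> S; a \<in> lists S; b \<in> lists S\<rbrakk>
    \<Longrightarrow> cox_cong W S (a @ concat (replicate (cox_m W s t) [s, t]) @ b) (a @ b)"
| refl: "a \<in> lists S \<Longrightarrow> cox_cong W S a a"
| sym: "cox_cong W S a b \<Longrightarrow> cox_cong W S b a"
| trans: "\<lbrakk>cox_cong W S a b; cox_cong W S b c\<rbrakk> \<Longrightarrow> cox_cong W S a c"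

definition coxeter_system :: "('w, 'b) monoid_scheme \<Rightarrow> 'w set \<Rightarrow> bool" where
  "coxeter_system W S \<longleftrightarrow>
     group W \<and> S \<subseteq> carrier W \<and>
     (\<forall>s\<in>S. group.ord W s = 2) \<and>
     carrier W = word_prod W ` lists S \<and>
     (\<forall>a\<in>lists S. \<forall>b\<in>lists S. word_prod W a = word_prod W b \<longrightarrow> cox_cong W S a b)"

definition reduced :: "('w, 'b) monoid_scheme \<Rightarrow> 'w set \<Rightarrow> 'w list \<Rightarrow> 'w \<Rightarrow> bool" where
  "reduced W S u w \<longleftrightarrow> u \<in> lists S \<and> word_prod W u = w \<and>
     (\<forall>u'\<in>lists S. word_prod W u' = w \<longrightarrow> length u \<le> length u')"

section \<open>The Hecke algebra\<close>

text \<open>The ring \<open>\<int>[v, v\<^sup>-\<^sup>1]\<close>: finitely supported functions from exponents to coefficients,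
  with convolution as product.\<close>

type_synonym laurent = "int \<Rightarrow>\<^sub>0 int"

definition v_pow :: "int \<Rightarrow> laurent" where
  "v_pow n = Poly_Mapping.single n 1"

text \<open>The free associative unital \<open>\<int>[v, v\<^sup>-\<^sup>1]\<close>-algebra on \<open>S\<close>.\<close>

definition free_alg :: "'s set \<Rightarrow> ('s list \<Rightarrow> laurent) ring" where
  "free_alg S = \<lparr>
     carrier = {f. finite {u. f u \<noteq> 0} \<and> {u. f u \<noteq> 0} \<subseteq> lists S},
     mult = (\<lambda>f g u. \<Sum>i\<le>length u. f (take i u) * g (drop i u)),
     one = (\<lambda>u. if u = [] then 1 else 0),
     zero = (\<lambda>u. 0),
     add = (\<lambda>f g u. f u + g u)\<rparr>"

definition monomial :: "laurent \<Rightarrow> 's list \<Rightarrow> 's list \<Rightarrow> laurent" where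
  "monomial r u = (\<lambda>u'. if u' = u then r else 0)"

fun alternating :: "'s \<Rightarrow> 's \<Rightarrow> nat \<Rightarrow> 's list" where
  "alternating s t 0 = []"
| "alternating s t (Suc n) = s # alternating t s n"

definition hecke_relators :: "('w, 'b) monoid_scheme \<Rightarrow> 'w set \<Rightarrow> ('w list \<Rightarrow> laurent) set" where
  "hecke_relators W S =
     {\<lambda>u. monomial 1 [s, s] u - monomial (v_pow (-1) - v_pow 1) [s] u - monomial 1 [] u | s. s \<in> S}
   \<union> {\<lambda>u. monomial 1 (alternating s t (cox_m W s t)) u
          - monomial 1 (alternating t s (cox_m W s t)) u | s t. s \<in> S \<and> t \<in> S \<and> cox_m W s t \<noteq> 0}"

definition hecke_ideal :: "('w, 'b) monoid_scheme \<Rightarrow> 'w set \<Rightarrow> ('w list \<Rightarrow> laurent) set" where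
  "hecke_ideal W S = Idl\<^bsub>free_alg S\<^esub> (hecke_relators W S)"

type_synonym 'w hecke = "('w list \<Rightarrow> laurent) set"

definition hecke_alg :: "('w, 'b) monoid_scheme \<Rightarrow> 'w set \<Rightarrow> 'w hecke ring" where
  "hecke_alg W S = free_alg S Quot hecke_ideal W S"

text \<open>The class of \<open>r s\<^sub>1\<cdots>s\<^sub>k\<close>. With the empty word this is the structure map of the algebra.\<close>

definition hecke_monom ::
  "('w, 'b) monoid_scheme \<Rightarrow> 'w set \<Rightarrow> laurent \<Rightarrow> 'w list \<Rightarrow> 'w hecke" where
  "hecke_monom W S r u = hecke_ideal W S +>\<^bsub>free_alg S\<^esub> monomial r u"

definition hecke_scalar :: "('w, 'b) monoid_scheme \<Rightarrow> 'w set \<Rightarrow> laurent \<Rightarrow> 'w hecke" where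
  "hecke_scalar W S r = hecke_monom W S r []"

definition hecke_basis :: "('w, 'b) monoid_scheme \<Rightarrow> 'w set \<Rightarrow> 'w \<Rightarrow> 'w hecke" where
  "hecke_basis W S w = hecke_monom W S 1 (SOME u. reduced W S u w)"

text \<open>Coordinates with respect to the basis \<open>h\<^sub>w\<close>, for finite \<open>W\<close>.\<close>

definition hecke_coord :: "('w, 'b) monoid_scheme \<Rightarrow> 'w set \<Rightarrow> 'w hecke \<Rightarrow> 'w \<Rightarrow> laurent" where
  "hecke_coord W S x = (THE c. (\<forall>w. w \<notin> carrier W \<longrightarrow> c w = 0) \<and>
     x = (\<Oplus>\<^bsub>hecke_alg W S\<^esub>w\<in>carrier W.
            hecke_scalar W S (c w) \<otimes>\<^bsub>hecke_alg W S\<^esub> hecke_basis W S w))"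

definition std_trace :: "('w, 'b) monoid_scheme \<Rightarrow> 'w set \<Rightarrow> 'w hecke \<Rightarrow> laurent" where
  "std_trace W S x = hecke_coord W S x \<one>\<^bsub>W\<^esub>"

section \<open>Representations over an extension field\<close>

text \<open>A field \<open>K\<close> containing \<open>\<int>[v, v\<^sup>-\<^sup>1]\<close> is given by an injective ring homomorphism \<open>\<theta>\<close>. A
  \<open>d\<close>-dimensional representation of \<open>K \<otimes> \<H>\<close> on \<open>K\<^sup>d\<close> is the same thing as a \<open>\<theta>\<close>-semilinear unital
  ring homomorphism from \<open>\<H>\<close> to matrices; up to isomorphism these are all finite-dimensional
  representations. Only the values of \<open>\<rho>\<close> on the carrier are relevant.\<close>

definition hecke_rep :: "('w, 'b) monoid_scheme \<Rightarrow> 'w set \<Rightarrow> (laurent \<Rightarrow> 'k::field) \<Rightarrow>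
    nat \<Rightarrow> ('w hecke \<Rightarrow> 'k mat) \<Rightarrow> bool" where
  "hecke_rep W S \<theta> d \<rho> \<longleftrightarrow>
     (\<forall>x\<in>carrier (hecke_alg W S). \<rho> x \<in> carrier_mat d d) \<and>
     \<rho> \<one>\<^bsub>hecke_alg W S\<^esub> = 1\<^sub>m d \<and>
     (\<forall>x\<in>carrier (hecke_alg W S). \<forall>y\<in>carrier (hecke_alg W S).
        \<rho> (x \<oplus>\<^bsub>hecke_alg W S\<^esub> y) = \<rho> x + \<rho> y \<and>
        \<rho> (x \<otimes>\<^bsub>hecke_alg W S\<^esub> y) = \<rho> x * \<rho> y) \<and>
     (\<forall>r. \<rho> (hecke_scalar W S r) = \<theta> r \<cdot>\<^sub>m 1\<^sub>m d)"

definition hecke_irrep :: "('w, 'b) monoid_scheme \<Rightarrow> 'w set \<Rightarrow> (laurent \<Rightarrow> 'k::field) \<Rightarrow>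
    nat \<Rightarrow> ('w hecke \<Rightarrow> 'k mat) \<Rightarrow> bool" where
  "hecke_irrep W S \<theta> d \<rho> \<longleftrightarrow>
     hecke_rep W S \<theta> d \<rho> \<and> d > 0 \<and>
     (\<forall>U. VectorSpace.subspace class_ring U (module_vec TYPE('k) d) \<and>
          (\<forall>x\<in>carrier (hecke_alg W S). \<forall>u\<in>U. \<rho> x *\<^sub>v u \<in> U)
        \<longrightarrow> U = {0\<^sub>v d} \<or> U = carrier_vec d)"

definition hecke_rep_iso :: "('w, 'b) monoid_scheme \<Rightarrow> 'w set \<Rightarrow>
    nat \<Rightarrow> ('w hecke \<Rightarrow> 'k::field mat) \<Rightarrow> ('w hecke \<Rightarrow> 'k mat) \<Rightarrow> bool" where
  "hecke_rep_iso W S d \<rho> \<rho>' \<longleftrightarrow>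
     (\<exists>P \<in> carrier_mat d d. invertible_mat P \<and>
        (\<forall>x\<in>carrier (hecke_alg W S). P * \<rho> x = \<rho>' x * P))"

definition irreps :: "('w, 'b) monoid_scheme \<Rightarrow> 'w set \<Rightarrow> (laurent \<Rightarrow> 'k::field) \<Rightarrow>
    ('w hecke \<Rightarrow> 'k mat) set" where
  "irreps W S \<theta> = {\<rho>. \<exists>d. hecke_irrep W S \<theta> d \<rho>}"

text \<open>Isomorphism classes of irreducible representations.\<close>

definition irrep_classes :: "('w, 'b) monoid_scheme \<Rightarrow> 'w set \<Rightarrow> (laurent \<Rightarrow> 'k::field) \<Rightarrow>
    ('w hecke \<Rightarrow> 'k mat) set set" where
  "irrep_classes W S \<theta> = irreps W S \<theta> //
     {(\<rho>, \<rho>'). \<exists>d. hecke_irrep W S \<theta> d \<rho> \<and> hecke_irrep W S \<theta> d \<rho>' \<and> hecke_rep_iso W S d \<rho> \<rho>'}"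

text \<open>The choice of a member of the class does not matter in the next two definitions.\<close>

definition irrep_dim :: "('w, 'b) monoid_scheme \<Rightarrow> 'w set \<Rightarrow>
    ('w hecke \<Rightarrow> 'k::field mat) set \<Rightarrow> nat" where
  "irrep_dim W S \<Lambda> = dim_row ((SOME \<rho>. \<rho> \<in> \<Lambda>) \<one>\<^bsub>hecke_alg W S\<^esub>)"

definition irrep_char :: "('w hecke \<Rightarrow> 'k::field mat) set \<Rightarrow> 'w hecke \<Rightarrow> 'k" where
  "irrep_char \<Lambda> x = sum_list (diag_mat ((SOME \<rho>. \<rho> \<in> \<Lambda>) x))"

text \<open>Every irreducible representation over \<open>K\<close> has only scalar endomorphisms, i.e. stays irreducible
  over every extension field of \<open>K\<close>.\<close>

definition splitting_field :: "('w, 'b) monoid_scheme \<Rightarrow> 'w set \<Rightarrow>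
    (laurent \<Rightarrow> 'k::field) \<Rightarrow> bool" where
  "splitting_field W S \<theta> \<longleftrightarrow>
     inj_comm_ring_hom \<theta> \<and>
     (\<forall>d \<rho>. hecke_irrep W S \<theta> d \<rho> \<longrightarrow>
        (\<forall>A \<in> carrier_mat d d. (\<forall>x\<in>carrier (hecke_alg W S). A * \<rho> x = \<rho> x * A)
           \<longrightarrow> (\<exists>a. A = a \<cdot>\<^sub>m 1\<^sub>m d)))"

text \<open>The values at isomorphism classes are determined uniquely, by linear independence of
  irreducible characters.\<close>

definition schur_element :: "('w, 'b) monoid_scheme \<Rightarrow> 'w set \<Rightarrow> (laurent \<Rightarrow> 'k::field) \<Rightarrow>
    ('w hecke \<Rightarrow> 'k mat) set \<Rightarrow> 'k" where
  "schur_element W S \<theta> = (SOME s.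
     (\<forall>\<Lambda> \<in> irrep_classes W S \<theta>. s \<Lambda> \<noteq> 0) \<and>
     (\<forall>x\<in>carrier (hecke_alg W S).
        \<theta> (std_trace W S x) = (\<Sum>\<Lambda> \<in> irrep_classes W S \<theta>. 1 / s \<Lambda> * irrep_char \<Lambda> x)))"

section \<open>Ciliated surfaces and triangulations\<close>

text \<open>A ciliated surface is recorded by its topological type; \<open>cilia \<Sigma> ! i\<close> is the number of
  cilia on the \<open>i\<close>-th boundary circle.\<close>

record surface =
  genus :: nat
  punctures :: nat
  cilia :: "nat list"

definition boundaries :: "surface \<Rightarrow> nat" where
  "boundaries \<Sigma> = length (cilia \<Sigma>)"

definition ciliated_surface :: "surface \<Rightarrow> bool" where
  "ciliated_surface \<Sigma> \<longleftrightarrow>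
     (let k = punctures \<Sigma>; n = boundaries \<Sigma>; c = sum_list (cilia \<Sigma>) in
       (\<forall>p \<in> set (cilia \<Sigma>). p \<ge> 1) \<and> k + n \<ge> 1 \<and>
       (genus \<Sigma> = 0 \<longrightarrow> k + n \<ge> 3 \<or> (k + n = 2 \<and> c \<ge> 1) \<or> (k + n = 1 \<and> c \<ge> 3)))"

text \<open>The segment \<open>(i, j)\<close> is the \<open>j\<close>-th one along the \<open>i\<close>-th boundary circle, in the order given by
  the induced orientation and starting from some arbitrary one.\<close>

definition segments :: "surface \<Rightarrow> (nat \<times> nat) set" where
  "segments \<Sigma> = (SIGMA i:{..<boundaries \<Sigma>}. {..<cilia \<Sigma> ! i})"

text \<open>A triangulation is a gluing of finitely many oriented triangles along sides. Face \<open>f\<close> has the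
  sides \<open>(f, 0)\<close>, \<open>(f, 1)\<close>, \<open>(f, 2)\<close> in the cyclic order of its orientation, each directed
  accordingly. The involution \<open>glue\<close> maps a side of an internal edge to the other side of this
  edge, the two being identified with reversal of direction (so the result is oriented); its fixed
  points are the external edges. Sides of the same face may be glued, as happens in a once-punctured
  monogon. The set \<open>oriented\<close> fixes the orientations of the internal edges: it contains, for every
  internal edge, the side whose direction agrees with the orientation of the edge. Finally \<open>seg\<close>
  says which side is a given boundary segment of the surface.\<close>

type_synonym 'f side = "'f \<times> nat"

record 'f triangulation =
  faces :: "'f set"
  glue :: "'f side \<Rightarrow> 'f side"
  oriented :: "'f side set"
  seg :: "nat \<times> nat \<Rightarrow> 'f side"

definition sides :: "('f, 'b) triangulation_scheme \<Rightarrow> 'f side set" where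
  "sides T = faces T \<times> {..<3}"

definition next_side :: "'f side \<Rightarrow> 'f side" where
  "next_side d = (fst d, (snd d + 1) mod 3)"

definition external :: "('f, 'b) triangulation_scheme \<Rightarrow> 'f side set" where
  "external T = {d \<in> sides T. glue T d = d}"

definition internal :: "('f, 'b) triangulation_scheme \<Rightarrow> 'f side set" where
  "internal T = {d \<in> sides T. glue T d \<noteq> d}"

definition edges :: "('f, 'b) triangulation_scheme \<Rightarrow> 'f side set set" where
  "edges T = (\<lambda>d. {d, glue T d}) ` sides T"

text \<open>A corner of a face is represented by the side starting at it. If \<open>d\<close> is internal, then
  \<open>glue T d\<close> ends where \<open>d\<close> starts, hence so does the side after \<open>glue T d\<close> start. Vertices are the
  classes of corners under the equivalence relation generated by these identifications.\<close>

definition same_vertex :: "('f, 'b) triangulation_scheme \<Rightarrow> ('f side \<times> 'f side) set" where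
  "same_vertex T =
     (let r = {(d, next_side (glue T d)) | d. d \<in> internal T}
      in (r \<union> r\<inverse>)\<^sup>* \<inter> sides T \<times> sides T)"

definition vertices :: "('f, 'b) triangulation_scheme \<Rightarrow> 'f side set set" where
  "vertices T = sides T // same_vertex T"

text \<open>The external side starting where the external side \<open>d\<close> ends.\<close>

definition boundary_next :: "('f, 'b) triangulation_scheme \<Rightarrow> 'f side \<Rightarrow> 'f side" where
  "boundary_next T d = (THE e. e \<in> external T \<and> (next_side d, e) \<in> same_vertex T)"

text \<open>The vertices without external side are the punctures and the other ones are the cilia. The
  genus is read off from the Euler characteristic \<open>2 - 2g - n\<close> of the compact surface with the
  punctures filled in.\<close>

definition triangulates :: "('f, 'b) triangulation_scheme \<Rightarrow> surface \<Rightarrow> bool" where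
  "triangulates T \<Sigma> \<longleftrightarrow>
     finite (faces T) \<and> faces T \<noteq> {} \<and>
     (\<forall>d\<in>sides T. glue T d \<in> sides T \<and> glue T (glue T d) = d) \<and>
     oriented T \<subseteq> internal T \<and>
     (\<forall>d\<in>internal T. (d \<in> oriented T) \<noteq> (glue T d \<in> oriented T)) \<and>
     (\<forall>d\<in>sides T. \<forall>e\<in>sides T.
        (d, e) \<in> {(a, b). a \<in> sides T \<and> (b = next_side a \<or> b = glue T a)}\<^sup>*) \<and>
     bij_betw (seg T) (segments \<Sigma>) (external T) \<and>
     (\<forall>(i, j)\<in>segments \<Sigma>. boundary_next T (seg T (i, j)) = seg T (i, (j + 1) mod cilia \<Sigma> ! i)) \<and>
     card {V \<in> vertices T. V \<inter> external T = {}} = punctures \<Sigma> \<and>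
     int (card (vertices T)) - int (card (edges T)) + int (card (faces T))
       = 2 - 2 * int (genus \<Sigma>) - int (boundaries \<Sigma>)"

section \<open>The invariant\<close>

text \<open>The element of \<open>W\<close> read along a side, for the labels \<open>b\<close> of boundary segments and \<open>x\<close> of
  oriented internal edges.\<close>

definition side_label :: "('w, 'b) monoid_scheme \<Rightarrow> surface \<Rightarrow> ('f, 'c) triangulation_scheme \<Rightarrow>
    (nat \<times> nat \<Rightarrow> 'w) \<Rightarrow> ('f side \<Rightarrow> 'w) \<Rightarrow> 'f side \<Rightarrow> 'w" where
  "side_label W \<Sigma> T b x d =
     (if d \<in> external T then b (the_inv_into (segments \<Sigma>) (seg T) d)
      else if d \<in> oriented T then x d
      else inv\<^bsub>W\<^esub> (x (glue T d)))"

definition invariant_W :: "('w, 'b) monoid_scheme \<Rightarrow> 'w set \<Rightarrow> surface \<Rightarrow>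
    ('f, 'c) triangulation_scheme \<Rightarrow> (nat \<times> nat \<Rightarrow> 'w) \<Rightarrow> laurent" where
  "invariant_W W S \<Sigma> T b =
     (\<Sum>x \<in> oriented T \<rightarrow>\<^sub>E carrier W. \<Prod>f \<in> faces T.
        std_trace W S
          (hecke_basis W S (side_label W \<Sigma> T b x (f, 0)) \<otimes>\<^bsub>hecke_alg W S\<^esub>
           hecke_basis W S (side_label W \<Sigma> T b x (f, 1)) \<otimes>\<^bsub>hecke_alg W S\<^esub>
           hecke_basis W S (side_label W \<Sigma> T b x (f, 2))))"

text \<open>The multilinear extension to boundary labels in the Hecke algebra.\<close>

definition invariant :: "('w, 'b) monoid_scheme \<Rightarrow> 'w set \<Rightarrow> surface \<Rightarrow>
    ('f, 'c) triangulation_scheme \<Rightarrow> (nat \<times> nat \<Rightarrow> 'w hecke) \<Rightarrow> laurent" where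
  "invariant W S \<Sigma> T l =
     (\<Sum>b \<in> segments \<Sigma> \<rightarrow>\<^sub>E carrier W.
        (\<Prod>e \<in> segments \<Sigma>. hecke_coord W S (l e) (b e)) * invariant_W W S \<Sigma> T b)"

definition boundary_label :: "('w, 'b) monoid_scheme \<Rightarrow> 'w set \<Rightarrow> surface \<Rightarrow>
    (nat \<times> nat \<Rightarrow> 'w hecke) \<Rightarrow> nat \<Rightarrow> 'w hecke" where
  "boundary_label W S \<Sigma> l i =
     foldr (\<lambda>x y. x \<otimes>\<^bsub>hecke_alg W S\<^esub> y) (map (\<lambda>j. l (i, j)) [0..<cilia \<Sigma> ! i]) \<one>\<^bsub>hecke_alg W S\<^esub>"

end

theory Submission
  imports Defs
begin

text \<open>The formula is a change of basis in a lattice topological field theory. For the trace form the elements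
\<open>h\<^sub>w\<close> and \<open>h\<^sub>w\<^sub>'\<close> with \<open>w' = w\<^sup>-\<^sup>1\<close> form dual bases, so the sum over the label of an internal edge inserts the
Casimir tensor \<open>\<Sum>\<^sub>w h\<^sub>w \<otimes> h\<^sub>w\<^sub>'\<close> into the two adjacent sides. In a pair \<open>V\<^sub>\<lambda> \<otimes> V\<^sub>\<mu>\<close> of irreducible representations
this tensor is \<open>s\<^sub>\<lambda>\<close> times the flip if \<open>\<lambda> = \<mu>\<close>, and \<open>0\<close> otherwise (\<open>schur_orthogonality\<close>). On the other
hand \<open>tr = \<Sum>\<^sub>\<lambda> \<chi>\<^sub>\<lambda> / s\<^sub>\<lambda>\<close> (\<open>trace_schur\<close>) writes the trace of a face as a sum over a representation \<open>\<lambda>\<close> and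
a basis index at each of its three corners (\<open>face_trace\<close>). After the labels of the edges have been summed
over, two faces with a common edge must carry the same \<open>\<lambda>\<close>, hence all faces do, because the surface is
connected; and the indices at the two corners that meet at an end of an edge must agree, so that one index
remains per vertex (\<open>sum_glued\<close>). Each face contributes \<open>1 / s\<^sub>\<lambda>\<close> and each internal edge \<open>s\<^sub>\<lambda>\<close>; by the Euler
characteristic the total exponent is \<open>2g - 2 + k + n\<close>. The index at a puncture is free and contributes
\<open>dim V\<^sub>\<lambda>\<close>; the indices at the cilia of a boundary circle multiply the labels along it and take the trace,
which is \<open>\<chi>\<^sub>\<lambda>(h\<^sub>i)\<close> (\<open>sum_boundary\<close>).

The algebraic input is of two kinds. First, the \<open>h\<^sub>w\<close> form a basis on which the trace form is
\<open>tr (h\<^sub>x h\<^sub>y) = 1\<close> if \<open>xy = 1\<close> and \<open>0\<close> otherwise. They span by Matsumoto's theorem (\<open>matsumoto\<close>), whose proof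
counts how often a reflection occurs in a word. They are independent because the algebra acts on functions
on \<open>W\<close> by the expected formulas; the braid relations for these operators hold since they commute with the
corresponding right operators (\<open>left_ops_eqI\<close>).

Secondly, the trace is a combination of irreducible characters. The element
\<open>z = \<Sum>\<^sub>w h\<^sub>w h\<^sub>w\<^sub>'\<close> satisfies \<open>tr (x z) = \<chi>(x)\<close> for the character \<open>\<chi>\<close> of the regular representation, and \<open>\<chi>\<close>
is a sum of irreducible characters by a composition series. Multiplication by \<open>z\<close> specialises to
multiplication by \<open>|W|\<close> at \<open>v = 1\<close>, so its determinant is nonzero and \<open>y z = D\<close> for some \<open>y\<close> and some scalar
\<open>D \<noteq> 0\<close> (\<open>casimir_elt_invertible\<close>). By Schur's lemma \<open>z\<close> acts on an irreducible representation by a scalar,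
which is therefore nonzero, and dividing by it gives \<open>tr\<close>. Pairing with an irreducible character
shows that every class occurs and that its coefficient is inverse to the constant in the orthogonality
relations, which thereby is the Schur element (\<open>trace_characters\<close>, \<open>schur_element_pairing\<close>).\<close>

section \<open>Coxeter groups\<close>

(* Membership of words in lists S is kept folded, as the rewrite rules for words are stated in terms of it. *)
declare in_listsD [rule del] in_listsI [rule del]

locale coxeter_group = group W for W :: "('w, 'b) monoid_scheme" (structure) +
  fixes S :: "'w set"
  assumes coxeter: "coxeter_system W S"
begin

lemma S_carrier: "s \<in> S \<Longrightarrow> s \<in> carrier W"
  using coxeter by (auto simp: coxeter_system_def)

lemma S_ord: "s \<in> S \<Longrightarrow> ord s = 2"
  using coxeter by (auto simp: coxeter_system_def)

lemma S_square: assumes "s \<in> S" shows "s \<otimes> s = \<one>"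
  using pow_ord_eq_1[OF S_carrier[OF assms]] S_ord[OF assms] S_carrier[OF assms]
  by (simp add: numeral_2_eq_2)

lemma S_inv: assumes "s \<in> S" shows "inv s = s"
  using inv_unique'[OF S_carrier S_carrier S_square S_square] assms by simp

lemma S_cancel: assumes "s \<in> S" "x \<in> carrier W" shows "s \<otimes> (s \<otimes> x) = x"
  using assms S_carrier S_square by (metis l_one m_assoc)

lemma word_prod_Nil [simp]: "word_prod W [] = \<one>"
  and word_prod_Cons [simp]: "word_prod W (s # u) = s \<otimes> word_prod W u"
  by (simp_all add: word_prod_def)

lemma word_prod_closed [simp]: "u \<in> lists S \<Longrightarrow> word_prod W u \<in> carrier W"
  by (induction u) (auto simp: S_carrier)

lemma word_prod_append:
  "a \<in> lists S \<Longrightarrow> b \<in> lists S \<Longrightarrow> word_prod W (a @ b) = word_prod W a \<otimes> word_prod W b"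
  by (induction a) (auto simp: S_carrier m_assoc)

lemma word_prod_rev: "u \<in> lists S \<Longrightarrow> word_prod W (rev u) = inv (word_prod W u)"
proof (induction u)
  case (Cons s u)
  then have "rev u \<in> lists S" by (simp add: in_lists_conv_set)
  then show ?case using Cons word_prod_append[of "rev u" "[s]"] by (auto simp: S_carrier inv_mult_group S_inv)
qed auto

lemma word_exists: "w \<in> carrier W \<Longrightarrow> \<exists>u\<in>lists S. word_prod W u = w"
  using coxeter by (auto simp: coxeter_system_def)

lemma word_prod_eqD:
  "a \<in> lists S \<Longrightarrow> b \<in> lists S \<Longrightarrow> word_prod W a = word_prod W b \<Longrightarrow> cox_cong W S a b"
  using coxeter by (auto simp: coxeter_system_def)

definition len :: "'w \<Rightarrow> nat" where
  "len w = (LEAST n. \<exists>u\<in>lists S. word_prod W u = w \<and> length u = n)"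

lemma len_le: "u \<in> lists S \<Longrightarrow> len (word_prod W u) \<le> length u"
  unfolding len_def by (rule Least_le) auto

lemma len_word:
  assumes "w \<in> carrier W"
  obtains u where "u \<in> lists S" "word_prod W u = w" "length u = len w"
proof -
  have "\<exists>n. \<exists>u\<in>lists S. word_prod W u = w \<and> length u = n" using word_exists[OF assms] by blast
  from LeastI_ex[OF this] show ?thesis using that unfolding len_def by blast
qed

lemma reduced_iff: "reduced W S u w \<longleftrightarrow> u \<in> lists S \<and> word_prod W u = w \<and> length u = len w"
proof
  assume r: "reduced W S u w"
  have w: "w \<in> carrier W" using r word_prod_closed unfolding reduced_def by blast
  obtain u' where "u' \<in> lists S" "word_prod W u' = w" "length u' = len w" by (rule len_word[OF w])
  then have "length u \<le> len w" using r unfolding reduced_def by force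
  moreover have u: "u \<in> lists S" "word_prod W u = w" using r unfolding reduced_def by auto
  moreover have "len w \<le> length u" using len_le[OF u(1)] u(2) by simp
  ultimately show "u \<in> lists S \<and> word_prod W u = w \<and> length u = len w" by simp
next
  assume u: "u \<in> lists S \<and> word_prod W u = w \<and> length u = len w"
  have "length u \<le> length u'" if "u' \<in> lists S" "word_prod W u' = w" for u'
    using len_le[OF that(1)] that(2) u by simp
  with u show "reduced W S u w" unfolding reduced_def by blast
qed

lemma reducedD: assumes "reduced W S u w"
  shows "u \<in> lists S" "word_prod W u = w" "length u = len w" "w \<in> carrier W"
  using assms unfolding reduced_iff by auto

lemma reduced_exists: "w \<in> carrier W \<Longrightarrow> \<exists>u. reduced W S u w"
  using len_word reduced_iff by metis

lemma len_one [simp]: "len \<one> = 0"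
  using len_le[of "[]"] by simp

lemma len_inv [simp]: assumes "w \<in> carrier W" shows "len (inv w) = len w"
proof -
  have *: "len (inv x) \<le> len x" if x: "x \<in> carrier W" for x
  proof -
    obtain u where u: "u \<in> lists S" "word_prod W u = x" "length u = len x" by (rule len_word[OF x])
    have "rev u \<in> lists S" using u by (simp add: in_lists_conv_set)
    from len_le[OF this] show ?thesis using u word_prod_rev by simp
  qed
  from *[of w] *[of "inv w"] assms show ?thesis by simp
qed

lemma len_mult_le: assumes "x \<in> carrier W" "y \<in> carrier W" shows "len (x \<otimes> y) \<le> len x + len y"
proof -
  obtain u where u: "u \<in> lists S" "word_prod W u = x" "length u = len x" by (rule len_word[OF assms(1)])
  obtain v where v: "v \<in> lists S" "word_prod W v = y" "length v = len y" by (rule len_word[OF assms(2)])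
  have "u @ v \<in> lists S" using u v by auto
  from len_le[OF this] show ?thesis using u v word_prod_append by simp
qed

lemma len_S_le: "s \<in> S \<Longrightarrow> len s \<le> 1"
  using len_le[of "[s]"] by (auto simp: S_carrier)

lemma length_concat_pair: "length (concat (replicate m [s, t])) = 2 * m"
  by (induction m) auto

text \<open>Relators have even length, so the parity of the length of a word depends only on the group element.
  Hence a generator changes the length of an element by exactly one.\<close>

lemma cox_cong_parity: "cox_cong W S a b \<Longrightarrow> even (length a) = even (length b)"
  by (induction rule: cox_cong.induct) (auto simp: length_concat_pair)

lemma len_S_mult: assumes "s \<in> S" "w \<in> carrier W"
  shows "len (s \<otimes> w) = Suc (len w) \<or> len w = Suc (len (s \<otimes> w))"
proof -
  have sw: "s \<otimes> w \<in> carrier W" using assms S_carrier by auto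
  obtain u where u: "u \<in> lists S" "word_prod W u = w" "length u = len w" by (rule len_word[OF assms(2)])
  obtain v where v: "v \<in> lists S" "word_prod W v = s \<otimes> w" "length v = len (s \<otimes> w)" by (rule len_word[OF sw])
  have "cox_cong W S (s # u) v" by (rule word_prod_eqD) (use u v assms in auto)
  from cox_cong_parity[OF this] have "even (Suc (len w)) = even (len (s \<otimes> w))" using u v by simp
  then have "len (s \<otimes> w) \<noteq> len w" by fastforce
  moreover have "len (s \<otimes> w) \<le> Suc (len w)"
    using len_mult_le[OF S_carrier assms(2), of s] len_S_le assms by fastforce
  moreover have "len w \<le> Suc (len (s \<otimes> w))"
    using len_mult_le[OF S_carrier sw, of s] len_S_le assms S_cancel by fastforce
  ultimately show ?thesis by linarith
qed

lemma len_mult_S: assumes "s \<in> S" "w \<in> carrier W"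
  shows "len (w \<otimes> s) = Suc (len w) \<or> len w = Suc (len (w \<otimes> s))"
proof -
  have "inv (w \<otimes> s) = s \<otimes> inv w" using assms S_inv S_carrier by (simp add: inv_mult_group)
  then have "len (w \<otimes> s) = len (s \<otimes> inv w)" using len_inv[of "w \<otimes> s"] assms S_carrier by simp
  then show ?thesis using len_S_mult[OF assms(1), of "inv w"] assms by simp
qed

text \<open>The reflections of a word \<open>s\<^sub>1\<dots>s\<^sub>k\<close> are the \<open>k\<close> elements \<open>s\<^sub>1\<dots>s\<^sub>i\<dots>s\<^sub>1\<close>. The predicate says that \<open>x\<close> occurs
  an odd number of times among them; removing the first letter conjugates the remaining reflections by it.\<close>

fun odd_inv :: "'w list \<Rightarrow> 'w \<Rightarrow> bool" where
  "odd_inv [] x = False"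
| "odd_inv (s # u) x = ((x = s) \<noteq> odd_inv u (s \<otimes> x \<otimes> s))"

lemma odd_inv_append:
  assumes "a \<in> lists S" "b \<in> lists S" "x \<in> carrier W"
  shows "odd_inv (a @ b) x = (odd_inv a x \<noteq> odd_inv b (inv (word_prod W a) \<otimes> x \<otimes> word_prod W a))"
  using assms
proof (induction a arbitrary: x)
  case (Cons s a)
  then have s: "s \<in> S" "s \<in> carrier W" and a: "a \<in> lists S" and p: "word_prod W a \<in> carrier W"
    using S_carrier by auto
  have "inv (s \<otimes> word_prod W a) \<otimes> x \<otimes> (s \<otimes> word_prod W a)
    = inv (word_prod W a) \<otimes> (s \<otimes> x \<otimes> s) \<otimes> word_prod W a"
    using s p Cons.prems by (simp add: inv_mult_group S_inv m_assoc)
  then show ?case using Cons.IH[of "s \<otimes> x \<otimes> s"] Cons.prems s a by auto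
qed auto

lemma alternating_lists: "s \<in> S \<Longrightarrow> t \<in> S \<Longrightarrow> alternating s t k \<in> lists S"
  by (induction k arbitrary: s t) auto

lemma alternating_length [simp]: "length (alternating s t k) = k"
  by (induction k arbitrary: s t) auto

lemma concat_alternating: "concat (replicate m [s, t]) = alternating s t (2 * m)"
  by (induction m) auto

lemma word_prod_alternating_even:
  assumes "s \<in> S" "t \<in> S"
  shows "word_prod W (alternating s t (2 * m)) = (s \<otimes> t) [^] m"
proof (induction m)
  case (Suc m)
  then show ?case using assms nat_pow_Suc2[of "s \<otimes> t" m] S_carrier by (simp add: m_assoc)
qed auto

lemma reflection_conj:
  assumes "s \<in> S" "t \<in> S" "x \<in> carrier W"
  shows "(s \<otimes> x \<otimes> s = (t \<otimes> s) [^] (i::nat) \<otimes> t) \<longleftrightarrow> (x = (s \<otimes> t) [^] Suc i \<otimes> s)"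
proof -
  have c: "s \<in> carrier W" "t \<in> carrier W" using assms S_carrier by auto
  have *: "(t \<otimes> s) [^] (i::nat) \<otimes> t = t \<otimes> (s \<otimes> t) [^] i" for i
  proof (induction i)
    case (Suc i)
    have "(t \<otimes> s) [^] Suc i \<otimes> t = (t \<otimes> s) \<otimes> ((t \<otimes> s) [^] i \<otimes> t)"
      using c by (subst nat_pow_Suc2) (auto simp: m_assoc)
    also have "\<dots> = t \<otimes> ((s \<otimes> t) \<otimes> (s \<otimes> t) [^] i)" using c by (subst Suc) (auto simp: m_assoc)
    finally show ?case using c by (simp only: nat_pow_Suc2[symmetric] m_closed)
  qed (use c in auto)
  have "s \<otimes> ((t \<otimes> s) [^] i \<otimes> t) \<otimes> s = (s \<otimes> t) [^] Suc i \<otimes> s"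
    using c unfolding * by (subst nat_pow_Suc2) (auto simp: m_assoc)
  moreover have "s \<otimes> (s \<otimes> x \<otimes> s) \<otimes> s = x" using assms c by (simp add: m_assoc S_cancel S_square)
  moreover have "s \<otimes> (s \<otimes> ((t \<otimes> s) [^] i \<otimes> t) \<otimes> s) \<otimes> s = (t \<otimes> s) [^] i \<otimes> t"
    using assms c by (simp add: m_assoc S_cancel S_square)
  ultimately show ?thesis by metis
qed

text \<open>The reflections of \<open>s t s t\<dots>\<close> are the elements \<open>(st)\<^sup>i s\<close>.\<close>

lemma odd_inv_alternating:
  assumes "s \<in> S" "t \<in> S" "x \<in> carrier W"
  shows "odd_inv (alternating s t k) x
    = odd (\<Sum>i<k. of_bool (x = (s \<otimes> t) [^] i \<otimes> s) :: nat)"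
  using assms
proof (induction k arbitrary: s t x)
  case (Suc k)
  have c: "s \<in> carrier W" "s \<otimes> x \<otimes> s \<in> carrier W" using Suc.prems S_carrier by auto
  have "odd_inv (alternating t s k) (s \<otimes> x \<otimes> s)
      = odd (\<Sum>i<k. of_bool (x = (s \<otimes> t) [^] Suc i \<otimes> s) :: nat)"
    using Suc.IH[OF Suc.prems(2,1) c(2)] reflection_conj[OF Suc.prems] by simp
  then show ?case using c by (simp add: sum.lessThan_Suc_shift del: nat_pow_Suc sum.lessThan_Suc)
qed auto

text \<open>The word \<open>(st)\<^sup>m\<close> has the reflections \<open>(st)\<^sup>i s\<close> for \<open>i < 2m\<close>, and those for \<open>i\<close> and \<open>i + m\<close> coincide. This is why
  the parity \<open>odd_inv\<close> is an invariant of the group element (\<open>odd_inv_cong\<close> below).\<close>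

lemma odd_inv_relator:
  assumes "s \<in> S" "t \<in> S" "x \<in> carrier W"
  shows "\<not> odd_inv (concat (replicate (cox_m W s t) [s, t])) x"
proof -
  let ?m = "cox_m W s t"
  have c: "s \<in> carrier W" "t \<in> carrier W" using assms S_carrier by auto
  have m: "(s \<otimes> t) [^] ?m = \<one>" unfolding cox_m_def using c by (intro pow_ord_eq_1) auto
  have p: "(s \<otimes> t) [^] (i + ?m) = (s \<otimes> t) [^] i" for i :: nat
    using c m by (simp add: nat_pow_mult[symmetric])
  let ?g = "\<lambda>i. of_bool (x = (s \<otimes> t) [^] i \<otimes> s) :: nat"
  have "(\<Sum>i<2 * ?m. ?g i) = (\<Sum>i<?m. ?g i) + (\<Sum>i<?m. ?g (i + ?m))"
    using sum.atLeastLessThan_concat[of 0 ?m "?m + ?m" ?g] sum.shift_bounds_nat_ivl[of ?g 0 ?m ?m]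
    unfolding mult_2 lessThan_atLeast0 by simp
  then have "(\<Sum>i<2 * ?m. ?g i) = 2 * (\<Sum>i<?m. ?g i)" unfolding p by simp
  then show ?thesis unfolding concat_alternating odd_inv_alternating[OF assms] by simp
qed

lemma word_prod_relator:
  assumes "s \<in> S" "t \<in> S" shows "word_prod W (concat (replicate (cox_m W s t) [s, t])) = \<one>"
  unfolding concat_alternating word_prod_alternating_even[OF assms] cox_m_def
  using assms S_carrier by (intro pow_ord_eq_1) auto

lemma cox_cong_odd_inv: "cox_cong W S a b \<Longrightarrow> x \<in> carrier W \<Longrightarrow> odd_inv a x = odd_inv b x"
proof (induction rule: cox_cong.induct)
  case (relator s t a b)
  let ?r = "concat (replicate (cox_m W s t) [s, t])"
  have r: "?r \<in> lists S" using relator unfolding concat_alternating by (intro alternating_lists)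
  have p: "word_prod W a \<in> carrier W" using relator by auto
  then have "\<not> odd_inv ?r (inv (word_prod W a) \<otimes> x \<otimes> word_prod W a)"
    using odd_inv_relator[OF relator(1,2)] relator by simp
  then have "odd_inv (a @ ?r @ b) x = (odd_inv a x \<noteq> odd_inv b (inv (word_prod W a) \<otimes> x \<otimes> word_prod W a))"
    using odd_inv_append[of a "?r @ b" x] relator r p word_prod_relator[OF relator(1,2)]
    by (simp add: odd_inv_append[OF r])
  then show ?case using relator odd_inv_append[of a b] by simp
qed auto

lemma odd_inv_cong:
  assumes "a \<in> lists S" "b \<in> lists S" "word_prod W a = word_prod W b" "x \<in> carrier W"
  shows "odd_inv a x = odd_inv b x"
  using cox_cong_odd_inv word_prod_eqD assms by blast

text \<open>Strong exchange: multiplication by the \<open>i\<close>-th reflection of a word deletes its \<open>i\<close>-th letter.\<close>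

lemma odd_inv_delete:
  assumes "u \<in> lists S" "x \<in> carrier W" "odd_inv u x"
  shows "\<exists>v\<in>lists S. Suc (length v) = length u \<and> x \<otimes> word_prod W u = word_prod W v"
  using assms
proof (induction u arbitrary: x)
  case (Cons s u)
  then have c: "s \<in> S" "s \<in> carrier W" "u \<in> lists S" "word_prod W u \<in> carrier W" using S_carrier by auto
  show ?case
  proof (cases "x = s")
    case True
    then show ?thesis using c by (intro bexI[of _ u]) (auto simp: S_cancel)
  next
    case False
    then have "odd_inv u (s \<otimes> x \<otimes> s)" using Cons.prems by simp
    then obtain v where v: "v \<in> lists S" "Suc (length v) = length u"
      "(s \<otimes> x \<otimes> s) \<otimes> word_prod W u = word_prod W v"
      using Cons.IH[of "s \<otimes> x \<otimes> s"] Cons.prems c by auto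
    have "x \<otimes> (s \<otimes> word_prod W u) = s \<otimes> ((s \<otimes> x \<otimes> s) \<otimes> word_prod W u)"
      using c Cons.prems by (simp add: m_assoc S_cancel)
    then show ?thesis using v c by (intro bexI[of _ "s # v"]) auto
  qed
qed auto

text \<open>If \<open>s\<close> occurs among the reflections of a reduced word, deleting a letter shows that \<open>s\<close> is a descent. If it
  occurs an even number of times, it occurs an odd number of times for \<open>s w\<close>, and so \<open>s w\<close> has the descent \<open>s\<close>.\<close>

lemma descent_iff_odd_inv:
  assumes "s \<in> S" "u \<in> lists S"
  shows "odd_inv u s \<longleftrightarrow> len (s \<otimes> word_prod W u) < len (word_prod W u)"
proof -
  have s: "s \<in> carrier W" using assms S_carrier by auto
  have *: "len (s \<otimes> word_prod W u) < len (word_prod W u)" if hu: "odd_inv u s" "u \<in> lists S" for u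
  proof -
    obtain u' where u': "u' \<in> lists S" "word_prod W u' = word_prod W u" "length u' = len (word_prod W u)"
      by (rule len_word[OF word_prod_closed[OF hu(2)]])
    then have "odd_inv u' s" using odd_inv_cong[OF u'(1) hu(2) _ s] hu(1) by simp
    from odd_inv_delete[OF u'(1) s this] obtain v where v: "v \<in> lists S" "Suc (length v) = length u'"
      "s \<otimes> word_prod W u' = word_prod W v" by blast
    then show ?thesis using u' len_le[OF v(1)] by simp
  qed
  show ?thesis
  proof
    assume l: "len (s \<otimes> word_prod W u) < len (word_prod W u)"
    show "odd_inv u s"
    proof (rule ccontr)
      assume "\<not> odd_inv u s"
      then have "odd_inv (s # u) s" using s assms by (simp add: S_square)
      from *[OF this] l assms show False by (simp add: S_cancel)
    qed
  qed (use * assms in auto)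
qed

text \<open>The reflections of \<open>w t\<close> are those of \<open>w\<close> and the element \<open>w t w\<^sup>-\<^sup>1\<close>, so only \<open>s = w t w\<^sup>-\<^sup>1\<close> can change its parity.
  This is the fact behind the commutation of left and right operators on the regular representation.\<close>

lemma descent_change_left:
  assumes "s \<in> S" "t \<in> S" "w \<in> carrier W"
    and "(len (s \<otimes> w) < len w) \<noteq> (len (s \<otimes> w \<otimes> t) < len (w \<otimes> t))"
  shows "s \<otimes> w = w \<otimes> t"
proof -
  have c: "s \<in> carrier W" "t \<in> carrier W" using assms S_carrier by auto
  obtain u where u: "u \<in> lists S" "word_prod W u = w" using word_exists[OF assms(3)] by blast
  have ut: "u @ [t] \<in> lists S" "word_prod W (u @ [t]) = w \<otimes> t" using u assms c by (auto simp: word_prod_append)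
  have "odd_inv u s \<noteq> odd_inv (u @ [t]) s"
    using descent_iff_odd_inv[OF assms(1) u(1)] descent_iff_odd_inv[OF assms(1) ut(1)] assms(4) u ut c assms(3)
    by (simp add: m_assoc)
  then have "inv w \<otimes> s \<otimes> w = t" using odd_inv_append[of u "[t]" s] u assms c by auto
  then have "w \<otimes> t = w \<otimes> (inv w \<otimes> (s \<otimes> w))" using assms c by (simp add: m_assoc)
  then show ?thesis using assms c by (simp add: m_assoc[symmetric])
qed

lemma descent_change_right:
  assumes "s \<in> S" "t \<in> S" "w \<in> carrier W"
    and "(len (w \<otimes> t) < len w) \<noteq> (len (s \<otimes> w \<otimes> t) < len (s \<otimes> w))"
  shows "s \<otimes> w = w \<otimes> t"
proof -
  have c: "s \<in> carrier W" "t \<in> carrier W" using assms S_carrier by auto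
  have i: "inv (w \<otimes> t) = t \<otimes> inv w" "inv (s \<otimes> w) = inv w \<otimes> s" "inv (s \<otimes> w \<otimes> t) = t \<otimes> inv w \<otimes> s"
    using assms c by (simp_all add: inv_mult_group S_inv m_assoc)
  have "(len (t \<otimes> inv w) < len (inv w)) \<noteq> (len (t \<otimes> inv w \<otimes> s) < len (inv w \<otimes> s))"
    using assms c len_inv[of w] len_inv[of "w \<otimes> t"] len_inv[of "s \<otimes> w"] len_inv[of "s \<otimes> w \<otimes> t"]
    unfolding i by simp
  from descent_change_left[OF assms(2,1) _ this] have "t \<otimes> inv w = inv w \<otimes> s" using assms by simp
  then show ?thesis using i assms c by (metis inv_inv m_closed inv_closed)
qed

lemma cox_m_commute: assumes "s \<in> S" "t \<in> S" shows "cox_m W s t = cox_m W t s"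
proof -
  have "inv (s \<otimes> t) = t \<otimes> s" using assms S_carrier S_inv by (simp add: inv_mult_group)
  then show ?thesis unfolding cox_m_def using ord_inv[of "s \<otimes> t"] assms S_carrier by auto
qed

lemma cox_pow_neq_one: assumes "s \<in> S" "t \<in> S" "0 < j" "j < cox_m W s t"
  shows "(s \<otimes> t) [^] j \<noteq> \<one>"
proof
  assume "(s \<otimes> t) [^] j = \<one>"
  then have "cox_m W s t dvd j" unfolding cox_m_def using assms S_carrier by (intro pow_eq_id[THEN iffD1]) auto
  then show False using assms by (auto dest: dvd_imp_le)
qed

text \<open>The letter \<open>s\<close> put in front of \<open>t s t\<dots>\<close> increases the length, since \<open>s = (ts)\<^sup>i t\<close> would give
  \<open>(ts)\<^bsup>i+1\<^esup> = 1\<close> with \<open>i + 1\<close> less than the order.\<close>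

lemma len_alternating:
  assumes "s \<in> S" "t \<in> S" "k \<le> cox_m W s t"
  shows "len (word_prod W (alternating s t k)) = k"
  using assms
proof (induction k arbitrary: s t)
  case (Suc k)
  have c: "s \<in> carrier W" "t \<in> carrier W" using Suc.prems S_carrier by auto
  let ?a = "alternating t s k"
  have a: "?a \<in> lists S" using alternating_lists Suc.prems by auto
  have IH: "len (word_prod W ?a) = k" using Suc cox_m_commute by auto
  have "s \<noteq> (t \<otimes> s) [^] i \<otimes> t" if "i < k" for i
  proof
    assume "s = (t \<otimes> s) [^] i \<otimes> t"
    then have "s \<otimes> s = (t \<otimes> s) [^] Suc i" using c by (metis m_assoc m_closed nat_pow_Suc nat_pow_closed)
    then have "(t \<otimes> s) [^] Suc i = \<one>" using Suc.prems S_square by simp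
    then show False using cox_pow_neq_one[of t s "Suc i"] Suc.prems that cox_m_commute[of s t] by auto
  qed
  then have z: "(\<Sum>i<k. of_bool (s = (t \<otimes> s) [^] i \<otimes> t) :: nat) = 0" by (intro sum.neutral) auto
  have "\<not> odd_inv ?a s" unfolding odd_inv_alternating[OF Suc.prems(2,1) c(1)] z by simp
  then have "\<not> len (s \<otimes> word_prod W ?a) < len (word_prod W ?a)"
    using descent_iff_odd_inv[OF Suc.prems(1) a] by simp
  then show ?case using len_S_mult[OF Suc.prems(1), of "word_prod W ?a"] a IH by auto
qed auto

lemma word_prod_alternating_braid:
  assumes "s \<in> S" "t \<in> S"
  shows "word_prod W (alternating s t (cox_m W s t)) = word_prod W (alternating t s (cox_m W s t))"
proof -
  let ?m = "cox_m W s t"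
  have *: "alternating s t (k + l) = alternating s t k @ (if even k then alternating s t l else alternating t s l)"
    for k l and s t :: 'w
    by (induction k arbitrary: s t) auto
  have r: "rev (alternating t s k) = (if even k then alternating s t k else alternating t s k)" for k and s t :: 'w
  proof (induction k arbitrary: s t)
    case (Suc k)
    have "s # alternating t s k = alternating s t k @ (if even k then [s] else [t])"
       "t # alternating s t k = alternating t s k @ (if even k then [t] else [s])"
      using *[of s t k 1] *[of t s k 1] by simp_all
    then show ?case using Suc[of t s] by auto
  qed auto
  let ?a = "alternating s t ?m" and ?b = "alternating t s ?m"
  have l: "?a \<in> lists S" "?b \<in> lists S" "rev ?b \<in> lists S"
    using alternating_lists assms unfolding r by auto
  have "word_prod W (?a @ rev ?b) = word_prod W (alternating s t (2 * ?m))"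
    unfolding mult_2 * r by simp
  also have "\<dots> = \<one>" using word_prod_relator[OF assms] by (simp add: concat_alternating)
  finally have "word_prod W ?a \<otimes> inv (word_prod W ?b) = \<one>" using l word_prod_append word_prod_rev by simp
  then show ?thesis using l by (metis inv_equality inv_inv word_prod_closed inv_closed)
qed

text \<open>Let \<open>w\<close> have a reduced word with an alternating prefix \<open>p = s t s\<dots>\<close> of length \<open>k\<close>. As \<open>t\<close> is a descent, it is a
  reflection of this word, but not one of \<open>p\<close> as long as \<open>k < m(s,t)\<close>. So deleting the corresponding letter
  of the rest and putting \<open>t\<close> in front gives a reduced word whose alternating prefix is longer by one.\<close>

lemma two_descents:
  assumes "s \<in> S" "t \<in> S" "s \<noteq> t" "w \<in> carrier W"
    and "len (s \<otimes> w) < len w" "len (t \<otimes> w) < len w" "0 < k" "k \<le> cox_m W s t"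
  shows "\<exists>x. reduced W S (alternating s t k @ x) w \<or> reduced W S (alternating t s k @ x) w"
  using assms(7,8)
proof (induction k)
  case (Suc k)
  show ?case
  proof (cases "k = 0")
    case True
    have "s \<otimes> w \<in> carrier W" using assms S_carrier by auto
    then obtain x where x: "x \<in> lists S" "word_prod W x = s \<otimes> w" "length x = len (s \<otimes> w)" by (rule len_word)
    have "len w = Suc (len (s \<otimes> w))" using assms(5) len_S_mult[OF assms(1,4)] by linarith
    then have "reduced W S ([s] @ x) w" unfolding reduced_iff
      using x assms(1) S_cancel[OF assms(1,4)] by simp
    then show ?thesis using True by auto
  next
    case False
    have step: "\<exists>y. reduced W S (alternating t s (Suc k) @ y) w"
      if r: "reduced W S (alternating s t k @ x) w" and st: "s \<in> S" "t \<in> S" "len (t \<otimes> w) < len w"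
       "k < cox_m W s t" for s t x
    proof -
      let ?a = "alternating s t k" and ?p = "word_prod W (alternating s t k)"
      have c: "s \<in> carrier W" "t \<in> carrier W" using st S_carrier by auto
      have a: "?a \<in> lists S" "?p \<in> carrier W" using st alternating_lists by auto
      have x: "x \<in> lists S" "word_prod W (?a @ x) = w" "k + length x = len w"
        using reducedD[OF r] by simp_all
      have px: "word_prod W x \<in> carrier W" using x(1) by (rule word_prod_closed)
      have "t \<noteq> (s \<otimes> t) [^] i \<otimes> s" if "i < k" for i
      proof
        assume "t = (s \<otimes> t) [^] i \<otimes> s"
        then have "t \<otimes> t = (s \<otimes> t) [^] Suc i" using c by (metis m_assoc m_closed nat_pow_Suc nat_pow_closed)
        then have "(s \<otimes> t) [^] Suc i = \<one>" using st S_square by simp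
        then show False using cox_pow_neq_one[of s t "Suc i"] st that by auto
      qed
      then have z: "(\<Sum>i<k. of_bool (t = (s \<otimes> t) [^] i \<otimes> s) :: nat) = 0" by (intro sum.neutral) auto
      have "\<not> odd_inv ?a t" unfolding odd_inv_alternating[OF st(1,2) c(2)] z by simp
      moreover have "odd_inv (?a @ x) t"
        using descent_iff_odd_inv[OF st(2) reducedD(1)[OF r]] st(3) unfolding x(2) by blast
      ultimately have "odd_inv x (inv ?p \<otimes> t \<otimes> ?p)" using odd_inv_append[OF a(1) x(1) c(2)] by simp
      then obtain y where y: "y \<in> lists S" "Suc (length y) = length x"
        "(inv ?p \<otimes> t \<otimes> ?p) \<otimes> word_prod W x = word_prod W y"
        using odd_inv_delete[OF x(1), of "inv ?p \<otimes> t \<otimes> ?p"] a(2) c by auto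
      have "word_prod W (alternating t s (Suc k) @ y) = t \<otimes> (?p \<otimes> word_prod W y)"
        using a c word_prod_append[OF a(1) y(1)] word_prod_closed[OF y(1)] by simp
      also have "?p \<otimes> word_prod W y = t \<otimes> (?p \<otimes> word_prod W x)"
        unfolding y(3)[symmetric] using a(2) c px by (simp add: m_assoc[symmetric])
      also have "?p \<otimes> word_prod W x = w" using x(2) word_prod_append[OF a(1) x(1)] by simp
      finally have "word_prod W (alternating t s (Suc k) @ y) = w" using S_cancel[OF st(2) assms(4)] by simp
      moreover have "alternating t s (Suc k) @ y \<in> lists S" using y(1) st(2) a(1) by simp
      ultimately have "reduced W S (alternating t s (Suc k) @ y) w"
        unfolding reduced_iff using y(2) x(3) by simp
      then show ?thesis by blast
    qed
    from Suc False obtain x where "reduced W S (alternating s t k @ x) w \<or> reduced W S (alternating t s k @ x) w" by auto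
    moreover have "k < cox_m W s t" "k < cox_m W t s" using Suc.prems cox_m_commute[OF assms(1,2)] by simp_all
    ultimately show ?thesis using step[OF _ assms(1,2,6)] step[OF _ assms(2,1,5)] by blast
  qed
qed auto

lemma reduced_Cons:
  assumes "reduced W S (s # u) w"
  shows "s \<in> S" "reduced W S u (s \<otimes> w)" "len (s \<otimes> w) < len w"
proof -
  from reducedD[OF assms] have u: "s \<in> S" "u \<in> lists S" "s \<otimes> word_prod W u = w" "Suc (length u) = len w"
    "w \<in> carrier W" by simp_all
  then have "s \<otimes> w = word_prod W u" using S_cancel[OF u(1) word_prod_closed[OF u(2)]] by simp
  moreover have "len (word_prod W u) = length u"
    using len_le[OF u(2)] len_S_mult[OF u(1) word_prod_closed[OF u(2)]] u(3,4) by auto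
  ultimately show "s \<in> S" "reduced W S u (s \<otimes> w)" "len (s \<otimes> w) < len w"
    using u(1,2,4) unfolding reduced_iff by simp_all
qed

text \<open>Reduced words of the same element are connected by braid moves; \<open>f\<close> is any function on words that is invariant
  under braid moves at the front and compatible with adding a letter in front. If the words begin with
  \<open>s \<noteq> t\<close>, both letters are descents, so that \<open>two_descents\<close> provides reduced words that begin with the two
  sides of the braid relation; these are compared to the given words by induction, after removal of the first letter.\<close>

theorem matsumoto:
  assumes cong: "\<And>s a b. s \<in> S \<Longrightarrow> a \<in> lists S \<Longrightarrow> b \<in> lists S \<Longrightarrow> f a = f b \<Longrightarrow> f (s # a) = f (s # b)"
    and braid: "\<And>s t a. s \<in> S \<Longrightarrow> t \<in> S \<Longrightarrow> a \<in> lists S \<Longrightarrow> cox_m W s t \<noteq> 0 \<Longrightarrow>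
       f (alternating s t (cox_m W s t) @ a) = f (alternating t s (cox_m W s t) @ a)"
    and fin: "finite (carrier W)"
    and "reduced W S u w" "reduced W S v w"
  shows "f u = f v"
  using assms(4,5)
proof (induction "len w" arbitrary: w u v rule: less_induct)
  case less
  note l = reducedD[OF less.prems(1)] reducedD[OF less.prems(2)]
  show ?case
  proof (cases u)
    case Nil
    then show ?thesis using l by auto
  next
    case (Cons s u')
    then obtain t v' where v: "v = t # v'" using l by (cases v) auto
    note u = Cons
    have su: "s \<in> S" "reduced W S u' (s \<otimes> w)" "len (s \<otimes> w) < len w"
      using reduced_Cons less.prems(1) unfolding u by auto
    have tv: "t \<in> S" "reduced W S v' (t \<otimes> w)" "len (t \<otimes> w) < len w"
      using reduced_Cons less.prems(2) unfolding v by auto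
    show ?thesis
    proof (cases "s = t")
      case True
      then have "reduced W S v' (s \<otimes> w)" using tv(2) by simp
      then have "f u' = f v'" by (rule less.hyps[OF su(3) su(2)])
      then show ?thesis using cong[OF su(1) reducedD(1)[OF su(2)] reducedD(1)[OF tv(2)]]
        unfolding u v True by simp
    next
      case False
      let ?m = "cox_m W s t"
      have c: "s \<in> carrier W" "t \<in> carrier W" using su tv S_carrier by auto
      have m: "?m \<noteq> 0" unfolding cox_m_def using fin c ord_ge_1[OF fin, of "s \<otimes> t"] by auto
      obtain x where "reduced W S (alternating s t ?m @ x) w \<or> reduced W S (alternating t s ?m @ x) w"
        using two_descents[OF su(1) tv(1) False l(4) su(3) tv(3), of ?m] m by auto
      moreover have "reduced W S (alternating s t ?m @ x) w \<longleftrightarrow> reduced W S (alternating t s ?m @ x) w"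
        using su(1) tv(1) unfolding reduced_iff
        using word_prod_append[OF alternating_lists[OF su(1) tv(1)], of x ?m]
          word_prod_append[OF alternating_lists[OF tv(1) su(1)], of x ?m]
          alternating_lists[OF su(1) tv(1), of ?m] alternating_lists[OF tv(1) su(1), of ?m]
          word_prod_alternating_braid[OF su(1) tv(1)]
        by auto
      ultimately have r: "reduced W S (alternating s t ?m @ x) w" "reduced W S (alternating t s ?m @ x) w" by auto
      obtain k where k: "?m = Suc k" using m by (cases ?m) auto
      have rs: "reduced W S (alternating t s k @ x) (s \<otimes> w)"
        using reduced_Cons(2)[of s "alternating t s k @ x" w] r(1) k by simp
      have rt: "reduced W S (alternating s t k @ x) (t \<otimes> w)"
        using reduced_Cons(2)[of t "alternating s t k @ x" w] r(2) k by simp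
      have x: "x \<in> lists S" using reducedD(1)[OF r(1)] by simp
      have "f (s # u') = f (s # (alternating t s k @ x))"
        by (rule cong[OF su(1) reducedD(1)[OF su(2)] reducedD(1)[OF rs] less.hyps[OF su(3) su(2) rs]])
      also have "\<dots> = f (t # (alternating s t k @ x))"
        using braid[OF su(1) tv(1) x m] k by simp
      also have "\<dots> = f (t # v')"
        by (rule cong[OF tv(1) reducedD(1)[OF rt] reducedD(1)[OF tv(2)] less.hyps[OF tv(3) rt tv(2)]])
      finally show ?thesis unfolding u v .
    qed
  qed
qed

end

section \<open>The free algebra\<close>

text \<open>The value at \<open>f\<close> of the linear extension of \<open>F\<close> from words to the free algebra.\<close>

definition pair_sum :: "('s list \<Rightarrow> laurent) \<Rightarrow> ('s list \<Rightarrow> laurent) \<Rightarrow> laurent" where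
  "pair_sum f F = (\<Sum>u | f u \<noteq> 0. f u * F u)"

lemma pair_sum_superset:
  assumes "finite C" "{u. f u \<noteq> 0} \<subseteq> C" shows "pair_sum f F = (\<Sum>u\<in>C. f u * F u)"
  unfolding pair_sum_def using assms by (intro sum.mono_neutral_left) auto

lemma free_alg_carrier: "f \<in> carrier (free_alg S) \<longleftrightarrow> finite {u. f u \<noteq> 0} \<and> {u. f u \<noteq> 0} \<subseteq> lists S"
  by (simp add: free_alg_def)

lemma free_alg_mult: "f \<otimes>\<^bsub>free_alg S\<^esub> g = (\<lambda>u. \<Sum>i\<le>length u. f (take i u) * g (drop i u))"
  and free_alg_add: "f \<oplus>\<^bsub>free_alg S\<^esub> g = (\<lambda>u. f u + g u)"
  and free_alg_one: "\<one>\<^bsub>free_alg S\<^esub> = monomial 1 []"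
  and free_alg_zero: "\<zero>\<^bsub>free_alg S\<^esub> = (\<lambda>u. 0)"
  by (simp_all add: free_alg_def monomial_def)

lemma pair_sum_add:
  assumes "finite {u. f u \<noteq> 0}" "finite {u. g u \<noteq> 0}"
  shows "pair_sum (\<lambda>u. f u + g u) F = pair_sum f F + pair_sum g F"
proof -
  let ?C = "{u. f u \<noteq> 0} \<union> {u. g u \<noteq> 0}"
  have "pair_sum h F = (\<Sum>u\<in>?C. h u * F u)" if "{u. h u \<noteq> 0} \<subseteq> ?C" for h
    using assms that by (intro pair_sum_superset) auto
  note * = this
  have 1: "{u. f u + g u \<noteq> 0} \<subseteq> ?C" "{u. f u \<noteq> 0} \<subseteq> ?C" "{u. g u \<noteq> 0} \<subseteq> ?C" by auto
  show ?thesis unfolding *[OF 1(1)] *[OF 1(2)] *[OF 1(3)] by (simp add: sum.distrib distrib_right)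
qed

lemma pair_sum_diff:
  assumes "finite {u. f u \<noteq> 0}" "finite {u. g u \<noteq> 0}"
  shows "pair_sum (\<lambda>u. f u - g u) F = pair_sum f F - pair_sum g F"
proof -
  let ?C = "{u. f u \<noteq> 0} \<union> {u. g u \<noteq> 0}"
  have "pair_sum h F = (\<Sum>u\<in>?C. h u * F u)" if "{u. h u \<noteq> 0} \<subseteq> ?C" for h
    using assms that by (intro pair_sum_superset) auto
  note * = this
  have 1: "{u. f u - g u \<noteq> 0} \<subseteq> ?C" "{u. f u \<noteq> 0} \<subseteq> ?C" "{u. g u \<noteq> 0} \<subseteq> ?C" by auto
  show ?thesis unfolding *[OF 1(1)] *[OF 1(2)] *[OF 1(3)] by (simp add: sum_subtractf left_diff_distrib)
qed

lemma pair_sum_monomial [simp]: "pair_sum (monomial r u) F = r * F u"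
proof -
  have "{v. monomial r u v \<noteq> 0} \<subseteq> {u}" by (auto simp: monomial_def)
  from pair_sum_superset[OF _ this, of F] show ?thesis by (simp add: monomial_def)
qed

lemma finite_monomial_support: "finite {u. monomial r v u \<noteq> 0}"
  by (rule finite_subset[of _ "{v}"]) (auto simp: monomial_def)

lemma free_alg_mult_support:
  "{u. (f \<otimes>\<^bsub>free_alg S\<^esub> g) u \<noteq> 0} \<subseteq> (\<lambda>(a, b). a @ b) ` ({u. f u \<noteq> 0} \<times> {u. g u \<noteq> 0})"
proof
  fix u assume "u \<in> {u. (f \<otimes>\<^bsub>free_alg S\<^esub> g) u \<noteq> 0}"
  then obtain i where "f (take i u) * g (drop i u) \<noteq> 0"
    unfolding free_alg_mult using sum.not_neutral_contains_not_neutral by fastforce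
  then have "f (take i u) \<noteq> 0" "g (drop i u) \<noteq> 0" by auto
  then show "u \<in> (\<lambda>(a, b). a @ b) ` ({u. f u \<noteq> 0} \<times> {u. g u \<noteq> 0})"
    by (intro image_eqI[of _ _ "(take i u, drop i u)"]) auto
qed

text \<open>Linear functionals turn the convolution of the free algebra into the concatenation of words.\<close>

lemma pair_sum_mult:
  assumes f: "finite {u. f u \<noteq> 0}" and g: "finite {u. g u \<noteq> 0}"
  shows "pair_sum (f \<otimes>\<^bsub>free_alg S\<^esub> g) F = pair_sum f (\<lambda>a. pair_sum g (\<lambda>b. F (a @ b)))"
proof -
  let ?A = "{u. f u \<noteq> 0}" and ?B = "{u. g u \<noteq> 0}"
  let ?C = "(\<lambda>(a, b). a @ b) ` (?A \<times> ?B)"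
  have C: "finite ?C" using f g by auto
  have "pair_sum (f \<otimes>\<^bsub>free_alg S\<^esub> g) F = (\<Sum>u\<in>?C. (f \<otimes>\<^bsub>free_alg S\<^esub> g) u * F u)"
    by (rule pair_sum_superset[OF C free_alg_mult_support])
  also have "\<dots> = (\<Sum>u\<in>?C. \<Sum>i\<le>length u. f (take i u) * g (drop i u) * F u)"
    by (simp add: free_alg_mult sum_distrib_right)
  also have "\<dots> = (\<Sum>(u, i)\<in>(SIGMA u:?C. {..length u}). f (take i u) * g (drop i u) * F u)"
    using C by (subst sum.Sigma) auto
  also have "\<dots> = (\<Sum>(u, i)\<in>{p. snd p \<le> length (fst p) \<and> f (take (snd p) (fst p)) \<noteq> 0 \<and>
      g (drop (snd p) (fst p)) \<noteq> 0}. f (take i u) * g (drop i u) * F u)"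
  proof (rule sum.mono_neutral_right)
    show "finite (SIGMA u:?C. {..length u})" using C by simp
    have "u \<in> ?C" if "f (take i u) \<noteq> 0" "g (drop i u) \<noteq> 0" for u i
      by (rule image_eqI[of _ _ "(take i u, drop i u)"]) (use that in simp_all)
    then show "{p. snd p \<le> length (fst p) \<and> f (take (snd p) (fst p)) \<noteq> 0 \<and> g (drop (snd p) (fst p)) \<noteq> 0}
      \<subseteq> (SIGMA u:?C. {..length u})"
      by fastforce
    show "\<forall>p\<in>(SIGMA u:?C. {..length u}) - {p. snd p \<le> length (fst p) \<and> f (take (snd p) (fst p)) \<noteq> 0 \<and>
        g (drop (snd p) (fst p)) \<noteq> 0}. (case p of (u, i) \<Rightarrow> f (take i u) * g (drop i u) * F u) = 0"
      by force
  qed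
  also have "\<dots> = (\<Sum>(a, b)\<in>?A \<times> ?B. f a * g b * F (a @ b))"
    by (rule sum.reindex_bij_witness[of _ "\<lambda>(a, b). (a @ b, length a)" "\<lambda>(u, i). (take i u, drop i u)"])
      (auto simp: split_beta min_absorb2)
  also have "\<dots> = pair_sum f (\<lambda>a. pair_sum g (\<lambda>b. F (a @ b)))"
    unfolding pair_sum_def sum.cartesian_product[symmetric] by (simp add: sum_distrib_left mult.assoc)
  finally show ?thesis .
qed

lemma pair_sum_indicator:
  assumes "finite {u. f u \<noteq> 0}" shows "pair_sum f (\<lambda>u. of_bool (u = v)) = f v"
  using assms pair_sum_superset[of "insert v {u. f u \<noteq> 0}" f "\<lambda>u. of_bool (u = v)"] by auto

lemma free_alg_closed:
  assumes "f \<in> carrier (free_alg S)" "g \<in> carrier (free_alg S)"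
  shows "f \<otimes>\<^bsub>free_alg S\<^esub> g \<in> carrier (free_alg S)" "f \<oplus>\<^bsub>free_alg S\<^esub> g \<in> carrier (free_alg S)"
proof -
  let ?C = "(\<lambda>(a, b). a @ b) ` ({u. f u \<noteq> 0} \<times> {u. g u \<noteq> 0})"
  have "finite ?C" "?C \<subseteq> lists S" using assms unfolding free_alg_carrier by auto
  then show "f \<otimes>\<^bsub>free_alg S\<^esub> g \<in> carrier (free_alg S)"
    unfolding free_alg_carrier using free_alg_mult_support[where f = f and g = g and S = S] by (meson finite_subset subset_trans)
  have "{u. (f \<oplus>\<^bsub>free_alg S\<^esub> g) u \<noteq> 0} \<subseteq> {u. f u \<noteq> 0} \<union> {u. g u \<noteq> 0}"
    by (auto simp: free_alg_add)
  then show "f \<oplus>\<^bsub>free_alg S\<^esub> g \<in> carrier (free_alg S)"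
    using assms unfolding free_alg_carrier by (meson finite_UnI finite_subset le_sup_iff order_trans)
qed

lemma monomial_closed [simp]: "u \<in> lists S \<Longrightarrow> monomial r u \<in> carrier (free_alg S)"
  unfolding free_alg_carrier using finite_monomial_support by (auto simp: monomial_def)

text \<open>Functionals separate the elements of the free algebra, so together with \<open>pair_sum_mult\<close> its ring axioms reduce
  to the monoid laws for words.\<close>

lemma free_alg_eqI:
  assumes "f \<in> carrier (free_alg S)" "g \<in> carrier (free_alg S)"
    and "\<And>F. pair_sum f F = pair_sum g F"
  shows "f = g"
  using assms pair_sum_indicator by (metis (no_types) ext free_alg_carrier)

lemma free_alg_ring: "ring (free_alg S)"
proof (rule ringI)
  note fin = free_alg_carrier[THEN iffD1, THEN conjunct1]
  show "abelian_group (free_alg S)"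
  proof (rule abelian_groupI)
    fix x assume "x \<in> carrier (free_alg S)"
    then show "\<exists>y\<in>carrier (free_alg S). y \<oplus>\<^bsub>free_alg S\<^esub> x = \<zero>\<^bsub>free_alg S\<^esub>"
      by (intro bexI[of _ "\<lambda>u. - x u"]) (auto simp: free_alg_carrier free_alg_add free_alg_zero)
  qed (auto simp: free_alg_closed free_alg_closed(2)[unfolded free_alg_add] free_alg_add free_alg_zero
      add_ac free_alg_carrier[of "\<lambda>u. 0"])
  show "monoid (free_alg S)"
  proof (rule monoidI)
    fix f g h assume "f \<in> carrier (free_alg S)" "g \<in> carrier (free_alg S)" "h \<in> carrier (free_alg S)"
    then show "f \<otimes>\<^bsub>free_alg S\<^esub> g \<otimes>\<^bsub>free_alg S\<^esub> h = f \<otimes>\<^bsub>free_alg S\<^esub> (g \<otimes>\<^bsub>free_alg S\<^esub> h)"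
      by (intro free_alg_eqI[of _ S]) (auto simp: free_alg_closed pair_sum_mult fin[of _ S])
  next
    fix f assume "f \<in> carrier (free_alg S)"
    then show "\<one>\<^bsub>free_alg S\<^esub> \<otimes>\<^bsub>free_alg S\<^esub> f = f" "f \<otimes>\<^bsub>free_alg S\<^esub> \<one>\<^bsub>free_alg S\<^esub> = f"
      by (auto intro!: free_alg_eqI[of _ S]
          simp: free_alg_one free_alg_closed pair_sum_mult fin[of _ S] finite_monomial_support)
  qed (auto simp: free_alg_closed free_alg_one)
qed (auto simp: free_alg_mult free_alg_add distrib_left distrib_right sum.distrib)

lemma monomial_mult:
  assumes "a \<in> lists S" "b \<in> lists S"
  shows "monomial r a \<otimes>\<^bsub>free_alg S\<^esub> monomial r' b = monomial (r * r') (a @ b)"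
  by (rule free_alg_eqI[of _ S]) (use assms in \<open>auto simp: free_alg_closed pair_sum_mult finite_monomial_support mult_ac\<close>)

lemma monomial_scalar_commute:
  assumes "f \<in> carrier (free_alg S)"
  shows "monomial r [] \<otimes>\<^bsub>free_alg S\<^esub> f = f \<otimes>\<^bsub>free_alg S\<^esub> monomial r []"
proof (rule free_alg_eqI[of _ S])
  fix F
  show "pair_sum (monomial r [] \<otimes>\<^bsub>free_alg S\<^esub> f) F = pair_sum (f \<otimes>\<^bsub>free_alg S\<^esub> monomial r []) F"
    using assms by (simp add: pair_sum_mult finite_monomial_support free_alg_carrier)
      (simp add: pair_sum_def sum_distrib_left mult_ac)
qed (use assms in \<open>auto simp: free_alg_closed\<close>)

section \<open>The regular representation\<close>

definition qpar :: laurent where "qpar = v_pow (-1) - v_pow 1"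

context coxeter_group
begin

text \<open>Left and right multiplication by \<open>h\<^sub>s\<close> on coordinate functions: \<open>h\<^sub>s h\<^sub>w\<close> is \<open>h\<^sub>s\<^sub>w\<close>, plus the multiple
  \<open>v\<^sup>-\<^sup>1 - v\<close> of \<open>h\<^sub>w\<close> if \<open>s\<close> is a descent of \<open>w\<close>. The functions vanish outside of the group, so that the quadratic
  relation holds as an equation of functions.\<close>

definition left_op :: "'w \<Rightarrow> ('w \<Rightarrow> laurent) \<Rightarrow> 'w \<Rightarrow> laurent" where
  "left_op s m w = (if w \<in> carrier W then m (s \<otimes> w) + (if len (s \<otimes> w) < len w then qpar * m w else 0) else 0)"

definition right_op :: "'w \<Rightarrow> ('w \<Rightarrow> laurent) \<Rightarrow> 'w \<Rightarrow> laurent" where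
  "right_op t m w = (if w \<in> carrier W then m (w \<otimes> t) + (if len (w \<otimes> t) < len w then qpar * m w else 0) else 0)"

definition on_group :: "('w \<Rightarrow> laurent) \<Rightarrow> bool" where
  "on_group m \<longleftrightarrow> (\<forall>w. w \<notin> carrier W \<longrightarrow> m w = 0)"

lemma on_group_left_op: "on_group (left_op s m)" and on_group_right_op: "on_group (right_op s m)"
  by (auto simp: on_group_def left_op_def right_op_def)

text \<open>The two composites differ only in whether the correction terms are governed by the descents of \<open>w\<close> or by those
  of \<open>s w\<close> and \<open>w t\<close>. These agree unless \<open>s w = w t\<close>, and in this case the two terms merge.\<close>

lemma left_right_op_commute:
  assumes "s \<in> S" "t \<in> S"
  shows "left_op s (right_op t m) = right_op t (left_op s m)"
proof
  fix w
  show "left_op s (right_op t m) w = right_op t (left_op s m) w"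
  proof (cases "w \<in> carrier W")
    case True
    have c: "s \<in> carrier W" "t \<in> carrier W" using assms S_carrier by auto
    let ?a = "len (s \<otimes> w) < len w" and ?a' = "len (s \<otimes> w \<otimes> t) < len (w \<otimes> t)"
      and ?b = "len (w \<otimes> t) < len w" and ?b' = "len (s \<otimes> w \<otimes> t) < len (s \<otimes> w)"
    have as: "s \<otimes> (w \<otimes> t) = s \<otimes> w \<otimes> t" using c True by (simp add: m_assoc)
    have 1: "left_op s (right_op t m) w = m (s \<otimes> w \<otimes> t) + (if ?b' then qpar * m (s \<otimes> w) else 0)
      + (if ?a then qpar * m (w \<otimes> t) + (if ?b then qpar * qpar * m w else 0) else 0)"
      using c True by (simp add: left_op_def right_op_def distrib_left)
    have 2: "right_op t (left_op s m) w = m (s \<otimes> w \<otimes> t) + (if ?a' then qpar * m (w \<otimes> t) else 0)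
      + (if ?b then qpar * m (s \<otimes> w) + (if ?a then qpar * qpar * m w else 0) else 0)"
      using c True by (simp add: left_op_def right_op_def distrib_left as)
    show ?thesis
    proof (cases "?a = ?a' \<and> ?b = ?b'")
      case True
      then show ?thesis unfolding 1 2 by auto
    next
      case False
      then have e: "s \<otimes> w = w \<otimes> t" using descent_change_left[OF assms True] descent_change_right[OF assms True] by blast
      then show ?thesis unfolding 1 2 e by auto
    qed
  qed (simp add: left_op_def right_op_def)
qed

lemma left_op_quadratic: assumes "s \<in> S" "on_group m"
  shows "left_op s (left_op s m) w = qpar * left_op s m w + m w"
proof (cases "w \<in> carrier W")
  case True
  have "s \<otimes> w \<in> carrier W" using assms True S_carrier by auto
  moreover have "(len w < len (s \<otimes> w)) = (\<not> len (s \<otimes> w) < len w)" using len_S_mult[OF assms(1) True] by auto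
  ultimately show ?thesis using True by (simp add: left_op_def S_cancel[OF assms(1) True] distrib_left)
next
  case False
  then show ?thesis using assms by (simp add: left_op_def on_group_def)
qed

abbreviation left_ops :: "'w list \<Rightarrow> ('w \<Rightarrow> laurent) \<Rightarrow> 'w \<Rightarrow> laurent" where
  "left_ops u m \<equiv> foldr left_op u m"

lemma left_right_ops_commute:
  assumes "u \<in> lists S" "v \<in> lists S"
  shows "left_ops u (foldr right_op v m) = foldr right_op v (left_ops u m)"
proof -
  have *: "left_op s (foldr right_op v m) = foldr right_op v (left_op s m)" if "s \<in> S" for s m
    using assms(2) that left_right_op_commute by (induction v) auto
  show ?thesis using assms(1)
  proof (induction u)
    case (Cons s u)
    then show ?case using * by simp
  qed simp
qed

lemma on_group_left_ops: "on_group m \<Longrightarrow> on_group (left_ops u m)"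
  by (cases u) (auto simp: on_group_left_op)

text \<open>No correction term arises along a product in which lengths add up.\<close>

lemma left_ops_at:
  assumes "u \<in> lists S" "x \<in> carrier W" "len (inv (word_prod W u) \<otimes> x) = length u + len x"
  shows "left_ops u m x = m (inv (word_prod W u) \<otimes> x)"
  using assms
proof (induction u arbitrary: x)
  case (Cons s u)
  then have c: "s \<in> S" "s \<in> carrier W" "u \<in> lists S" "word_prod W u \<in> carrier W" "s \<otimes> x \<in> carrier W"
    using S_carrier by auto
  have e: "inv (word_prod W (s # u)) \<otimes> x = inv (word_prod W u) \<otimes> (s \<otimes> x)"
    using c Cons.prems by (simp add: inv_mult_group S_inv m_assoc)
  have "len (inv (word_prod W u) \<otimes> (s \<otimes> x)) \<le> length u + len (s \<otimes> x)"
    using len_mult_le[of "inv (word_prod W u)" "s \<otimes> x"] c len_le[OF c(3)] by simp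
  then have l: "len (s \<otimes> x) = Suc (len x)"
    using Cons.prems(2) len_S_mult[OF c(1) Cons.prems(1)] unfolding e by auto
  then have "len (inv (word_prod W u) \<otimes> (s \<otimes> x)) = length u + len (s \<otimes> x)"
    using Cons.prems(2) unfolding e by simp
  from Cons.IH[OF c(5) this] show ?case using l Cons.prems(1) unfolding e by (simp add: left_op_def)
qed auto

lemma right_ops_at:
  assumes "u \<in> lists S" "x \<in> carrier W" "len (x \<otimes> word_prod W u) = length u + len x"
  shows "foldr right_op u m x = m (x \<otimes> word_prod W u)"
  using assms
proof (induction u arbitrary: x)
  case (Cons s u)
  then have c: "s \<in> S" "s \<in> carrier W" "u \<in> lists S" "word_prod W u \<in> carrier W" "x \<otimes> s \<in> carrier W"
    using S_carrier by auto
  have e: "x \<otimes> word_prod W (s # u) = x \<otimes> s \<otimes> word_prod W u"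
    using c Cons.prems by (simp add: m_assoc)
  have "len (x \<otimes> s \<otimes> word_prod W u) \<le> length u + len (x \<otimes> s)"
    using len_mult_le[of "x \<otimes> s" "word_prod W u"] c len_le[OF c(3)] by simp
  then have l: "len (x \<otimes> s) = Suc (len x)"
    using Cons.prems(2) len_mult_S[OF c(1) Cons.prems(1)] unfolding e by auto
  then have "len (x \<otimes> s \<otimes> word_prod W u) = length u + len (x \<otimes> s)"
    using Cons.prems(2) unfolding e by simp
  from Cons.IH[OF c(5) this] show ?case using l Cons.prems(1) unfolding e by (simp add: right_op_def)
qed auto

lemma left_ops_at_one:
  assumes "reduced W S u w" shows "left_ops u m \<one> = m (inv w)"
  using left_ops_at[of u \<one> m] reducedD[OF assms] by simp

text \<open>The value at \<open>x\<close> is the value at \<open>1\<close> after applying the right operators of a reduced word of \<open>x\<close>. These commute with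
  the left operators, whose value at \<open>1\<close> depends only on \<open>w\<close>. This implies the braid relations, as the two sides
  of a braid relation are reduced words.\<close>

lemma left_ops_eqI:
  assumes "reduced W S u w" "reduced W S v w" "on_group m"
  shows "left_ops u m = left_ops v m"
proof
  fix x
  show "left_ops u m x = left_ops v m x"
  proof (cases "x \<in> carrier W")
    case True
    then obtain r where r: "reduced W S r x" using reduced_exists by blast
    note rd = reducedD[OF r]
    have *: "left_ops a m x = foldr right_op r m (inv w)" if "reduced W S a w" for a
    proof -
      have "left_ops a m x = foldr right_op r (left_ops a m) \<one>"
        using right_ops_at[of r \<one> "left_ops a m"] rd by simp
      also have "\<dots> = left_ops a (foldr right_op r m) \<one>"
        using left_right_ops_commute[OF reducedD(1)[OF that] rd(1)] by simp
      finally show ?thesis using left_ops_at_one[OF that] by simp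
    qed
    show ?thesis using *[OF assms(1)] *[OF assms(2)] by simp
  next
    case False
    then show ?thesis using on_group_left_ops[OF assms(3)] unfolding on_group_def by simp
  qed
qed

lemma reduced_alternating:
  assumes "s \<in> S" "t \<in> S"
  shows "reduced W S (alternating s t (cox_m W s t)) (word_prod W (alternating s t (cox_m W s t)))"
  unfolding reduced_iff using alternating_lists[OF assms] len_alternating[OF assms] by simp

lemma left_ops_braid:
  assumes "s \<in> S" "t \<in> S" "on_group m"
  shows "left_ops (alternating s t (cox_m W s t)) m = left_ops (alternating t s (cox_m W s t)) m"
  using left_ops_eqI[OF reduced_alternating[OF assms(1,2)] _ assms(3)] reduced_alternating[OF assms(2,1)]
  unfolding word_prod_alternating_braid[OF assms(1,2)] cox_m_commute[OF assms(2,1)] .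

definition delta :: "'w \<Rightarrow> 'w \<Rightarrow> laurent" where "delta w = (\<lambda>x. of_bool (x = w))"

lemma on_group_delta [simp]: "w \<in> carrier W \<Longrightarrow> on_group (delta w)"
  by (auto simp: on_group_def delta_def)

lemma left_op_delta: assumes "s \<in> S" "w \<in> carrier W"
  shows "left_op s (delta w) x = delta (s \<otimes> w) x + (if len (s \<otimes> w) < len w then qpar * delta w x else 0)"
proof (cases "x \<in> carrier W")
  case True
  have "(s \<otimes> x = w) \<longleftrightarrow> (x = s \<otimes> w)" using S_cancel[OF assms(1)] True assms by metis
  then show ?thesis using True by (auto simp: left_op_def delta_def)
next
  case False
  then show ?thesis using assms S_carrier[OF assms(1)] by (auto simp: left_op_def delta_def)
qed

lemma left_ops_delta:
  assumes "reduced W S u w" shows "left_ops u (delta \<one>) = delta w"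
  using assms
proof (induction u arbitrary: w)
  case Nil
  then show ?case using reducedD[OF Nil] by simp
next
  case (Cons s u)
  note r = reduced_Cons[OF Cons.prems] and w = reducedD(4)[OF Cons.prems]
  have sw: "s \<otimes> w \<in> carrier W" using S_carrier[OF r(1)] w by simp
  have "left_op s (delta (s \<otimes> w)) = delta w"
    using left_op_delta[OF r(1) sw] S_cancel[OF r(1) w] r(3) by (intro ext) auto
  then show ?case using Cons.IH[OF r(2)] by simp
qed

end

section \<open>The basis of the Hecke algebra and the trace form\<close>

lemma free_alg_diff_closed:
  assumes "f \<in> carrier (free_alg S)" "g \<in> carrier (free_alg S)"
  shows "(\<lambda>u. f u - g u) \<in> carrier (free_alg S)"
proof -
  have "{u. f u - g u \<noteq> 0} \<subseteq> {u. f u \<noteq> 0} \<union> {u. g u \<noteq> 0}" by auto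
  then show ?thesis using assms unfolding free_alg_carrier
    by (meson finite_UnI finite_subset le_sup_iff order_trans)
qed

lemma free_alg_a_inv:
  assumes "f \<in> carrier (free_alg S)" shows "\<ominus>\<^bsub>free_alg S\<^esub> f = (\<lambda>u. - f u)"
proof -
  interpret R: ring "free_alg S" by (rule free_alg_ring)
  have "(\<lambda>u. - f u) \<in> carrier (free_alg S)" using assms by (simp add: free_alg_carrier)
  moreover have "(\<lambda>u. - f u) \<oplus>\<^bsub>free_alg S\<^esub> f = \<zero>\<^bsub>free_alg S\<^esub>" by (simp add: free_alg_add free_alg_zero)
  ultimately show ?thesis using R.minus_equality assms by blast
qed

context coxeter_group
begin

lemma alternating_in_S [simp]: "s \<in> S \<Longrightarrow> t \<in> S \<Longrightarrow> alternating s t k \<in> lists S"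
  by (rule alternating_lists)

lemma left_ops_sum:
  "left_ops u (\<lambda>w. \<Sum>b\<in>B. c b * M b w) = (\<lambda>w. \<Sum>b\<in>B. c b * left_ops u (M b) w)"
proof (induction u)
  case (Cons s u)
  have "left_op s (\<lambda>w. \<Sum>b\<in>B. c b * N b w) x = (\<Sum>b\<in>B. c b * left_op s (N b) x)" for N x
    by (simp add: left_op_def sum.distrib distrib_left sum_distrib_left mult_ac)
  then have "left_op s (\<lambda>w. \<Sum>b\<in>B. c b * N b w) = (\<lambda>x. \<Sum>b\<in>B. c b * left_op s (N b) x)" for N
    by (rule ext)
  then show ?case using Cons.IH by simp
qed simp

definition act :: "('w list \<Rightarrow> laurent) \<Rightarrow> ('w \<Rightarrow> laurent) \<Rightarrow> 'w \<Rightarrow> laurent" where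
  "act f m = (\<lambda>w. pair_sum f (\<lambda>u. left_ops u m w))"

lemma act_mult:
  assumes "f \<in> carrier (free_alg S)" "g \<in> carrier (free_alg S)"
  shows "act (f \<otimes>\<^bsub>free_alg S\<^esub> g) m = act f (act g m)"
proof -
  have "left_ops a (act g m) = (\<lambda>w. pair_sum g (\<lambda>b. left_ops a (left_ops b m) w))" for a
    unfolding act_def pair_sum_def by (rule left_ops_sum)
  then show ?thesis using assms unfolding act_def free_alg_carrier by (simp add: pair_sum_mult)
qed

lemma act_add:
  assumes "f \<in> carrier (free_alg S)" "g \<in> carrier (free_alg S)"
  shows "act (f \<oplus>\<^bsub>free_alg S\<^esub> g) m = (\<lambda>w. act f m w + act g m w)"
  using assms unfolding act_def free_alg_carrier free_alg_add by (simp add: pair_sum_add)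

lemma act_diff:
  assumes "f \<in> carrier (free_alg S)" "g \<in> carrier (free_alg S)"
  shows "act (\<lambda>u. f u - g u) m = (\<lambda>w. act f m w - act g m w)"
  using assms unfolding act_def free_alg_carrier by (simp add: pair_sum_diff)

lemma act_monomial: "act (monomial r u) m = (\<lambda>w. r * left_ops u m w)"
  unfolding act_def by simp

lemma on_group_act: "on_group m \<Longrightarrow> on_group (act f m)"
  using on_group_left_ops unfolding on_group_def act_def pair_sum_def by simp

lemma act_zero_right: "act f (\<lambda>w. 0) = (\<lambda>w. 0)"
proof -
  have "left_ops u (\<lambda>w. 0) = (\<lambda>w. 0)" for u
    by (induction u) (auto simp: left_op_def)
  then show ?thesis unfolding act_def pair_sum_def by simp
qed

text \<open>The annihilator of the regular representation is an ideal that contains the defining relations, hence the Hecke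
  algebra acts.\<close>

definition act_kernel :: "('w list \<Rightarrow> laurent) set" where
  "act_kernel = {f \<in> carrier (free_alg S). \<forall>m. on_group m \<longrightarrow> act f m = (\<lambda>w. 0)}"

lemma act_kernel_ideal: "ideal act_kernel (free_alg S)"
proof -
  interpret R: ring "free_alg S" by (rule free_alg_ring)
  have z: "act (\<lambda>u. 0) m = (\<lambda>w. 0)" for m unfolding act_def pair_sum_def by simp
  have n: "act (\<lambda>u. - f u) m = (\<lambda>w. - act f m w)" for f m
    unfolding act_def pair_sum_def by (simp add: sum_negf)
  show ?thesis
  proof (rule idealI)
    show "subgroup act_kernel (add_monoid (free_alg S))"
    proof (rule subgroup.intro)
      show "act_kernel \<subseteq> carrier (add_monoid (free_alg S))" by (auto simp: act_kernel_def)
    next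
      fix x y assume "x \<in> act_kernel" "y \<in> act_kernel"
      then show "x \<otimes>\<^bsub>add_monoid (free_alg S)\<^esub> y \<in> act_kernel"
        by (auto simp: act_kernel_def act_add)
    next
      show "\<one>\<^bsub>add_monoid (free_alg S)\<^esub> \<in> act_kernel"
        using R.zero_closed z by (auto simp: act_kernel_def free_alg_zero)
    next
      fix x assume "x \<in> act_kernel"
      then have x: "x \<in> carrier (free_alg S)" "\<And>m. on_group m \<Longrightarrow> act x m = (\<lambda>w. 0)"
        by (auto simp: act_kernel_def)
      then have "\<ominus>\<^bsub>free_alg S\<^esub> x \<in> act_kernel"
        using R.a_inv_closed[OF x(1)] n unfolding act_kernel_def by (simp add: free_alg_a_inv)
      then show "inv\<^bsub>add_monoid (free_alg S)\<^esub> x \<in> act_kernel" by (simp add: a_inv_def)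
    qed
  next
    fix a x assume a: "a \<in> act_kernel" and x: "x \<in> carrier (free_alg S)"
    then have a': "a \<in> carrier (free_alg S)" "\<And>m. on_group m \<Longrightarrow> act a m = (\<lambda>w. 0)"
        by (auto simp: act_kernel_def)
    show "x \<otimes>\<^bsub>free_alg S\<^esub> a \<in> act_kernel" "a \<otimes>\<^bsub>free_alg S\<^esub> x \<in> act_kernel"
      using a' x on_group_act act_zero_right unfolding act_kernel_def by (auto simp: act_mult)
  qed (rule free_alg_ring)
qed

lemma hecke_relators_carrier: "hecke_relators W S \<subseteq> carrier (free_alg S)"
  unfolding hecke_relators_def by (auto intro!: free_alg_diff_closed)

lemma hecke_relators_kernel: "hecke_relators W S \<subseteq> act_kernel"
proof
  fix f assume f: "f \<in> hecke_relators W S"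
  have fc: "f \<in> carrier (free_alg S)" using f hecke_relators_carrier by blast
  have "act f m = (\<lambda>w. 0)" if m: "on_group m" for m
    using f unfolding hecke_relators_def
  proof
    assume "f \<in> {\<lambda>u. monomial 1 [s, s] u - monomial (v_pow (- 1) - v_pow 1) [s] u - monomial 1 [] u |s. s \<in> S}"
    then obtain s where s: "s \<in> S"
      and f: "f = (\<lambda>u. monomial 1 [s, s] u - monomial qpar [s] u - monomial 1 [] u)"
      unfolding qpar_def by auto
    show ?thesis unfolding f using s left_op_quadratic[OF s m]
      by (simp add: act_diff[OF free_alg_diff_closed] act_diff act_monomial)
  next
    assume "f \<in> {\<lambda>u. monomial 1 (alternating s t (cox_m W s t)) u - monomial 1 (alternating t s (cox_m W s t)) u |s t.
        s \<in> S \<and> t \<in> S \<and> cox_m W s t \<noteq> 0}"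
    then obtain s t where s: "s \<in> S" "t \<in> S"
      and f: "f = (\<lambda>u. monomial 1 (alternating s t (cox_m W s t)) u - monomial 1 (alternating t s (cox_m W s t)) u)"
      by auto
    show ?thesis unfolding f using left_ops_braid[OF s m] s
      by (simp add: act_diff act_monomial)
  qed
  then show "f \<in> act_kernel" using fc by (simp add: act_kernel_def)
qed

abbreviation "H \<equiv> hecke_alg W S"

abbreviation hecke_mult :: "'w hecke \<Rightarrow> 'w hecke \<Rightarrow> 'w hecke" (infixl \<open>\<star>\<close> 70) where
  "x \<star> y \<equiv> x \<otimes>\<^bsub>hecke_alg W S\<^esub> y"

lemma hecke_ideal_ideal: "ideal (hecke_ideal W S) (free_alg S)"
  unfolding hecke_ideal_def by (rule ring.genideal_ideal[OF free_alg_ring hecke_relators_carrier])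

lemma hecke_relators_ideal: "hecke_relators W S \<subseteq> hecke_ideal W S"
  unfolding hecke_ideal_def by (rule ring.genideal_self[OF free_alg_ring hecke_relators_carrier])

lemma hecke_ideal_kernel: "hecke_ideal W S \<subseteq> act_kernel"
  unfolding hecke_ideal_def
  by (rule ring.genideal_minimal[OF free_alg_ring act_kernel_ideal hecke_relators_kernel])

lemma hecke_ring: "ring H"
  unfolding hecke_alg_def by (rule ideal.quotient_is_ring[OF hecke_ideal_ideal])

sublocale H: ring "hecke_alg W S" by (rule hecke_ring)

definition hecke_class :: "('w list \<Rightarrow> laurent) \<Rightarrow> 'w hecke" where
  "hecke_class f = hecke_ideal W S +>\<^bsub>free_alg S\<^esub> f"

lemma hecke_class_hom: "hecke_class \<in> Ring.ring_hom (free_alg S) H"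
proof -
  have "hecke_class = (+>\<^bsub>free_alg S\<^esub>) (hecke_ideal W S)" by (rule ext) (simp only: hecke_class_def)
  then show ?thesis using ideal.rcos_ring_hom[OF hecke_ideal_ideal] by (simp only: hecke_alg_def)
qed

lemmas hecke_class_closed [simp] = Ring.ring_hom_closed[OF hecke_class_hom]
lemmas hecke_class_mult = Ring.ring_hom_mult[OF hecke_class_hom]
lemmas hecke_class_add = Ring.ring_hom_add[OF hecke_class_hom]
lemmas hecke_class_one = Ring.ring_hom_one[OF hecke_class_hom]

lemma hecke_class_surj: assumes "x \<in> carrier H" obtains f where "f \<in> carrier (free_alg S)" "x = hecke_class f"
  using assms unfolding hecke_alg_def FactRing_def A_RCOSETS_def' hecke_class_def by auto

lemma free_alg_minus:
  assumes "f \<in> carrier (free_alg S)" "g \<in> carrier (free_alg S)"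
  shows "f \<ominus>\<^bsub>free_alg S\<^esub> g = (\<lambda>u. f u - g u)"
  using assms by (simp add: a_minus_def free_alg_a_inv free_alg_add)

lemma hecke_class_eq_iff:
  assumes "f \<in> carrier (free_alg S)" "g \<in> carrier (free_alg S)"
  shows "hecke_class f = hecke_class g \<longleftrightarrow> (\<lambda>u. f u - g u) \<in> hecke_ideal W S"
  using ring.quotient_eq_iff_same_a_r_cos[OF free_alg_ring hecke_ideal_ideal assms]
  unfolding hecke_class_def free_alg_minus[OF assms] by simp

definition hact :: "'w hecke \<Rightarrow> ('w \<Rightarrow> laurent) \<Rightarrow> 'w \<Rightarrow> laurent" where
  "hact x = act (SOME f. f \<in> carrier (free_alg S) \<and> hecke_class f = x)"

lemma hact_class:
  assumes "f \<in> carrier (free_alg S)" "on_group m"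
  shows "hact (hecke_class f) m = act f m"
proof -
  let ?g = "SOME g. g \<in> carrier (free_alg S) \<and> hecke_class g = hecke_class f"
  have g: "?g \<in> carrier (free_alg S)" "hecke_class ?g = hecke_class f"
    using someI[of "\<lambda>g. g \<in> carrier (free_alg S) \<and> hecke_class g = hecke_class f" f] assms by auto
  then have "(\<lambda>u. ?g u - f u) \<in> act_kernel" using hecke_class_eq_iff hecke_ideal_kernel assms by blast
  then have "act (\<lambda>u. ?g u - f u) m = (\<lambda>w. 0)" using assms by (simp add: act_kernel_def)
  then show ?thesis unfolding hact_def by (simp add: act_diff[OF g(1) assms(1)] fun_eq_iff)
qed

lemma on_group_hact: "on_group m \<Longrightarrow> on_group (hact x m)"
  unfolding hact_def by (rule on_group_act)

lemma hact_mult: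
  assumes "x \<in> carrier H" "y \<in> carrier H" "on_group m"
  shows "hact (x \<star> y) m = hact x (hact y m)"
proof -
  obtain f where f: "f \<in> carrier (free_alg S)" "x = hecke_class f" using hecke_class_surj[OF assms(1)] .
  obtain g where g: "g \<in> carrier (free_alg S)" "y = hecke_class g" using hecke_class_surj[OF assms(2)] .
  show ?thesis unfolding f g hecke_class_mult[OF f(1) g(1), symmetric]
    using f g assms by (simp add: hact_class free_alg_closed act_mult on_group_act)
qed

lemma hact_add:
  assumes "x \<in> carrier H" "y \<in> carrier H" "on_group m"
  shows "hact (x \<oplus>\<^bsub>H\<^esub> y) m = (\<lambda>w. hact x m w + hact y m w)"
proof -
  obtain f where f: "f \<in> carrier (free_alg S)" "x = hecke_class f" using hecke_class_surj[OF assms(1)] .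
  obtain g where g: "g \<in> carrier (free_alg S)" "y = hecke_class g" using hecke_class_surj[OF assms(2)] .
  show ?thesis unfolding f g hecke_class_add[OF f(1) g(1), symmetric]
    using f g assms by (simp add: hact_class free_alg_closed act_add)
qed

abbreviation "sc \<equiv> hecke_scalar W S"
abbreviation "B \<equiv> hecke_basis W S"
abbreviation "word_elt \<equiv> hecke_monom W S 1"

lemma hecke_monom_class: "hecke_monom W S r u = hecke_class (monomial r u)"
  by (simp add: hecke_monom_def hecke_class_def)

lemma word_elt_closed [simp]: "u \<in> lists S \<Longrightarrow> hecke_monom W S r u \<in> carrier H"
  by (simp add: hecke_monom_class)

lemma sc_closed [simp]: "sc r \<in> carrier H"
  by (simp add: hecke_scalar_def)

lemma hact_word:
  assumes "u \<in> lists S" "on_group m" shows "hact (word_elt u) m = left_ops u m"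
  using assms by (simp add: hecke_monom_class hact_class act_monomial)

lemma hact_sc: assumes "on_group m" shows "hact (sc r) m = (\<lambda>w. r * m w)"
  using assms by (simp add: hecke_scalar_def hecke_monom_class hact_class act_monomial)

lemma hecke_monom_mult:
  assumes "a \<in> lists S" "b \<in> lists S"
  shows "hecke_monom W S r a \<star> hecke_monom W S r' b = hecke_monom W S (r * r') (a @ b)"
  using assms by (simp add: hecke_monom_class flip: hecke_class_mult) (simp add: monomial_mult)

lemma sc_mult: "sc r \<star> sc r' = sc (r * r')"
  by (simp add: hecke_scalar_def hecke_monom_mult)

lemma sc_word_elt: "u \<in> lists S \<Longrightarrow> sc r \<star> word_elt u = hecke_monom W S r u"
  by (simp add: hecke_scalar_def hecke_monom_mult)

lemma sc_one: "sc 1 = \<one>\<^bsub>H\<^esub>"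
  by (simp add: hecke_scalar_def hecke_monom_class hecke_class_one[symmetric] free_alg_one)

lemma sc_add: "sc (r + r') = sc r \<oplus>\<^bsub>H\<^esub> sc r'"
proof -
  have "monomial (r + r') [] = monomial r [] \<oplus>\<^bsub>free_alg S\<^esub> monomial r' []"
    by (auto simp: free_alg_add monomial_def)
  then show ?thesis by (simp add: hecke_scalar_def hecke_monom_class hecke_class_add)
qed

lemma sc_zero: "sc 0 = \<zero>\<^bsub>H\<^esub>"
  using sc_add[of 0 0] H.add.l_cancel_one'[of "sc 0" "sc 0"] by simp

lemma sc_commute: assumes "x \<in> carrier H" shows "sc r \<star> x = x \<star> sc r"
proof -
  obtain f where f: "f \<in> carrier (free_alg S)" "x = hecke_class f" using hecke_class_surj[OF assms] .
  then show ?thesis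
    using monomial_scalar_commute[OF f(1)] by (simp add: hecke_scalar_def hecke_monom_class flip: hecke_class_mult)
qed

lemma sc_left_commute:
  assumes "x \<in> carrier H" "y \<in> carrier H"
  shows "x \<star> (sc r \<star> y) = sc r \<star> (x \<star> y)"
  using assms by (metis sc_commute H.m_assoc sc_closed)

lemma word_elt_eqI:
  assumes "u \<in> lists S" "v \<in> lists S" "(\<lambda>a. monomial 1 u a - monomial 1 v a) \<in> hecke_relators W S"
  shows "word_elt u = word_elt v"
  using assms hecke_relators_ideal by (auto simp: hecke_monom_class hecke_class_eq_iff)

lemma word_elt_braid:
  assumes "s \<in> S" "t \<in> S" "cox_m W s t \<noteq> 0"
  shows "word_elt (alternating s t (cox_m W s t)) = word_elt (alternating t s (cox_m W s t))"
  by (rule word_elt_eqI) (use assms in \<open>auto simp: hecke_relators_def\<close>)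

lemma word_elt_quadratic:
  assumes "s \<in> S" shows "word_elt [s, s] = sc qpar \<star> word_elt [s] \<oplus>\<^bsub>H\<^esub> \<one>\<^bsub>H\<^esub>"
proof -
  let ?g = "monomial qpar [s] \<oplus>\<^bsub>free_alg S\<^esub> monomial 1 []"
  have "(\<lambda>u. monomial 1 [s, s] u - ?g u) \<in> hecke_relators W S"
    using assms unfolding hecke_relators_def free_alg_add qpar_def by (auto simp: diff_diff_eq)
  then have "hecke_class (monomial 1 [s, s]) = hecke_class ?g"
    using hecke_relators_ideal assms by (subst hecke_class_eq_iff) (auto simp: free_alg_closed)
  then show ?thesis using assms by (simp add: hecke_class_add hecke_monom_class[symmetric] sc_word_elt free_alg_one hecke_class_one[symmetric])
qed

end

locale finite_coxeter_group = coxeter_group W S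
  for W :: "('w, 'b) monoid_scheme" (structure) and S :: "'w set" +
  assumes finite_W: "finite (carrier W)"
begin

text \<open>Matsumoto's theorem for the map that sends a word to its class: the basis elements do not depend on the chosen
  reduced words.\<close>

lemma word_elt_reduced_eq:
  assumes "reduced W S u w" "reduced W S v w" shows "word_elt u = word_elt v"
proof (rule matsumoto[OF _ _ finite_W assms])
  fix s a b assume "s \<in> S" "a \<in> lists S" "b \<in> lists S" "word_elt a = word_elt b"
  then show "word_elt (s # a) = word_elt (s # b)"
    using hecke_monom_mult[of "[s]" a 1 1] hecke_monom_mult[of "[s]" b 1 1] by simp
next
  fix s t a assume "s \<in> S" "t \<in> S" "a \<in> lists S" "cox_m W s t \<noteq> 0"
  then show "word_elt (alternating s t (cox_m W s t) @ a) = word_elt (alternating t s (cox_m W s t) @ a)"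
    using hecke_monom_mult[of "alternating s t (cox_m W s t)" a 1 1]
      hecke_monom_mult[of "alternating t s (cox_m W s t)" a 1 1] word_elt_braid[of s t] by simp
qed

lemma B_reduced: assumes "reduced W S u w" shows "B w = word_elt u"
  unfolding hecke_basis_def using word_elt_reduced_eq[OF someI[of "\<lambda>u. reduced W S u w", OF assms] assms] .

lemma B_closed [simp]: "w \<in> carrier W \<Longrightarrow> B w \<in> carrier H"
  using reduced_exists B_reduced reducedD(1) word_elt_closed by metis

lemma B_one: "B \<one> = \<one>\<^bsub>H\<^esub>"
proof -
  have "reduced W S [] \<one>" by (simp add: reduced_iff)
  from B_reduced[OF this] show ?thesis using sc_one by (simp add: hecke_scalar_def)
qed

text \<open>If \<open>s\<close> is a descent, then \<open>h\<^sub>w = h\<^sub>s h\<^sub>s\<^sub>w\<close> and the quadratic relation applies.\<close>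

lemma word_elt_mult_B:
  assumes "s \<in> S" "w \<in> carrier W"
  shows "word_elt [s] \<star> B w = (if len (s \<otimes> w) < len w then sc qpar \<star> B w \<oplus>\<^bsub>H\<^esub> B (s \<otimes> w) else B (s \<otimes> w))"
proof -
  have asc: "word_elt [s] \<star> B w = B (s \<otimes> w)" if "\<not> len (s \<otimes> w) < len w" "w \<in> carrier W" for w
  proof -
    obtain u where u: "reduced W S u w" using reduced_exists \<open>w \<in> carrier W\<close> by blast
    then have "reduced W S (s # u) (s \<otimes> w)" using that assms(1) len_S_mult[of s w] unfolding reduced_iff by auto
    from B_reduced[OF this] B_reduced[OF u] show ?thesis
      using hecke_monom_mult[of "[s]" u 1 1] reducedD(1)[OF u] assms(1) by simp
  qed
  show ?thesis
  proof (cases "len (s \<otimes> w) < len w")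
    case True
    have sw: "s \<otimes> w \<in> carrier W" using assms S_carrier by simp
    have "word_elt [s] \<star> B (s \<otimes> w) = B w" using asc[OF _ sw] True S_cancel[OF assms] by simp
    then have "word_elt [s] \<star> B w = word_elt [s, s] \<star> B (s \<otimes> w)"
      using sw assms(1) hecke_monom_mult[of "[s]" "[s]" 1 1] H.m_assoc[of "word_elt [s]" "word_elt [s]" "B (s \<otimes> w)"] by simp
    also have "\<dots> = sc qpar \<star> (word_elt [s] \<star> B (s \<otimes> w)) \<oplus>\<^bsub>H\<^esub> B (s \<otimes> w)"
      unfolding word_elt_quadratic[OF assms(1)] using sw assms(1) by (simp add: H.l_distr H.m_assoc)
    finally show ?thesis using True \<open>word_elt [s] \<star> B (s \<otimes> w) = B w\<close> by simp
  qed (use asc assms in simp)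
qed

text \<open>The coordinates of \<open>x\<close> are read off from its action on the coordinate function of \<open>1\<close>.\<close>

definition coord :: "'w hecke \<Rightarrow> 'w \<Rightarrow> laurent" where
  "coord x = hact x (delta \<one>)"

lemma coord_on_group: "on_group (coord x)" unfolding coord_def by (rule on_group_hact) simp

lemma coord_add: "x \<in> carrier H \<Longrightarrow> y \<in> carrier H \<Longrightarrow> coord (x \<oplus>\<^bsub>H\<^esub> y) w = coord x w + coord y w"
  unfolding coord_def by (simp add: hact_add)

lemma coord_mult: "x \<in> carrier H \<Longrightarrow> y \<in> carrier H \<Longrightarrow> coord (x \<star> y) = hact x (coord y)"
  unfolding coord_def by (simp add: hact_mult)

lemma coord_sc: "x \<in> carrier H \<Longrightarrow> coord (sc r \<star> x) w = r * coord x w"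
  using coord_on_group[of x] by (simp add: coord_mult hact_sc)

lemma coord_B: "w \<in> carrier W \<Longrightarrow> coord (B w) = delta w"
  using reduced_exists[of w] B_reduced left_ops_delta reducedD(1) hact_word unfolding coord_def
  by (metis on_group_delta one_closed)

definition lincomb :: "('w \<Rightarrow> laurent) \<Rightarrow> 'w hecke" where
  "lincomb c = (\<Oplus>\<^bsub>H\<^esub>w\<in>carrier W. sc (c w) \<star> B w)"

lemma lincomb_closed [simp]: "lincomb c \<in> carrier H"
  unfolding lincomb_def by (intro H.finsum_closed) auto

lemma additive_finsum:
  assumes "finite A" "F \<in> A \<rightarrow> carrier H"
    and "\<And>x y. x \<in> carrier H \<Longrightarrow> y \<in> carrier H \<Longrightarrow> \<phi> (x \<oplus>\<^bsub>H\<^esub> y) = \<phi> x + \<phi> y"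
  shows "\<phi> (finsum H F A) = (\<Sum>a\<in>A. \<phi> (F a) :: 'c::ab_group_add)"
  using assms(1,2)
proof (induction A rule: finite_induct)
  case empty
  have "\<phi> \<zero>\<^bsub>H\<^esub> = \<phi> \<zero>\<^bsub>H\<^esub> + \<phi> \<zero>\<^bsub>H\<^esub>" using assms(3)[of "\<zero>\<^bsub>H\<^esub>" "\<zero>\<^bsub>H\<^esub>"] by simp
  then show ?case by simp
next
  case (insert a A)
  then show ?case using assms(3)[of "F a" "finsum H F A"] by (simp add: Pi_def)
qed

lemma coord_lincomb: assumes "on_group c" shows "coord (lincomb c) = c"
proof
  fix w
  have "coord (lincomb c) w = (\<Sum>x\<in>carrier W. coord (sc (c x) \<star> B x) w)"
    unfolding lincomb_def by (rule additive_finsum) (auto simp: finite_W coord_add)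
  also have "\<dots> = (\<Sum>x\<in>carrier W. if x = w then c x else 0)"
    by (rule sum.cong) (auto simp: coord_sc coord_B delta_def)
  also have "\<dots> = c w" using finite_W assms by (auto simp: on_group_def)
  finally show "coord (lincomb c) w = c w" .
qed

text \<open>The property of being recovered from its coordinates. It holds for all elements because
  \<open>1\<close> has it, and it is inherited by sums, by scalar multiples and by left multiplication with generators.\<close>

definition spanned :: "'w hecke \<Rightarrow> bool" where
  "spanned x \<longleftrightarrow> x \<in> carrier H \<and> lincomb (coord x) = x"

lemma spanned_add: assumes "spanned x" "spanned y" shows "spanned (x \<oplus>\<^bsub>H\<^esub> y)"
proof -
  have xy: "x \<in> carrier H" "y \<in> carrier H" using assms by (auto simp: spanned_def)
  have "lincomb (coord (x \<oplus>\<^bsub>H\<^esub> y)) = (\<Oplus>\<^bsub>H\<^esub>w\<in>carrier W. sc (coord x w) \<star> B w \<oplus>\<^bsub>H\<^esub> sc (coord y w) \<star> B w)"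
    unfolding lincomb_def using xy by (intro H.finsum_cong') (auto simp: coord_add sc_add H.l_distr)
  also have "\<dots> = lincomb (coord x) \<oplus>\<^bsub>H\<^esub> lincomb (coord y)"
    unfolding lincomb_def by (intro H.finsum_addf) auto
  finally show ?thesis using assms xy by (simp add: spanned_def)
qed

lemma spanned_sc: assumes "spanned x" shows "spanned (sc r \<star> x)"
proof -
  have x: "x \<in> carrier H" using assms by (auto simp: spanned_def)
  have "lincomb (coord (sc r \<star> x)) = (\<Oplus>\<^bsub>H\<^esub>w\<in>carrier W. sc r \<star> (sc (coord x w) \<star> B w))"
    unfolding lincomb_def using x by (intro H.finsum_cong') (auto simp: coord_sc sc_mult[symmetric] H.m_assoc)
  also have "\<dots> = sc r \<star> lincomb (coord x)"
    unfolding lincomb_def using finite_W by (intro H.finsum_rdistr[symmetric]) auto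
  finally show ?thesis using assms x by (simp add: spanned_def)
qed

lemma spanned_B: assumes "w \<in> carrier W" shows "spanned (B w)"
proof -
  have "lincomb (coord (B w)) = (\<Oplus>\<^bsub>H\<^esub>x\<in>carrier W. if w = x then B x else \<zero>\<^bsub>H\<^esub>)"
    unfolding lincomb_def using assms
    by (intro H.finsum_cong') (auto simp: coord_B delta_def sc_one sc_zero)
  also have "\<dots> = B w" using assms finite_W by (intro H.finsum_singleton) auto
  finally show ?thesis using assms by (simp add: spanned_def)
qed

lemma spanned_zero: "spanned \<zero>\<^bsub>H\<^esub>"
  using spanned_sc[OF spanned_B[OF one_closed], of 0] sc_zero by simp

lemma spanned_finsum:
  assumes "finite A" "\<And>a. a \<in> A \<Longrightarrow> spanned (F a)" shows "spanned (finsum H F A)"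
  using assms
proof (induction A rule: finite_induct)
  case (insert a A)
  then have "F a \<in> carrier H" "F \<in> A \<rightarrow> carrier H" by (auto simp: spanned_def)
  then show ?case using insert spanned_add by simp
qed (simp add: spanned_zero)

lemma spanned_word_mult: assumes "s \<in> S" "spanned x" shows "spanned (word_elt [s] \<star> x)"
proof -
  have "word_elt [s] \<star> lincomb (coord x) = (\<Oplus>\<^bsub>H\<^esub>w\<in>carrier W. word_elt [s] \<star> (sc (coord x w) \<star> B w))"
    unfolding lincomb_def using finite_W assms by (intro H.finsum_rdistr) auto
  also have "\<dots> = (\<Oplus>\<^bsub>H\<^esub>w\<in>carrier W. sc (coord x w) \<star> (word_elt [s] \<star> B w))"
    using assms by (intro H.finsum_cong') (auto simp: sc_left_commute)
  finally have e: "word_elt [s] \<star> x = (\<Oplus>\<^bsub>H\<^esub>w\<in>carrier W. sc (coord x w) \<star> (word_elt [s] \<star> B w))"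
    using assms by (simp add: spanned_def)
  show ?thesis unfolding e
    by (intro spanned_finsum finite_W spanned_sc)
      (use assms S_carrier in \<open>auto simp: word_elt_mult_B intro!: spanned_add spanned_sc spanned_B\<close>)
qed

lemma spanned_all: assumes "x \<in> carrier H" shows "spanned x"
proof -
  have mon: "spanned (hecke_monom W S r u)" if "u \<in> lists S" for r u
  proof -
    have "spanned (word_elt u)" using that
    proof (induction u)
      case Nil
      then show ?case using spanned_B[OF one_closed] B_one sc_one by (simp add: hecke_scalar_def)
    next
      case (Cons s u)
      then show ?case using spanned_word_mult[of s "word_elt u"] hecke_monom_mult[of "[s]" u 1 1] by simp
    qed
    from spanned_sc[OF this] show ?thesis using sc_word_elt[OF that] by simp
  qed
  have "spanned (hecke_class f)" if "finite C" "{u. f u \<noteq> 0} = C" "C \<subseteq> lists S" for f C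
    using that
  proof (induction C arbitrary: f rule: finite_induct)
    case empty
    then have "f = monomial 0 []" by (auto simp: monomial_def)
    then show ?case using mon[of "[]" 0] by (simp add: hecke_monom_class)
  next
    case (insert u C)
    let ?g = "f(u := 0)"
    have g: "{a. ?g a \<noteq> 0} = C" using insert by auto
    have gc: "?g \<in> carrier (free_alg S)" unfolding free_alg_carrier g using insert by auto
    have "f = monomial (f u) u \<oplus>\<^bsub>free_alg S\<^esub> ?g" by (auto simp: monomial_def free_alg_add)
    then have "hecke_class f = hecke_monom W S (f u) u \<oplus>\<^bsub>H\<^esub> hecke_class ?g"
      using hecke_class_add[of "monomial (f u) u" ?g] insert.prems gc by (simp add: hecke_monom_class)
    moreover have "spanned (hecke_class ?g)" by (rule insert.IH[OF g]) (use insert.prems in simp)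
    ultimately show ?case using spanned_add mon insert.prems by simp
  qed
  moreover obtain f where "f \<in> carrier (free_alg S)" "x = hecke_class f" using hecke_class_surj[OF assms] .
  ultimately show ?thesis unfolding free_alg_carrier by blast
qed

lemma lincomb_coord: "x \<in> carrier H \<Longrightarrow> lincomb (coord x) = x"
  using spanned_all by (simp add: spanned_def)

lemma hecke_coord_eq: assumes "x \<in> carrier H" shows "hecke_coord W S x = coord x"
  unfolding hecke_coord_def
proof (rule the_equality)
  show "(\<forall>w. w \<notin> carrier W \<longrightarrow> coord x w = 0) \<and> x = (\<Oplus>\<^bsub>H\<^esub>w\<in>carrier W. sc (coord x w) \<star> B w)"
    using coord_on_group[of x] lincomb_coord[OF assms] by (simp add: on_group_def lincomb_def)
next
  fix c assume "(\<forall>w. w \<notin> carrier W \<longrightarrow> c w = 0) \<and> x = (\<Oplus>\<^bsub>H\<^esub>w\<in>carrier W. sc (c w) \<star> B w)"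
  then show "c = coord x" using coord_lincomb[of c] by (simp add: on_group_def lincomb_def)
qed

abbreviation "tr \<equiv> std_trace W S"

lemma tr_coord: "x \<in> carrier H \<Longrightarrow> tr x = coord x \<one>"
  by (simp add: std_trace_def hecke_coord_eq)

text \<open>With \<open>\<theta>\<close> the embedding into the field this applies to entries of representations, with the identity as \<open>\<theta>\<close> to
  coordinates and to the trace.\<close>

lemma semilinear_expand:
  fixes \<phi> :: "'w hecke \<Rightarrow> 'c::comm_ring_1"
  assumes "\<And>x y. x \<in> carrier H \<Longrightarrow> y \<in> carrier H \<Longrightarrow> \<phi> (x \<oplus>\<^bsub>H\<^esub> y) = \<phi> x + \<phi> y"
    and "\<And>r x. x \<in> carrier H \<Longrightarrow> \<phi> (sc r \<star> x) = \<theta> r * \<phi> x"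
    and "x \<in> carrier H"
  shows "\<phi> x = (\<Sum>w\<in>carrier W. \<theta> (coord x w) * \<phi> (B w))"
proof -
  have "\<phi> (lincomb (coord x)) = (\<Sum>w\<in>carrier W. \<phi> (sc (coord x w) \<star> B w))"
    unfolding lincomb_def by (rule additive_finsum) (auto simp: finite_W assms)
  then show ?thesis using assms by (simp add: lincomb_coord)
qed

lemma hact_B_at_one: assumes "w \<in> carrier W" "on_group m" shows "hact (B w) m \<one> = m (inv w)"
  using reduced_exists[OF assms(1)] B_reduced hact_word left_ops_at_one reducedD(1) assms(2) by metis

text \<open>The trace is the value at \<open>1\<close> of the operator of \<open>x\<close> on the coordinate function of \<open>y\<close>, which is the value of the
  latter at \<open>x\<^sup>-\<^sup>1\<close> since a reduced word starting from \<open>1\<close> produces no correction terms.\<close>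

lemma tr_B_B: assumes "x \<in> carrier W" "y \<in> carrier W"
  shows "tr (B x \<star> B y) = of_bool (y = inv x)"
  using assms by (simp add: tr_coord coord_mult coord_B hact_B_at_one) (simp add: delta_def eq_commute)

lemma tr_add: "x \<in> carrier H \<Longrightarrow> y \<in> carrier H \<Longrightarrow> tr (x \<oplus>\<^bsub>H\<^esub> y) = tr x + tr y"
  by (simp add: tr_coord coord_add)

lemma tr_sc: "x \<in> carrier H \<Longrightarrow> tr (sc r \<star> x) = r * tr x"
  by (simp add: tr_coord coord_sc)

lemma tr_mult_B_inv: assumes "x \<in> carrier H" "w \<in> carrier W"
  shows "tr (x \<star> B (inv w)) = coord x w"
proof -
  have "tr (x \<star> B (inv w)) = (\<Sum>u\<in>carrier W. coord x u * tr (B u \<star> B (inv w)))"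
    using semilinear_expand[of "\<lambda>x. tr (x \<star> B (inv w))" "\<lambda>r. r" x] assms
    by (simp add: H.l_distr tr_add H.m_assoc tr_sc)
  also have "\<dots> = (\<Sum>u\<in>carrier W. if u = w then coord x u else 0)"
    using assms by (intro sum.cong) (auto simp: tr_B_B)
  finally show ?thesis using assms finite_W by simp
qed

lemma tr_commute: assumes "x \<in> carrier H" "y \<in> carrier H"
  shows "tr (x \<star> y) = tr (y \<star> x)"
proof -
  have *: "tr (z \<star> B w) = tr (B w \<star> z)" if "z \<in> carrier H" "w \<in> carrier W" for z w
  proof -
    have "tr (z \<star> B w) = (\<Sum>u\<in>carrier W. coord z u * tr (B u \<star> B w))"
      using semilinear_expand[of "\<lambda>x. tr (x \<star> B w)" "\<lambda>r. r" z] that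
      by (simp add: H.l_distr tr_add H.m_assoc tr_sc)
    also have "\<dots> = (\<Sum>u\<in>carrier W. coord z u * tr (B w \<star> B u))"
      using that by (intro sum.cong HOL.refl) (auto simp: tr_B_B)
    also have "\<dots> = tr (B w \<star> z)"
      using semilinear_expand[of "\<lambda>x. tr (B w \<star> x)" "\<lambda>r. r" z] that
      by (simp add: H.r_distr tr_add sc_left_commute tr_sc)
    finally show ?thesis .
  qed
  have "tr (x \<star> y) = (\<Sum>u\<in>carrier W. coord x u * tr (B u \<star> y))"
    using semilinear_expand[of "\<lambda>x. tr (x \<star> y)" "\<lambda>r. r" x] assms
    by (simp add: H.l_distr tr_add H.m_assoc tr_sc)
  also have "\<dots> = (\<Sum>u\<in>carrier W. coord x u * tr (y \<star> B u))"
    using assms by (intro sum.cong HOL.refl) (simp add: *[symmetric])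
  also have "\<dots> = tr (y \<star> x)"
    using semilinear_expand[of "\<lambda>x. tr (y \<star> x)" "\<lambda>r. r" x] assms
    by (simp add: H.r_distr tr_add sc_left_commute tr_sc)
  finally show ?thesis .
qed

text \<open>Invariance of the Casimir tensor. Both sides are expanded in the basis; the two families of structure constants
  coincide because the trace is cyclic and the bases \<open>h\<^sub>w\<close> and \<open>h\<^sub>w\<^sub>'\<close> are dual.\<close>

lemma casimir:
  fixes \<phi> \<psi> :: "'w hecke \<Rightarrow> 'c::comm_ring_1"
  assumes \<phi>: "\<And>x y. x \<in> carrier H \<Longrightarrow> y \<in> carrier H \<Longrightarrow> \<phi> (x \<oplus>\<^bsub>H\<^esub> y) = \<phi> x + \<phi> y"
     "\<And>r x. x \<in> carrier H \<Longrightarrow> \<phi> (sc r \<star> x) = \<theta> r * \<phi> x"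
   and \<psi>: "\<And>x y. x \<in> carrier H \<Longrightarrow> y \<in> carrier H \<Longrightarrow> \<psi> (x \<oplus>\<^bsub>H\<^esub> y) = \<psi> x + \<psi> y"
     "\<And>r x. x \<in> carrier H \<Longrightarrow> \<psi> (sc r \<star> x) = \<theta> r * \<psi> x"
   and x: "x \<in> carrier H"
  shows "(\<Sum>w\<in>carrier W. \<phi> (x \<star> B w) * \<psi> (B (inv w)))
    = (\<Sum>w\<in>carrier W. \<phi> (B w) * \<psi> (B (inv w) \<star> x))"
proof -
  have 1: "\<phi> (x \<star> B w) = (\<Sum>u\<in>carrier W. \<theta> (tr (x \<star> B w \<star> B (inv u))) * \<phi> (B u))"
    if "w \<in> carrier W" for w
    using semilinear_expand[of \<phi> \<theta>, OF \<phi>, of "x \<star> B w"] that x by (simp add: tr_mult_B_inv)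
  have 2: "\<psi> (B (inv u) \<star> x) = (\<Sum>w\<in>carrier W. \<theta> (tr (x \<star> B w \<star> B (inv u))) * \<psi> (B (inv w)))"
    if u: "u \<in> carrier W" for u
  proof -
    have "\<psi> (B (inv u) \<star> x) = (\<Sum>w\<in>carrier W. \<theta> (tr (B (inv u) \<star> x \<star> B (inv w))) * \<psi> (B w))"
      using semilinear_expand[of \<psi> \<theta>, OF \<psi>, of "B (inv u) \<star> x"] u x by (simp add: tr_mult_B_inv)
    also have "\<dots> = (\<Sum>w\<in>carrier W. \<theta> (tr (B (inv u) \<star> x \<star> B w)) * \<psi> (B (inv w)))"
      by (rule sum.reindex_bij_witness[of _ "\<lambda>w. inv w" "\<lambda>w. inv w"]) auto
    also have "\<dots> = (\<Sum>w\<in>carrier W. \<theta> (tr (x \<star> B w \<star> B (inv u))) * \<psi> (B (inv w)))"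
    proof (rule sum.cong[OF HOL.refl])
      fix w assume w: "w \<in> carrier W"
      have "tr (B (inv u) \<star> x \<star> B w) = tr (x \<star> B w \<star> B (inv u))"
        using tr_commute[of "B (inv u)" "x \<star> B w"] u w x by (simp add: H.m_assoc)
      then show "\<theta> (tr (B (inv u) \<star> x \<star> B w)) * \<psi> (B (inv w)) =
        \<theta> (tr (x \<star> B w \<star> B (inv u))) * \<psi> (B (inv w))" by (simp only:)
    qed
    finally show ?thesis .
  qed
  have "(\<Sum>w\<in>carrier W. \<phi> (x \<star> B w) * \<psi> (B (inv w))) =
    (\<Sum>w\<in>carrier W. \<Sum>u\<in>carrier W. \<theta> (tr (x \<star> B w \<star> B (inv u))) * \<phi> (B u) * \<psi> (B (inv w)))"
    by (simp add: 1 sum_distrib_right)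
  also have "\<dots> = (\<Sum>u\<in>carrier W. \<Sum>w\<in>carrier W. \<theta> (tr (x \<star> B w \<star> B (inv u))) * \<phi> (B u) * \<psi> (B (inv w)))"
    by (rule sum.swap)
  also have "\<dots> = (\<Sum>u\<in>carrier W. \<phi> (B u) * \<psi> (B (inv u) \<star> x))"
    by (simp add: 2 sum_distrib_left mult_ac)
  finally show ?thesis .
qed

end

section \<open>Linear algebra\<close>

lemma mult_mat_index:
  assumes "A \<in> carrier_mat n m" "B \<in> carrier_mat m k" "i < n" "j < k"
  shows "(A * B) $$ (i, j) = (\<Sum>l<m. A $$ (i, l) * B $$ (l, j))"
  using assms by (auto simp: scalar_prod_def lessThan_atLeast0 intro!: sum.cong)

lemma mult_mat_vec_nth:
  assumes "A \<in> carrier_mat n m" "v \<in> carrier_vec m" "i < n"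
  shows "(A *\<^sub>v v) $ i = (\<Sum>l<m. A $$ (i, l) * v $ l)"
  using assms by (auto simp: scalar_prod_def lessThan_atLeast0 intro!: sum.cong)

lemma vec_subspace_iff:
  "VectorSpace.subspace class_ring U (module_vec TYPE('k::field) d) \<longleftrightarrow>
    U \<subseteq> carrier_vec d \<and> 0\<^sub>v d \<in> U \<and> (\<forall>u\<in>U. \<forall>v\<in>U. u + v \<in> U) \<and> (\<forall>c. \<forall>u\<in>U. c \<cdot>\<^sub>v u \<in> U)"
proof -
  interpret vec_space "TYPE('k)" d .
  show ?thesis
    unfolding VectorSpace.subspace_def submodule_def using vec_vs[where ?'a = 'k and n = d]
      vec_module[where ?'a = 'k and n = d]
    by (auto simp: module_vec_simps)
qed

lemma det_nonzero_inverse: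
  fixes P :: "'k::field mat"
  assumes "P \<in> carrier_mat d d" "det P \<noteq> 0"
  obtains Q where "Q \<in> carrier_mat d d" "P * Q = 1\<^sub>m d" "Q * P = 1\<^sub>m d"
proof -
  have "P \<in> Units (ring_mat TYPE('k) d ())" by (rule det_non_zero_imp_unit[OF assms])
  then show ?thesis using that unfolding Units_def ring_mat_def by auto
qed

text \<open>Coordinates in which a subspace is a coordinate subspace. Among the invertible matrices choose one with as many
  columns in \<open>U\<close> as possible, and let \<open>J\<close> be the set of their positions. If some \<open>u \<in> U\<close> had a nonzero coordinate \<open>k \<notin> J\<close>,
  the \<open>k\<close>-th column could be replaced by \<open>u\<close>.\<close>

lemma adapted_basis:
  fixes U :: "'k::field vec set"
  assumes U: "VectorSpace.subspace class_ring U (module_vec TYPE('k) d)"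
  obtains P Q J where "P \<in> carrier_mat d d" "Q \<in> carrier_mat d d" "P * Q = 1\<^sub>m d" "Q * P = 1\<^sub>m d"
    "J \<subseteq> {..<d}" "\<And>j. j \<in> J \<Longrightarrow> col P j \<in> U" "\<And>u i. u \<in> U \<Longrightarrow> i < d \<Longrightarrow> i \<notin> J \<Longrightarrow> (Q *\<^sub>v u) $ i = 0"
proof -
  define good where
    "good J \<longleftrightarrow> (\<exists>P \<in> carrier_mat d d. det P \<noteq> 0 \<and> J \<subseteq> {..<d} \<and> (\<forall>j\<in>J. col P j \<in> U))" for J
  have "good {}" unfolding good_def by (intro bexI[of _ "1\<^sub>m d"]) auto
  moreover have "\<forall>J. good J \<longrightarrow> card J \<le> d"
    unfolding good_def using subset_eq_atLeast0_lessThan_card by (auto simp: lessThan_atLeast0)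
  ultimately have "\<exists>J. good J \<and> (\<forall>J'. good J' \<longrightarrow> card J' \<le> card J)"
    using arg_max_natI[of good "{}" card "Suc d"] arg_max_nat_le[of good _ card "Suc d"] by (metis le_imp_less_Suc)
  then obtain J where good: "good J" and max: "\<And>J'. good J' \<Longrightarrow> card J' \<le> card J" by blast
  from good obtain P where P: "P \<in> carrier_mat d d" "det P \<noteq> 0" "J \<subseteq> {..<d}" "\<And>j. j \<in> J \<Longrightarrow> col P j \<in> U"
    unfolding good_def by blast
  obtain Q where Q: "Q \<in> carrier_mat d d" "P * Q = 1\<^sub>m d" "Q * P = 1\<^sub>m d"
    using det_nonzero_inverse[OF P(1,2)] .
  have Uc: "U \<subseteq> carrier_vec d" using U by (simp add: vec_subspace_iff)
  have "(Q *\<^sub>v u) $ k = 0" if u: "u \<in> U" and k: "k < d" "k \<notin> J" for u k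
  proof (rule ccontr)
    define w where "w = Q *\<^sub>v u"
    assume "(Q *\<^sub>v u) $ k \<noteq> 0"
    then have wk: "w $ k \<noteq> 0" by (simp add: w_def)
    have uc: "u \<in> carrier_vec d" using u Uc by blast
    have wc: "w \<in> carrier_vec d" using Q uc by (simp add: w_def)
    have Pw: "P *\<^sub>v w = u" unfolding w_def using P Q uc by (simp flip: assoc_mult_mat_vec)
    \<comment> \<open>The identity with its k-th column replaced by the coordinates of u, so P * E is P with k-th column u.\<close>
    define E where "E = mat d d (\<lambda>(i, j). if j = k then w $ i else if i = j then 1 else 0)"
    have E: "E \<in> carrier_mat d d" by (simp add: E_def)
    have "det E \<noteq> 0"
    proof
      assume "det E = 0"
      then obtain x where x: "x \<in> carrier_vec d" "x \<noteq> 0\<^sub>v d" "E *\<^sub>v x = 0\<^sub>v d"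
        using det_0_iff_vec_prod_zero_field[OF E] by blast
      have row: "(\<Sum>l<d. E $$ (i, l) * x $ l) = 0" if "i < d" for i
        using mult_mat_vec_nth[OF E x(1) that] x(3) that by simp
      have "(\<Sum>l<d. E $$ (k, l) * x $ l) = (\<Sum>l<d. if l = k then w $ k * x $ k else 0)"
        using k by (intro sum.cong) (auto simp: E_def)
      then have xk: "x $ k = 0" using row[OF k(1)] k wk by simp
      have "x $ i = 0" if i: "i < d" for i
      proof -
        have "(\<Sum>l<d. E $$ (i, l) * x $ l) = (\<Sum>l<d. if l = i then x $ i else 0)"
          using i xk k by (intro sum.cong) (auto simp: E_def)
        then show ?thesis using row[OF i] i by simp
      qed
      then show False using x by (auto intro!: eq_vecI)
    qed
    moreover have "det (P * E) = det P * det E" using P E by (simp add: det_mult)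
    ultimately have "det (P * E) \<noteq> 0" using P by simp
    moreover have cols: "col (P * E) j = P *\<^sub>v col E j" if "j < d" for j
      using that P E by (auto intro!: eq_vecI)
    have "col E k = w" using wc k by (auto intro!: eq_vecI simp: E_def)
    then have ck: "col (P * E) k = u" using cols k Pw by simp
    moreover have "col (P * E) j = col P j" if "j \<in> J" for j
    proof -
      have j: "j < d" "j \<noteq> k" using that P k by auto
      have "col E j = unit_vec d j" using j by (auto intro!: eq_vecI simp: E_def)
      then have "col (P * E) j = P *\<^sub>v unit_vec d j" using cols j by simp
      also have "\<dots> = col P j" using P j by (intro eq_vecI) (auto simp: col_def)
      finally show ?thesis .
    qed
    ultimately have "good (insert k J)"
      unfolding good_def using P(1,3) E k u P(4) by (intro bexI[of _ "P * E"]) auto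
    from max[OF this] k finite_subset[OF P(3)] show False by simp
  qed
  with that[OF P(1) Q P(3,4)] show ?thesis by blast
qed

lemma adapted_basis_proper:
  fixes U :: "'k::field vec set"
  assumes U: "VectorSpace.subspace class_ring U (module_vec TYPE('k) d)"
    and "U \<noteq> {0\<^sub>v d}" "U \<noteq> carrier_vec d"
  obtains P Q J where "P \<in> carrier_mat d d" "Q \<in> carrier_mat d d" "P * Q = 1\<^sub>m d" "Q * P = 1\<^sub>m d"
    "J \<subset> {..<d}" "J \<noteq> {}"
    "\<And>j. j \<in> J \<Longrightarrow> col P j \<in> U" "\<And>u i. u \<in> U \<Longrightarrow> i < d \<Longrightarrow> i \<notin> J \<Longrightarrow> (Q *\<^sub>v u) $ i = 0"
proof -
  note sub = U[unfolded vec_subspace_iff]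
  obtain P Q J where P: "P \<in> carrier_mat d d" "Q \<in> carrier_mat d d" "P * Q = 1\<^sub>m d" "Q * P = 1\<^sub>m d"
    "J \<subseteq> {..<d}" "\<And>j. j \<in> J \<Longrightarrow> col P j \<in> U" "\<And>u i. u \<in> U \<Longrightarrow> i < d \<Longrightarrow> i \<notin> J \<Longrightarrow> (Q *\<^sub>v u) $ i = 0"
    using adapted_basis[OF U] by blast
  have PQ: "P *\<^sub>v (Q *\<^sub>v v) = v" if "v \<in> carrier_vec d" for v
    using P that by (simp flip: assoc_mult_mat_vec)
  have "J \<noteq> {}"
  proof
    assume J: "J = {}"
    have "u = 0\<^sub>v d" if u: "u \<in> U" for u
    proof -
      have "Q *\<^sub>v u = 0\<^sub>v d" using P(7)[OF u] J P(2) by (intro eq_vecI) auto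
      then have "u = P *\<^sub>v 0\<^sub>v d" using PQ u sub by (metis subsetD)
      then show ?thesis using P by (auto intro!: eq_vecI)
    qed
    then show False using sub assms(2) by blast
  qed
  moreover have "J \<noteq> {..<d}"
  proof
    assume J: "J = {..<d}"
    have "v \<in> U" if v: "v \<in> carrier_vec d" for v
    proof -
      define w where "w = Q *\<^sub>v v"
      have part: "n \<le> d \<Longrightarrow> vec d (\<lambda>i. \<Sum>j<n. P $$ (i, j) * w $ j) \<in> U" for n
      proof (induction n)
        case 0
        have "vec d (\<lambda>i. 0 :: 'k) = 0\<^sub>v d" by auto
        then show ?case using sub by simp
      next
        case (Suc n)
        have "vec d (\<lambda>i. \<Sum>j<Suc n. P $$ (i, j) * w $ j)
          = vec d (\<lambda>i. \<Sum>j<n. P $$ (i, j) * w $ j) + w $ n \<cdot>\<^sub>v col P n"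
          using P(1) Suc by (auto intro!: eq_vecI)
        moreover have "col P n \<in> U" using P(6) J Suc by simp
        ultimately show ?case using Suc sub by simp
      qed
      have "v = vec d (\<lambda>i. \<Sum>j<d. P $$ (i, j) * w $ j)"
        using PQ[OF v, symmetric] mult_mat_vec_nth[OF P(1), of w] P v by (auto intro!: eq_vecI simp: w_def)
      then show ?thesis using part by auto
    qed
    then show False using sub assms(3) by blast
  qed
  ultimately show ?thesis using that P by blast
qed

text \<open>A bijective matrix is square: if \<open>X\<close> is its inverse, then \<open>n\<close> and \<open>m\<close> are the traces of \<open>Y X\<close> and \<open>X Y\<close>.\<close>

lemma schur_injective:
  fixes Y :: "'k::field mat"
  assumes char_0: "inj (of_nat :: nat \<Rightarrow> 'k)"
    and Y: "Y \<in> carrier_mat n m"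
    and inj: "\<And>v. v \<in> carrier_vec m \<Longrightarrow> Y *\<^sub>v v = 0\<^sub>v n \<Longrightarrow> v = 0\<^sub>v m"
    and surj: "\<And>u. u \<in> carrier_vec n \<Longrightarrow> \<exists>v \<in> carrier_vec m. Y *\<^sub>v v = u"
  shows "n = m \<and> invertible_mat Y"
proof -
  have "\<forall>i. \<exists>v. v \<in> carrier_vec m \<and> Y *\<^sub>v v = unit_vec n i" using surj unit_vec_carrier by blast
  then obtain b where b: "\<And>i. b i \<in> carrier_vec m" "\<And>i. Y *\<^sub>v b i = unit_vec n i" by metis
  define X where "X = mat_of_cols m (map b [0..<n])"
  have X: "X \<in> carrier_mat m n" by (auto simp: X_def)
  have cX: "col X i = b i" if "i < n" for i using that b by (simp add: X_def)
  have YX: "Y * X = 1\<^sub>m n"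
  proof (rule mat_col_eqI)
    fix i assume i: "i < dim_col (1\<^sub>m n :: 'k mat)"
    have "col (Y * X) i = Y *\<^sub>v col X i" using i X Y by (auto intro!: eq_vecI)
    then show "col (Y * X) i = col (1\<^sub>m n) i" using i cX b by simp
  qed (use X Y in auto)
  have XY: "X * Y = 1\<^sub>m m"
  proof (rule mat_col_eqI)
    fix i assume i: "i < dim_col (1\<^sub>m m :: 'k mat)"
    define v where "v = X *\<^sub>v col Y i - unit_vec m i"
    have cY: "col Y i \<in> carrier_vec n" using Y i by simp
    have "Y *\<^sub>v unit_vec m i = col Y i" using Y i by (intro eq_vecI) (auto simp: col_def)
    moreover have "Y *\<^sub>v (X *\<^sub>v col Y i) = col Y i" using X Y cY YX by (simp flip: assoc_mult_mat_vec)
    ultimately have "Y *\<^sub>v v = 0\<^sub>v n" unfolding v_def using X Y cY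
      by (subst mult_minus_distrib_mat_vec[of _ n m]) auto
    then have "v = 0\<^sub>v m" using inj[of v] X cY by (auto simp: v_def)
    then have "X *\<^sub>v col Y i = unit_vec m i"
      using X cY i by (auto simp: v_def vec_eq_iff)
    moreover have "col (X * Y) i = X *\<^sub>v col Y i" using i X Y by (auto intro!: eq_vecI)
    ultimately show "col (X * Y) i = col (1\<^sub>m m) i" using i by simp
  qed (use X Y in auto)
  have "of_nat n = (\<Sum>i<n. (Y * X) $$ (i, i))" unfolding YX by simp
  also have "\<dots> = (\<Sum>i<n. \<Sum>j<m. Y $$ (i, j) * X $$ (j, i))"
    by (intro sum.cong HOL.refl mult_mat_index[OF Y X]) auto
  also have "\<dots> = (\<Sum>j<m. \<Sum>i<n. X $$ (j, i) * Y $$ (i, j))"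
    by (subst sum.swap) (simp add: mult.commute)
  also have "\<dots> = (\<Sum>j<m. (X * Y) $$ (j, j))"
    by (intro sum.cong HOL.refl mult_mat_index[OF X Y, symmetric]) auto
  also have "\<dots> = (of_nat m :: 'k)" unfolding XY by simp
  finally have "n = m" using char_0 by (simp add: inj_eq)
  then show ?thesis using X Y XY YX unfolding invertible_mat_def inverts_mat_def by auto
qed

section \<open>Representations and orthogonality\<close>

lemma invertible_mat_inverse:
  assumes P: "P \<in> carrier_mat d d" "invertible_mat P"
  obtains Q where "Q \<in> carrier_mat d d" "P * Q = 1\<^sub>m d" "Q * P = 1\<^sub>m d"
proof -
  obtain Q where Q: "P * Q = 1\<^sub>m d" "Q * P = 1\<^sub>m (dim_row Q)"
    using P unfolding invertible_mat_def inverts_mat_def by auto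
  have "dim_col (P * Q) = d" "dim_col (Q * P) = dim_row Q" unfolding Q by simp_all
  then have "Q \<in> carrier_mat d d" using P(1) by auto
  then show ?thesis using that Q by auto
qed

lemma invertible_mat_det:
  fixes P :: "'k::field mat"
  assumes P: "P \<in> carrier_mat d d" "invertible_mat P" shows "det P \<noteq> 0"
proof
  obtain Q where Q: "Q \<in> carrier_mat d d" "P * Q = 1\<^sub>m d" using invertible_mat_inverse[OF P] .
  assume "det P = 0"
  moreover have "det P * det Q = 1" using det_mult[OF P(1) Q(1)] Q(2) by simp
  ultimately show False by simp
qed

lemma det_nonzero_invertible:
  fixes P :: "'k::field mat"
  assumes "P \<in> carrier_mat d d" "det P \<noteq> 0" shows "invertible_mat P"
proof -
  obtain Q where "Q \<in> carrier_mat d d" "P * Q = 1\<^sub>m d" "Q * P = 1\<^sub>m d"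
    using det_nonzero_inverse[OF assms] .
  then show ?thesis using assms(1) unfolding invertible_mat_def inverts_mat_def by auto
qed

locale hecke_field = finite_coxeter_group W S
  for W :: "('w, 'b) monoid_scheme" (structure) and S :: "'w set" +
  fixes \<theta> :: "laurent \<Rightarrow> 'k::field"
  assumes splitting: "splitting_field W S \<theta>"
begin

sublocale \<theta>: inj_comm_ring_hom \<theta>
  using splitting by (simp add: splitting_field_def)

text \<open>Integers embed into the Laurent polynomials, and these embed into the field.\<close>

lemma field_char_0: "inj (of_nat :: nat \<Rightarrow> 'k)"
proof (rule injI)
  fix m n :: nat assume "of_nat m = (of_nat n :: 'k)"
  then have "\<theta> (of_nat m) = \<theta> (of_nat n)" by (simp add: \<theta>.hom_of_nat)
  then show "m = n" by (simp add: \<theta>.injectivity)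
qed

abbreviation "rep \<equiv> hecke_rep W S \<theta>"
abbreviation "irrep \<equiv> hecke_irrep W S \<theta>"

lemma repD:
  assumes "rep d \<rho>"
  shows "x \<in> carrier H \<Longrightarrow> \<rho> x \<in> carrier_mat d d" "\<rho> \<one>\<^bsub>H\<^esub> = 1\<^sub>m d"
    "x \<in> carrier H \<Longrightarrow> y \<in> carrier H \<Longrightarrow> \<rho> (x \<oplus>\<^bsub>H\<^esub> y) = \<rho> x + \<rho> y"
    "x \<in> carrier H \<Longrightarrow> y \<in> carrier H \<Longrightarrow> \<rho> (x \<star> y) = \<rho> x * \<rho> y"
    "\<rho> (sc r) = \<theta> r \<cdot>\<^sub>m 1\<^sub>m d"
  using assms by (simp_all add: hecke_rep_def)

lemma irrepD:
  assumes "irrep d \<rho>" shows "rep d \<rho>" "d > 0"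
  using assms by (simp_all add: hecke_irrep_def)

lemma irrep_dim_unique: "rep d \<rho> \<Longrightarrow> rep d' \<rho> \<Longrightarrow> d = d'"
  by (metis repD(2) index_one_mat(2))

lemma rep_entry_add:
  assumes "rep d \<rho>" "i < d" "j < d" "x \<in> carrier H" "y \<in> carrier H"
  shows "\<rho> (x \<oplus>\<^bsub>H\<^esub> y) $$ (i, j) = \<rho> x $$ (i, j) + \<rho> y $$ (i, j)"
  using assms repD(1)[OF assms(1,4)] repD(1)[OF assms(1,5)] repD(3)[OF assms(1,4,5)] by simp

lemma rep_entry_mult:
  assumes "rep d \<rho>" "i < d" "j < d" "x \<in> carrier H" "y \<in> carrier H"
  shows "\<rho> (x \<star> y) $$ (i, j) = (\<Sum>l<d. \<rho> x $$ (i, l) * \<rho> y $$ (l, j))"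
  unfolding repD(4)[OF assms(1,4,5)]
  by (rule mult_mat_index[OF repD(1)[OF assms(1,4)] repD(1)[OF assms(1,5)] assms(2,3)])

lemma rep_entry_sc:
  assumes "rep d \<rho>" "i < d" "j < d" "x \<in> carrier H"
  shows "\<rho> (sc r \<star> x) $$ (i, j) = \<theta> r * \<rho> x $$ (i, j)"
proof -
  have "\<rho> (sc r \<star> x) = \<theta> r \<cdot>\<^sub>m \<rho> x"
    using repD(1)[OF assms(1,4)] repD(4)[OF assms(1) sc_closed assms(4)] repD(5)[OF assms(1)]
    by (simp add: mult_smult_assoc_mat[OF one_carrier_mat])
  then show ?thesis using assms repD(1)[OF assms(1,4)] by simp
qed

text \<open>The matrix of the Casimir tensor in a pair of representations.\<close>

definition coeff_pairing :: "('w hecke \<Rightarrow> 'k mat) \<Rightarrow> ('w hecke \<Rightarrow> 'k mat) \<Rightarrow> nat \<Rightarrow> nat \<Rightarrow> nat \<Rightarrow> nat \<Rightarrow> 'k" where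
  "coeff_pairing \<rho> \<rho>' i j k l = (\<Sum>w\<in>carrier W. \<rho> (B w) $$ (i, j) * \<rho>' (B (inv w)) $$ (k, l))"

lemma coeff_pairing_swap: "coeff_pairing \<rho> \<rho>' i j k l = coeff_pairing \<rho>' \<rho> k l i j"
  unfolding coeff_pairing_def
  by (rule sum.reindex_bij_witness[of _ "\<lambda>w. inv w" "\<lambda>w. inv w"]) (auto simp: mult.commute)

text \<open>For fixed inner indices \<open>j\<close>, \<open>k\<close> the outer indices form the matrix \<open>\<Sum>\<^sub>w \<rho>(h\<^sub>w) E\<^sub>j\<^sub>k \<rho>'(h\<^sub>w\<^sub>')\<close> with an elementary
  matrix in the middle, and \<open>casimir\<close> moves \<open>x\<close> from one end to the other.\<close>

lemma coeff_pairing_intertwines: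
  assumes r: "rep d \<rho>" "rep d' \<rho>'" and jk: "j < d" "k < d'" and x: "x \<in> carrier H"
  defines "Y \<equiv> mat d d' (\<lambda>(i, l). coeff_pairing \<rho> \<rho>' i j k l)"
  shows "\<rho> x * Y = Y * \<rho>' x"
proof (rule eq_matI)
  have Y: "Y \<in> carrier_mat d d'" by (simp add: Y_def)
  note \<rho>x = repD(1)[OF r(1) x] repD(1)[OF r(2) x]
  fix i l assume "i < dim_row (Y * \<rho>' x)" "l < dim_col (Y * \<rho>' x)"
  then have il: "i < d" "l < d'" using Y \<rho>x by auto
  have "(\<rho> x * Y) $$ (i, l) = (\<Sum>p<d. \<rho> x $$ (i, p) * (\<Sum>w\<in>carrier W. \<rho> (B w) $$ (p, j) * \<rho>' (B (inv w)) $$ (k, l)))"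
    using il by (subst mult_mat_index[OF \<rho>x(1) Y]) (auto simp: Y_def coeff_pairing_def)
  also have "\<dots> = (\<Sum>w\<in>carrier W. \<rho> (x \<star> B w) $$ (i, j) * \<rho>' (B (inv w)) $$ (k, l))"
    unfolding sum_distrib_left by (subst sum.swap)
      (intro sum.cong HOL.refl, simp add: rep_entry_mult[OF r(1) il(1) jk(1) x] sum_distrib_right mult.assoc)
  also have "\<dots> = (\<Sum>w\<in>carrier W. \<rho> (B w) $$ (i, j) * \<rho>' (B (inv w) \<star> x) $$ (k, l))"
    by (rule casimir[where \<theta> = \<theta>])
      (auto intro: rep_entry_add[OF r(1)] rep_entry_add[OF r(2)] rep_entry_sc[OF r(1)] rep_entry_sc[OF r(2)] il jk x)
  also have "\<dots> = (\<Sum>p<d'. (\<Sum>w\<in>carrier W. \<rho> (B w) $$ (i, j) * \<rho>' (B (inv w)) $$ (k, p)) * \<rho>' x $$ (p, l))"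
    unfolding sum_distrib_right by (subst sum.swap)
      (intro sum.cong HOL.refl, simp add: rep_entry_mult[OF r(2) jk(2) il(2) _ x] sum_distrib_left mult.assoc)
  also have "\<dots> = (Y * \<rho>' x) $$ (i, l)"
    using il by (subst mult_mat_index[OF Y \<rho>x(2)]) (auto simp: Y_def coeff_pairing_def)
  finally show "(\<rho> x * Y) $$ (i, l) = (Y * \<rho>' x) $$ (i, l)" .
qed (use repD(1)[OF r(1) x] repD(1)[OF r(2) x] in \<open>auto simp: Y_def\<close>)

lemma irrep_invariant_subspace:
  assumes "irrep d \<rho>" "U \<subseteq> carrier_vec d" "0\<^sub>v d \<in> U"
    "\<And>u v. u \<in> U \<Longrightarrow> v \<in> U \<Longrightarrow> u + v \<in> U" "\<And>c u. u \<in> U \<Longrightarrow> c \<cdot>\<^sub>v u \<in> U"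
    "\<And>x u. x \<in> carrier H \<Longrightarrow> u \<in> U \<Longrightarrow> \<rho> x *\<^sub>v u \<in> U"
  shows "U = {0\<^sub>v d} \<or> U = carrier_vec d"
proof -
  have "VectorSpace.subspace class_ring U (module_vec TYPE('k) d)"
    unfolding vec_subspace_iff using assms(2-5) by blast
  then show ?thesis using assms(1,6) unfolding hecke_irrep_def by blast
qed

lemma schur_lemma:
  assumes irr: "irrep d \<rho>" "irrep d' \<rho>'" and Y: "Y \<in> carrier_mat d d'"
    and comm: "\<And>x. x \<in> carrier H \<Longrightarrow> \<rho> x * Y = Y * \<rho>' x"
  shows "Y = 0\<^sub>m d d' \<or> (d = d' \<and> invertible_mat Y)"
proof -
  note rep = irrepD(1)[OF irr(1)] irrepD(1)[OF irr(2)]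
  have act: "\<rho> x *\<^sub>v (Y *\<^sub>v v) = Y *\<^sub>v (\<rho>' x *\<^sub>v v)" if "x \<in> carrier H" "v \<in> carrier_vec d'" for x v
    using comm[OF that(1)] repD(1)[OF rep(1) that(1)] repD(1)[OF rep(2) that(1)] Y that(2)
    by (metis assoc_mult_mat_vec)
  let ?ker = "{v \<in> carrier_vec d'. Y *\<^sub>v v = 0\<^sub>v d}" and ?im = "(\<lambda>v. Y *\<^sub>v v) ` carrier_vec d'"
  have ker: "?ker = {0\<^sub>v d'} \<or> ?ker = carrier_vec d'"
  proof (rule irrep_invariant_subspace[OF irr(2)])
    show "0\<^sub>v d' \<in> ?ker" using Y by (auto intro!: eq_vecI)
  next
    fix u v assume "u \<in> ?ker" "v \<in> ?ker"
    then show "u + v \<in> ?ker" using Y by (auto simp: mult_add_distrib_mat_vec)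
  next
    fix c u assume "u \<in> ?ker"
    then show "c \<cdot>\<^sub>v u \<in> ?ker" using Y by (auto simp: mult_mat_vec)
  next
    fix x u assume x: "x \<in> carrier H" and u: "u \<in> ?ker"
    have "\<rho> x *\<^sub>v 0\<^sub>v d = 0\<^sub>v d" using repD(1)[OF rep(1) x] by (auto intro!: eq_vecI)
    then show "\<rho>' x *\<^sub>v u \<in> ?ker" using act[OF x, of u] u repD(1)[OF rep(2) x] by auto
  qed auto
  have im: "?im = {0\<^sub>v d} \<or> ?im = carrier_vec d"
  proof (rule irrep_invariant_subspace[OF irr(1)])
    show "?im \<subseteq> carrier_vec d" using Y by auto
    have "0\<^sub>v d = Y *\<^sub>v 0\<^sub>v d'" using Y by (auto intro!: eq_vecI)
    then show "0\<^sub>v d \<in> ?im" by (rule image_eqI) simp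
  next
    fix u v assume "u \<in> ?im" "v \<in> ?im"
    then obtain a b where ab: "a \<in> carrier_vec d'" "b \<in> carrier_vec d'" "u = Y *\<^sub>v a" "v = Y *\<^sub>v b" by blast
    then have "u + v = Y *\<^sub>v (a + b)" using Y by (simp add: mult_add_distrib_mat_vec)
    then show "u + v \<in> ?im" by (rule image_eqI) (use ab in simp)
  next
    fix c u assume "u \<in> ?im"
    then obtain a where a: "a \<in> carrier_vec d'" "u = Y *\<^sub>v a" by blast
    then have "c \<cdot>\<^sub>v u = Y *\<^sub>v (c \<cdot>\<^sub>v a)" using Y by (simp add: mult_mat_vec)
    then show "c \<cdot>\<^sub>v u \<in> ?im" by (rule image_eqI) (use a in simp)
  next
    fix x u assume x: "x \<in> carrier H" and "u \<in> ?im"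
    then obtain a where a: "a \<in> carrier_vec d'" "u = Y *\<^sub>v a" by blast
    then have "\<rho> x *\<^sub>v u = Y *\<^sub>v (\<rho>' x *\<^sub>v a)" using act x by simp
    then show "\<rho> x *\<^sub>v u \<in> ?im" by (rule image_eqI) (use a repD(1)[OF rep(2) x] in simp)
  qed
  show ?thesis
  proof (cases "?ker = carrier_vec d' \<or> ?im = {0\<^sub>v d}")
    case True
    then have z: "Y *\<^sub>v v = 0\<^sub>v d" if "v \<in> carrier_vec d'" for v using that by blast
    have "Y = 0\<^sub>m d d'"
    proof (rule eq_matI)
      fix i j assume ij: "i < dim_row (0\<^sub>m d d')" "j < dim_col (0\<^sub>m d d')"
      have "(Y *\<^sub>v unit_vec d' j) $ i = Y $$ (i, j)" using Y ij by simp
      then show "Y $$ (i, j) = 0\<^sub>m d d' $$ (i, j)" using z[of "unit_vec d' j"] ij by simp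
    qed (use Y in auto)
    then show ?thesis by simp
  next
    case False
    then have k: "?ker = {0\<^sub>v d'}" and i: "?im = carrier_vec d" using ker im by blast+
    have "d = d' \<and> invertible_mat Y"
    proof (rule schur_injective[OF field_char_0 Y])
      fix v assume "v \<in> carrier_vec d'" "Y *\<^sub>v v = 0\<^sub>v d"
      then show "v = 0\<^sub>v d'" using k by blast
    next
      fix u :: "'k vec" assume "u \<in> carrier_vec d"
      then have "u \<in> ?im" using i by simp
      then show "\<exists>v\<in>carrier_vec d'. Y *\<^sub>v v = u" by auto
    qed
    then show ?thesis by simp
  qed
qed

lemma coeff_pairing_not_iso:
  assumes irr: "irrep d \<rho>" "irrep d' \<rho>'" and not_iso: "\<not> (d = d' \<and> hecke_rep_iso W S d \<rho>' \<rho>)"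
    and idx: "i < d" "j < d" "k < d'" "l < d'"
  shows "coeff_pairing \<rho> \<rho>' i j k l = 0"
proof -
  define Y where "Y = mat d d' (\<lambda>(i, l). coeff_pairing \<rho> \<rho>' i j k l)"
  have Y: "Y \<in> carrier_mat d d'" by (simp add: Y_def)
  have comm: "\<rho> x * Y = Y * \<rho>' x" if "x \<in> carrier H" for x
    unfolding Y_def by (rule coeff_pairing_intertwines[OF irrepD(1)[OF irr(1)] irrepD(1)[OF irr(2)] idx(2,3) that])
  have "\<not> (d = d' \<and> invertible_mat Y)"
    using not_iso comm Y unfolding hecke_rep_iso_def by metis
  then have "Y = 0\<^sub>m d d'" using schur_lemma[OF irr Y comm] by blast
  then have "Y $$ (i, l) = 0" using idx by simp
  then show ?thesis using idx by (simp add: Y_def)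
qed

text \<open>By Schur's lemma over a splitting field the pairing is \<open>a\<^sub>j\<^sub>k \<delta>\<^sub>i\<^sub>l\<close>. It is symmetric under the exchange of the index pairs
  \<open>(i,j)\<close> and \<open>(k,l)\<close>, because \<open>w\<close> can be replaced by its inverse; this forces \<open>a\<^sub>j\<^sub>k\<close> to be a multiple of \<open>\<delta>\<^sub>j\<^sub>k\<close>.\<close>

lemma coeff_pairing_same:
  assumes irr: "irrep d \<rho>"
  shows "\<exists>c. \<forall>i<d. \<forall>j<d. \<forall>k<d. \<forall>l<d. coeff_pairing \<rho> \<rho> i j k l = (if i = l \<and> j = k then c else 0)"
proof -
  note rep = irrepD(1)[OF irr] and d = irrepD(2)[OF irr]
  let ?K = "coeff_pairing \<rho> \<rho>"
  have "\<exists>a. \<forall>i<d. \<forall>l<d. ?K i j k l = (if i = l then a else 0)" if jk: "j < d" "k < d" for j k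
  proof -
    define Y where "Y = mat d d (\<lambda>(i, l). ?K i j k l)"
    have Y: "Y \<in> carrier_mat d d" by (simp add: Y_def)
    have "Y * \<rho> x = \<rho> x * Y" if "x \<in> carrier H" for x
      unfolding Y_def by (rule coeff_pairing_intertwines[OF rep rep jk that, symmetric])
    then obtain a where a: "Y = a \<cdot>\<^sub>m 1\<^sub>m d"
      using splitting irr Y unfolding splitting_field_def by blast
    have "?K i j k l = (if i = l then a else 0)" if "i < d" "l < d" for i l
    proof -
      have "Y $$ (i, l) = ?K i j k l" using that by (simp add: Y_def)
      moreover have "(a \<cdot>\<^sub>m 1\<^sub>m d) $$ (i, l) = (if i = l then a else 0)" using that by simp
      ultimately show ?thesis using a by simp
    qed
    then show ?thesis by blast
  qed
  then obtain a where a: "\<And>i j k l. i < d \<Longrightarrow> j < d \<Longrightarrow> k < d \<Longrightarrow> l < d \<Longrightarrow> ?K i j k l = (if i = l then a j k else 0)"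
    by metis
  have "a j k = (if j = k then a 0 0 else 0)" if jk: "j < d" "k < d" for j k
  proof -
    have "a j k = ?K 0 j k 0" using a[OF d jk d] by simp
    also have "\<dots> = ?K k 0 0 j" by (rule coeff_pairing_swap)
    also have "\<dots> = (if k = j then a 0 0 else 0)" by (rule a) (use d jk in auto)
    finally show ?thesis by auto
  qed
  note const = this
  show ?thesis
  proof (intro exI allI impI)
    fix i j k l assume idx: "i < d" "j < d" "k < d" "l < d"
    show "?K i j k l = (if i = l \<and> j = k then a 0 0 else 0)"
      unfolding a[OF idx] using const[OF idx(2,3)] by presburger
  qed
qed

text \<open>Eventually this is the Schur element (\<open>schur_element_pairing\<close>).\<close>

definition pairing_const :: "('w hecke \<Rightarrow> 'k mat) \<Rightarrow> 'k" where
  "pairing_const \<rho> = coeff_pairing \<rho> \<rho> 0 0 0 0"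

lemma coeff_pairing_self:
  assumes irr: "irrep d \<rho>" and idx: "i < d" "j < d" "k < d" "l < d"
  shows "coeff_pairing \<rho> \<rho> i j k l = (if i = l \<and> j = k then pairing_const \<rho> else 0)"
proof -
  obtain c where c: "\<forall>i<d. \<forall>j<d. \<forall>k<d. \<forall>l<d. coeff_pairing \<rho> \<rho> i j k l = (if i = l \<and> j = k then c else 0)"
    using coeff_pairing_same[OF irr] by blast
  have "pairing_const \<rho> = c" using c irrepD(2)[OF irr] by (simp add: pairing_const_def)
  then show ?thesis using c idx by simp
qed

definition character :: "nat \<Rightarrow> ('w hecke \<Rightarrow> 'k mat) \<Rightarrow> 'w hecke \<Rightarrow> 'k" where
  "character d \<rho> x = (\<Sum>i<d. \<rho> x $$ (i, i))"

lemma character_one: "rep d \<rho> \<Longrightarrow> character d \<rho> \<one>\<^bsub>H\<^esub> = of_nat d"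
  unfolding character_def by (simp add: repD(2))

lemma character_pairing:
  "(\<Sum>w\<in>carrier W. character d \<rho> (B w) * character d' \<rho>' (B (inv w))) = (\<Sum>i<d. \<Sum>k<d'. coeff_pairing \<rho> \<rho>' i i k k)"
proof -
  have "(\<Sum>w\<in>carrier W. character d \<rho> (B w) * character d' \<rho>' (B (inv w)))
    = (\<Sum>w\<in>carrier W. \<Sum>i<d. \<Sum>k<d'. \<rho> (B w) $$ (i, i) * \<rho>' (B (inv w)) $$ (k, k))"
    unfolding character_def by (simp add: sum_product)
  also have "\<dots> = (\<Sum>i<d. \<Sum>w\<in>carrier W. \<Sum>k<d'. \<rho> (B w) $$ (i, i) * \<rho>' (B (inv w)) $$ (k, k))"
    by (rule sum.swap)
  also have "\<dots> = (\<Sum>i<d. \<Sum>k<d'. coeff_pairing \<rho> \<rho>' i i k k)"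
    unfolding coeff_pairing_def by (intro sum.cong HOL.refl sum.swap)
  finally show ?thesis .
qed

text \<open>Conjugate matrices have the same trace.\<close>

lemma character_iso:
  assumes r: "rep d \<rho>" "rep d \<rho>'" and iso: "hecke_rep_iso W S d \<rho> \<rho>'" and x: "x \<in> carrier H"
  shows "character d \<rho> x = character d \<rho>' x"
proof -
  obtain P where P: "P \<in> carrier_mat d d" "invertible_mat P" "P * \<rho> x = \<rho>' x * P"
    using iso x unfolding hecke_rep_iso_def by blast
  obtain Q where Qd: "Q \<in> carrier_mat d d" and PQ: "P * Q = 1\<^sub>m d" "Q * P = 1\<^sub>m d"
    using invertible_mat_inverse[OF P(1,2)] .
  note rx = repD(1)[OF r(1) x] repD(1)[OF r(2) x]
  have "\<rho> x = Q * (P * \<rho> x)" using PQ Qd P(1) rx by (simp flip: assoc_mult_mat)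
  then have e: "\<rho> x = Q * (\<rho>' x * P)" using P(3) by simp
  have rP: "\<rho>' x * P \<in> carrier_mat d d" using rx P(1) by simp
  have e': "(\<rho>' x * P) * Q = \<rho>' x" using PQ Qd P(1) rx by simp
  have "character d \<rho> x = (\<Sum>i<d. \<Sum>j<d. Q $$ (i, j) * (\<rho>' x * P) $$ (j, i))"
    unfolding character_def by (subst e) (intro sum.cong HOL.refl mult_mat_index[OF Qd rP], auto)
  also have "\<dots> = (\<Sum>j<d. \<Sum>i<d. (\<rho>' x * P) $$ (j, i) * Q $$ (i, j))"
    by (subst sum.swap) (simp add: mult.commute)
  also have "\<dots> = (\<Sum>j<d. ((\<rho>' x * P) * Q) $$ (j, j))"
    by (intro sum.cong HOL.refl mult_mat_index[OF rP Qd, symmetric]) auto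
  finally show ?thesis unfolding e' character_def .
qed

lemma hecke_rep_iso_refl: "rep d \<rho> \<Longrightarrow> hecke_rep_iso W S d \<rho> \<rho>"
  unfolding hecke_rep_iso_def
  by (intro bexI[of _ "1\<^sub>m d"])
    (auto simp: invertible_mat_def inverts_mat_def intro!: exI[of _ "1\<^sub>m d"] dest: repD(1))

lemma hecke_rep_iso_sym:
  assumes r: "rep d \<rho>" "rep d \<rho>'" and iso: "hecke_rep_iso W S d \<rho> \<rho>'"
  shows "hecke_rep_iso W S d \<rho>' \<rho>"
proof -
  obtain P where P: "P \<in> carrier_mat d d" "invertible_mat P" "\<And>x. x \<in> carrier H \<Longrightarrow> P * \<rho> x = \<rho>' x * P"
    using iso unfolding hecke_rep_iso_def by blast
  obtain Q where Qd: "Q \<in> carrier_mat d d" and PQ: "P * Q = 1\<^sub>m d" "Q * P = 1\<^sub>m d"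
    using invertible_mat_inverse[OF P(1,2)] .
  have "Q * \<rho>' x = \<rho> x * Q" if x: "x \<in> carrier H" for x
  proof -
    note rx = repD(1)[OF r(1) x] repD(1)[OF r(2) x]
    have "Q * \<rho>' x = Q * ((\<rho>' x * P) * Q)" using PQ Qd P(1) rx by simp
    also have "\<dots> = Q * ((P * \<rho> x) * Q)" using P(3)[OF x] by simp
    also have "\<dots> = (Q * P) * \<rho> x * Q" using Qd P(1) rx by (simp add: assoc_mult_mat[of _ d d _ d _ d])
    finally show ?thesis using PQ rx by simp
  qed
  then show ?thesis unfolding hecke_rep_iso_def
    using Qd P(1) PQ by (intro bexI[of _ Q]) (auto simp: invertible_mat_def inverts_mat_def)
qed

lemma hecke_rep_iso_trans:
  assumes r: "rep d \<rho>" "rep d \<rho>'" "rep d \<rho>''"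
    and iso: "hecke_rep_iso W S d \<rho> \<rho>'" "hecke_rep_iso W S d \<rho>' \<rho>''"
  shows "hecke_rep_iso W S d \<rho> \<rho>''"
proof -
  obtain P where P: "P \<in> carrier_mat d d" "invertible_mat P" "\<And>x. x \<in> carrier H \<Longrightarrow> P * \<rho> x = \<rho>' x * P"
    using iso unfolding hecke_rep_iso_def by blast
  obtain R where R: "R \<in> carrier_mat d d" "invertible_mat R" "\<And>x. x \<in> carrier H \<Longrightarrow> R * \<rho>' x = \<rho>'' x * R"
    using iso unfolding hecke_rep_iso_def by blast
  have "det (R * P) \<noteq> 0"
    using invertible_mat_det[OF P(1,2)] invertible_mat_det[OF R(1,2)] P(1) R(1) by (simp add: det_mult)
  then have "invertible_mat (R * P)" using P(1) R(1) by (intro det_nonzero_invertible) auto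
  moreover have "(R * P) * \<rho> x = \<rho>'' x * (R * P)" if x: "x \<in> carrier H" for x
  proof -
    note rx = repD(1)[OF r(1) x] repD(1)[OF r(2) x] repD(1)[OF r(3) x]
    have "(R * P) * \<rho> x = R * (P * \<rho> x)" using P(1) R(1) rx by simp
    also have "\<dots> = (R * \<rho>' x) * P" using P(1) R(1) rx P(3)[OF x] by simp
    also have "\<dots> = \<rho>'' x * (R * P)" using P(1) R(1) rx R(3)[OF x] by simp
    finally show ?thesis .
  qed
  ultimately show ?thesis unfolding hecke_rep_iso_def using P(1) R(1) by (intro bexI[of _ "R * P"]) auto
qed

abbreviation "iso_rel \<equiv> {(\<rho>, \<rho>'). \<exists>d. irrep d \<rho> \<and> irrep d \<rho>' \<and> hecke_rep_iso W S d \<rho> \<rho>'}"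

lemma iso_rel_equiv: "equiv (irreps W S \<theta>) iso_rel"
proof (rule equivI)
  show "iso_rel \<subseteq> irreps W S \<theta> \<times> irreps W S \<theta>" by (auto simp: irreps_def)
  show "refl_on (irreps W S \<theta>) iso_rel"
    unfolding refl_on_def irreps_def using hecke_rep_iso_refl irrepD(1) by blast
  show "sym iso_rel"
    unfolding sym_def using hecke_rep_iso_sym irrepD(1) by blast
  show "trans iso_rel"
  proof (rule transI)
    fix \<rho> \<rho>' \<rho>'' assume "(\<rho>, \<rho>') \<in> iso_rel" "(\<rho>', \<rho>'') \<in> iso_rel"
    then obtain d d' where d: "irrep d \<rho>" "irrep d \<rho>'" "irrep d' \<rho>'" "irrep d' \<rho>''"
      "hecke_rep_iso W S d \<rho> \<rho>'" "hecke_rep_iso W S d' \<rho>' \<rho>''" by blast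
    then have "d = d'" using irrep_dim_unique irrepD(1) by blast
    then show "(\<rho>, \<rho>'') \<in> iso_rel" using d hecke_rep_iso_trans irrepD(1) by blast
  qed
qed

abbreviation "hclasses \<equiv> irrep_classes W S \<theta>"
definition "chosen \<Lambda> = (SOME \<rho>. \<rho> \<in> (\<Lambda> :: ('w hecke \<Rightarrow> 'k mat) set))"
abbreviation "cdim \<equiv> irrep_dim W S"

lemma chosen_in: assumes "\<Lambda> \<in> hclasses" shows "chosen \<Lambda> \<in> \<Lambda>"
proof -
  have "\<Lambda> \<noteq> {}"
    using in_quotient_imp_non_empty[OF iso_rel_equiv] assms unfolding irrep_classes_def .
  then have "\<exists>\<rho>. \<rho> \<in> \<Lambda>" by blast
  then show ?thesis unfolding chosen_def by (rule someI_ex)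
qed

lemma class_member:
  assumes "\<Lambda> \<in> hclasses" "\<rho> \<in> \<Lambda>" shows "irrep (cdim \<Lambda>) \<rho>" "hecke_rep_iso W S (cdim \<Lambda>) \<rho> (chosen \<Lambda>)"
proof -
  have "(\<rho>, chosen \<Lambda>) \<in> iso_rel"
    using in_quotient_imp_in_rel[OF iso_rel_equiv, of \<Lambda> \<rho> "chosen \<Lambda>"] assms chosen_in[OF assms(1)]
    by (simp add: irrep_classes_def)
  then obtain d where d: "irrep d \<rho>" "irrep d (chosen \<Lambda>)" "hecke_rep_iso W S d \<rho> (chosen \<Lambda>)" by blast
  have "cdim \<Lambda> = d" unfolding irrep_dim_def using repD(2)[OF irrepD(1)[OF d(2)]] by (simp add: chosen_def)
  then show "irrep (cdim \<Lambda>) \<rho>" "hecke_rep_iso W S (cdim \<Lambda>) \<rho> (chosen \<Lambda>)" using d by simp_all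
qed

lemma chosen_irrep: "\<Lambda> \<in> hclasses \<Longrightarrow> irrep (cdim \<Lambda>) (chosen \<Lambda>)"
  using class_member(1) chosen_in by blast

lemma class_exists:
  assumes "irrep d \<rho>" shows "\<exists>\<Lambda>\<in>hclasses. \<rho> \<in> \<Lambda>"
proof -
  have r: "\<rho> \<in> irreps W S \<theta>" using assms unfolding irreps_def by blast
  show ?thesis unfolding irrep_classes_def
    by (rule bexI, rule equiv_class_self[OF iso_rel_equiv r], rule quotientI[OF r])
qed

lemma iso_same_class:
  assumes "\<Lambda> \<in> hclasses" "M \<in> hclasses" "\<rho> \<in> \<Lambda>" "\<rho>' \<in> M" "irrep d \<rho>" "irrep d \<rho>'" "hecke_rep_iso W S d \<rho> \<rho>'"
  shows "\<Lambda> = M"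
  using quotient_eq_iff[OF iso_rel_equiv, of \<Lambda> M \<rho> \<rho>'] assms unfolding irrep_classes_def by blast

lemma irrep_char_eq:
  assumes "\<Lambda> \<in> hclasses" "x \<in> carrier H" shows "irrep_char \<Lambda> x = character (cdim \<Lambda>) (chosen \<Lambda>) x"
proof -
  have "chosen \<Lambda> x \<in> carrier_mat (cdim \<Lambda>) (cdim \<Lambda>)" using repD(1) chosen_irrep irrepD(1) assms by blast
  then show ?thesis unfolding irrep_char_def character_def chosen_def[symmetric] diag_mat_def
    by (simp add: interv_sum_list_conv_sum_set_nat lessThan_atLeast0)
qed

lemma coeff_pairing_classes:
  assumes "\<Lambda> \<in> hclasses" "M \<in> hclasses" "i < cdim \<Lambda>" "j < cdim \<Lambda>" "k < cdim M" "l < cdim M"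
  shows "coeff_pairing (chosen \<Lambda>) (chosen M) i j k l =
    (if \<Lambda> = M \<and> i = l \<and> j = k then pairing_const (chosen \<Lambda>) else 0)"
proof (cases "\<Lambda> = M")
  case True
  then show ?thesis using coeff_pairing_self[OF chosen_irrep[OF assms(1)]] assms by simp
next
  case False
  have "\<not> (cdim \<Lambda> = cdim M \<and> hecke_rep_iso W S (cdim \<Lambda>) (chosen M) (chosen \<Lambda>))"
    using iso_same_class[OF assms(2,1) chosen_in[OF assms(2)] chosen_in[OF assms(1)]]
     chosen_irrep assms(1,2) False by metis
  from coeff_pairing_not_iso[OF chosen_irrep[OF assms(1)] chosen_irrep[OF assms(2)] this assms(3-6)] False
  show ?thesis by simp
qed

lemma irrep_char_pairing:
  assumes "\<Lambda> \<in> hclasses" "M \<in> hclasses"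
  shows "(\<Sum>w\<in>carrier W. irrep_char \<Lambda> (B w) * irrep_char M (B (inv w))) =
    (if \<Lambda> = M then pairing_const (chosen M) * of_nat (cdim M) else 0)"
proof -
  have "(\<Sum>w\<in>carrier W. irrep_char \<Lambda> (B w) * irrep_char M (B (inv w))) =
    (\<Sum>i<cdim \<Lambda>. \<Sum>k<cdim M. coeff_pairing (chosen \<Lambda>) (chosen M) i i k k)"
    using assms by (simp add: irrep_char_eq character_pairing)
  also have "\<dots> = (\<Sum>i<cdim \<Lambda>. \<Sum>k<cdim M.
      if k = i then (if \<Lambda> = M then pairing_const (chosen \<Lambda>) else 0) else 0)"
    using assms by (intro sum.cong HOL.refl) (auto simp: coeff_pairing_classes)
  finally show ?thesis by auto
qed

lemma cdim_nonzero: assumes "\<Lambda> \<in> hclasses" shows "of_nat (cdim \<Lambda>) \<noteq> (0::'k)"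
  using irrepD(2)[OF chosen_irrep[OF assms]] injD[OF field_char_0, of "cdim \<Lambda>" 0] by auto

end

section \<open>Composition series\<close>

context hecke_field
begin

lemma rep_conjugate:
  assumes r: "rep d \<rho>" and P: "P \<in> carrier_mat d d" "Q \<in> carrier_mat d d" "P * Q = 1\<^sub>m d" "Q * P = 1\<^sub>m d"
  shows "rep d (\<lambda>x. Q * \<rho> x * P)" "x \<in> carrier H \<Longrightarrow> character d (\<lambda>x. Q * \<rho> x * P) x = character d \<rho> x"
proof -
  note c = repD(1)[OF r]
  have mult: "Q * \<rho> (x \<star> y) * P = (Q * \<rho> x * P) * (Q * \<rho> y * P)"
    if xy: "x \<in> carrier H" "y \<in> carrier H" for x y
  proof -
    have "(Q * \<rho> x * P) * (Q * \<rho> y * P) = Q * \<rho> x * (P * Q) * (\<rho> y * P)"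
      using P(1,2) c[OF xy(1)] c[OF xy(2)] by (simp add: assoc_mult_mat[of _ d d _ d _ d])
    also have "\<dots> = Q * (\<rho> x * \<rho> y) * P"
      using P c[OF xy(1)] c[OF xy(2)] by (simp add: assoc_mult_mat[of _ d d _ d _ d])
    finally show ?thesis using repD(4)[OF r xy] by simp
  qed
  have add: "Q * \<rho> (x \<oplus>\<^bsub>H\<^esub> y) * P = (Q * \<rho> x * P) + (Q * \<rho> y * P)"
    if xy: "x \<in> carrier H" "y \<in> carrier H" for x y
    using P(1,2) c[OF xy(1)] c[OF xy(2)] repD(3)[OF r xy]
    by (simp add: mult_add_distrib_mat[of _ d d _ d] add_mult_distrib_mat[of _ d d _ _ d])
  have sc: "Q * \<rho> (sc a) * P = \<theta> a \<cdot>\<^sub>m 1\<^sub>m d" for a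
    using P repD(5)[OF r]
    by (simp add: mult_smult_distrib[of _ d d _ d] mult_smult_assoc_mat[of _ d d _ d])
  show rep: "rep d (\<lambda>x. Q * \<rho> x * P)"
    unfolding hecke_rep_def using P c mult add sc repD(2)[OF r] by (simp add: mult_carrier_mat[of _ d d _ d])
  assume x: "x \<in> carrier H"
  have "hecke_rep_iso W S d (\<lambda>x. Q * \<rho> x * P) \<rho>"
    unfolding hecke_rep_iso_def
  proof (intro bexI[of _ P] conjI ballI)
    show "invertible_mat P" using P unfolding invertible_mat_def inverts_mat_def by auto
  next
    fix y assume y: "y \<in> carrier H"
    have "P * (Q * \<rho> y * P) = (P * Q) * \<rho> y * P" using P(1,2) c[OF y] by (simp add: assoc_mult_mat[of _ d d _ d _ d])
    then show "P * (Q * \<rho> y * P) = \<rho> y * P" using P c[OF y] by simp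
  qed (rule P(1))
  from character_iso[OF rep r this x] show "character d (\<lambda>x. Q * \<rho> x * P) x = character d \<rho> x" .
qed

text \<open>The block of indices in \<open>K\<close> of a representation by matrices is again a representation if paths leaving and
  reentering \<open>K\<close> do not contribute to products. This covers both a subrepresentation and a quotient by one.\<close>

lemma rep_compress:
  assumes r: "rep d \<rho>" and K: "K \<subseteq> {..<d}"
    and closed: "\<And>x y i j. x \<in> carrier H \<Longrightarrow> y \<in> carrier H \<Longrightarrow> i \<in> K \<Longrightarrow> j \<in> K \<Longrightarrow>
      (\<Sum>k<d. \<rho> x $$ (i, k) * \<rho> y $$ (k, j)) = (\<Sum>k\<in>K. \<rho> x $$ (i, k) * \<rho> y $$ (k, j))"
  shows "\<exists>\<rho>'. rep (card K) \<rho>' \<and> (\<forall>x\<in>carrier H. character (card K) \<rho>' x = (\<Sum>i\<in>K. \<rho> x $$ (i, i)))"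
proof -
  have "finite K" using K finite_subset by blast
  then obtain e where e: "bij_betw e {..<card K} K" using ex_bij_betw_nat_finite lessThan_atLeast0 by metis
  have eK: "e a \<in> K" "e a < d" if "a < card K" for a using e that K unfolding bij_betw_def by auto
  have einj: "e a = e b \<longleftrightarrow> a = b" if "a < card K" "b < card K" for a b
    using e that unfolding bij_betw_def inj_on_def by auto
  define \<rho>' where "\<rho>' x = mat (card K) (card K) (\<lambda>(a, b). \<rho> x $$ (e a, e b))" for x
  have c: "\<rho>' x \<in> carrier_mat (card K) (card K)" for x by (simp add: \<rho>'_def)
  have "rep (card K) \<rho>'"
    unfolding hecke_rep_def
  proof (intro conjI ballI allI)
    show "\<rho>' \<one>\<^bsub>H\<^esub> = 1\<^sub>m (card K)"
      unfolding \<rho>'_def repD(2)[OF r] by (rule eq_matI) (use eK einj in auto)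
  next
    fix a show "\<rho>' (sc a) = \<theta> a \<cdot>\<^sub>m 1\<^sub>m (card K)"
      unfolding \<rho>'_def repD(5)[OF r] by (rule eq_matI) (use eK einj in auto)
  next
    fix x y assume xy: "x \<in> carrier H" "y \<in> carrier H"
    show "\<rho>' (x \<oplus>\<^bsub>H\<^esub> y) = \<rho>' x + \<rho>' y"
      unfolding \<rho>'_def by (rule eq_matI) (use eK rep_entry_add[OF r _ _ xy] in auto)
    show "\<rho>' (x \<star> y) = \<rho>' x * \<rho>' y"
    proof (rule eq_matI)
      fix a b assume "a < dim_row (\<rho>' x * \<rho>' y)" "b < dim_col (\<rho>' x * \<rho>' y)"
      then have ab: "a < card K" "b < card K" by (simp_all add: \<rho>'_def)
      have "\<rho>' (x \<star> y) $$ (a, b) = (\<Sum>k\<in>K. \<rho> x $$ (e a, k) * \<rho> y $$ (k, e b))"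
        using ab eK rep_entry_mult[OF r _ _ xy] closed[OF xy] by (simp add: \<rho>'_def)
      also have "\<dots> = (\<Sum>k<card K. \<rho> x $$ (e a, e k) * \<rho> y $$ (e k, e b))"
        by (rule sum.reindex_bij_betw[OF e, symmetric])
      also have "\<dots> = (\<rho>' x * \<rho>' y) $$ (a, b)"
        using mult_mat_index[OF c c ab] ab by (simp add: \<rho>'_def)
      finally show "\<rho>' (x \<star> y) $$ (a, b) = (\<rho>' x * \<rho>' y) $$ (a, b)" .
    qed (simp_all add: \<rho>'_def)
  qed (rule c)
  moreover have "character (card K) \<rho>' x = (\<Sum>i\<in>K. \<rho> x $$ (i, i))" for x
    unfolding character_def \<rho>'_def using sum.reindex_bij_betw[OF e, of "\<lambda>i. \<rho> x $$ (i, i)"] by simp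
  ultimately show ?thesis by blast
qed

text \<open>An invariant subspace makes the matrices block triangular in adapted coordinates. The diagonal blocks are
  representations of smaller dimension, and the characters add up.\<close>

lemma composition_series:
  assumes "rep d \<rho>"
  shows "\<exists>L. (\<forall>(d', \<rho>')\<in>set L. irrep d' \<rho>') \<and>
    (\<forall>x\<in>carrier H. character d \<rho> x = (\<Sum>(d', \<rho>')\<leftarrow>L. character d' \<rho>' x))"
  using assms
proof (induction d arbitrary: \<rho> rule: less_induct)
  case (less d)
  show ?case
  proof (cases "d = 0 \<or> irrep d \<rho>")
    case True
    then show ?thesis
    proof
      assume "d = 0"
      then show ?thesis by (intro exI[of _ "[]"]) (simp add: character_def)
    next
      assume "irrep d \<rho>"
      then show ?thesis by (intro exI[of _ "[(d, \<rho>)]"]) simp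
    qed
  next
    case False
    then obtain U where U: "VectorSpace.subspace class_ring U (module_vec TYPE('k) d)"
       "\<And>x u. x \<in> carrier H \<Longrightarrow> u \<in> U \<Longrightarrow> \<rho> x *\<^sub>v u \<in> U" "U \<noteq> {0\<^sub>v d}" "U \<noteq> carrier_vec d"
      using less.prems unfolding hecke_irrep_def neq0_conv[symmetric] by blast
    obtain P Q J where P: "P \<in> carrier_mat d d" "Q \<in> carrier_mat d d" "P * Q = 1\<^sub>m d" "Q * P = 1\<^sub>m d"
      and J: "J \<subset> {..<d}" "J \<noteq> {}"
      and PU: "\<And>j. j \<in> J \<Longrightarrow> col P j \<in> U" and QU: "\<And>u i. u \<in> U \<Longrightarrow> i < d \<Longrightarrow> i \<notin> J \<Longrightarrow> (Q *\<^sub>v u) $ i = 0"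
      using adapted_basis_proper[OF U(1,3,4)] by blast
    define M where "M x = Q * \<rho> x * P" for x
    have M: "rep d M" using rep_conjugate(1)[OF less.prems P] unfolding M_def[abs_def] .
    have chrM: "character d M x = character d \<rho> x" if "x \<in> carrier H" for x
      using rep_conjugate(2)[OF less.prems P that] unfolding M_def[abs_def] .
    have zero: "M x $$ (i, j) = 0" if x: "x \<in> carrier H" and ij: "i < d" "i \<notin> J" "j \<in> J" for x i j
    proof -
      note rx = repD(1)[OF less.prems x]
      have j: "j < d" using ij J by auto
      have rP: "\<rho> x * P \<in> carrier_mat d d" using P(1) rx by simp
      have "M x = Q * (\<rho> x * P)" unfolding M_def by (rule assoc_mult_mat[OF P(2) rx P(1)])
      then have "col (M x) j = Q *\<^sub>v (\<rho> x *\<^sub>v col P j)"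
        using col_mult2[OF P(2) rP j] col_mult2[OF rx P(1) j] by simp
      moreover have "(Q *\<^sub>v (\<rho> x *\<^sub>v col P j)) $ i = 0" using QU[OF U(2)[OF x PU[OF ij(3)]] ij(1,2)] .
      moreover have "col (M x) j $ i = M x $$ (i, j)" using ij j repD(1)[OF M x] by simp
      ultimately show ?thesis by simp
    qed
    let ?K = "{..<d} - J"
    have Jd: "J \<subseteq> {..<d}" using J by blast
    have split: "(\<Sum>k<d. F k) = (\<Sum>k\<in>J. F k) + (\<Sum>k\<in>?K. F k)" for F :: "nat \<Rightarrow> 'k"
      using sum.subset_diff[OF Jd, of F] by (simp add: add.commute)
    have "\<exists>\<rho>'. rep (card J) \<rho>' \<and> (\<forall>x\<in>carrier H. character (card J) \<rho>' x = (\<Sum>i\<in>J. M x $$ (i, i)))"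
      by (rule rep_compress[OF M Jd]) (use zero in \<open>simp add: split\<close>)
    then obtain \<rho>1 where r1: "rep (card J) \<rho>1" "\<And>x. x \<in> carrier H \<Longrightarrow> character (card J) \<rho>1 x = (\<Sum>i\<in>J. M x $$ (i, i))"
      by blast
    have "\<exists>\<rho>'. rep (card ?K) \<rho>' \<and> (\<forall>x\<in>carrier H. character (card ?K) \<rho>' x = (\<Sum>i\<in>?K. M x $$ (i, i)))"
      by (rule rep_compress[OF M]) (use zero in \<open>auto simp: split\<close>)
    then obtain \<rho>2 where r2: "rep (card ?K) \<rho>2" "\<And>x. x \<in> carrier H \<Longrightarrow> character (card ?K) \<rho>2 x = (\<Sum>i\<in>?K. M x $$ (i, i))"
      by blast
    have "card J < d" using psubset_card_mono[OF _ J(1)] by simp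
    then obtain L1 where L1: "\<forall>(d', \<rho>')\<in>set L1. irrep d' \<rho>'"
      "\<forall>x\<in>carrier H. character (card J) \<rho>1 x = (\<Sum>(d', \<rho>')\<leftarrow>L1. character d' \<rho>' x)"
      using less.IH[OF _ r1(1)] by blast
    have "card ?K < d" using psubset_card_mono[of "{..<d}" ?K] J by auto
    then obtain L2 where L2: "\<forall>(d', \<rho>')\<in>set L2. irrep d' \<rho>'"
      "\<forall>x\<in>carrier H. character (card ?K) \<rho>2 x = (\<Sum>(d', \<rho>')\<leftarrow>L2. character d' \<rho>' x)"
      using less.IH[OF _ r2(1)] by blast
    have "character d \<rho> x = (\<Sum>(d', \<rho>')\<leftarrow>L1 @ L2. character d' \<rho>' x)" if x: "x \<in> carrier H" for x
    proof -
      have "character d \<rho> x = (\<Sum>k<d. M x $$ (k, k))" using chrM[OF x] by (simp add: character_def)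
      also have "\<dots> = character (card J) \<rho>1 x + character (card ?K) \<rho>2 x" unfolding split r1(2)[OF x] r2(2)[OF x] by simp
      finally show ?thesis using L1(2) L2(2) x by simp
    qed
    then show ?thesis using L1(1) L2(1) by (intro exI[of _ "L1 @ L2"]) auto
  qed
qed

end

section \<open>Specialisation at \<open>v = 1\<close>\<close>

definition eval_one :: "laurent \<Rightarrow> int" where
  "eval_one p = (\<Sum>k\<in>Poly_Mapping.keys p. Poly_Mapping.lookup p k)"

lemma eval_one_superset:
  assumes "finite K" "Poly_Mapping.keys p \<subseteq> K" shows "eval_one p = (\<Sum>k\<in>K. Poly_Mapping.lookup p k)"
  unfolding eval_one_def using assms by (intro sum.mono_neutral_left) (auto simp: in_keys_iff)

lemma eval_one_single [simp]: "eval_one (Poly_Mapping.single k a) = a"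
  using eval_one_superset[of "{k}" "Poly_Mapping.single k a"] by simp

lemma eval_one_add: "eval_one (p + q) = eval_one p + eval_one q"
proof -
  let ?K = "Poly_Mapping.keys p \<union> Poly_Mapping.keys q"
  have "eval_one (p + q) = (\<Sum>k\<in>?K. Poly_Mapping.lookup (p + q) k)" "eval_one p = (\<Sum>k\<in>?K. Poly_Mapping.lookup p k)"
    "eval_one q = (\<Sum>k\<in>?K. Poly_Mapping.lookup q k)"
    using Poly_Mapping.keys_add[of p q] by (intro eval_one_superset; auto)+
  then show ?thesis by (simp add: lookup_add sum.distrib)
qed

lemma eval_one_sum: "eval_one (sum f A) = (\<Sum>a\<in>A. eval_one (f a))"
proof (induction A rule: infinite_finite_induct)
  case (insert a A)
  then show ?case by (simp add: eval_one_add)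
qed (simp_all add: eval_one_def)

lemma poly_mapping_sum_single: "p = (\<Sum>k\<in>Poly_Mapping.keys p. Poly_Mapping.single k (Poly_Mapping.lookup p k))"
proof (rule poly_mapping_eqI)
  fix k
  have "(\<Sum>i\<in>Poly_Mapping.keys p. Poly_Mapping.lookup (Poly_Mapping.single i (Poly_Mapping.lookup p i)) k) = (\<Sum>i\<in>Poly_Mapping.keys p. if i = k then Poly_Mapping.lookup p k else 0)"
    by (intro sum.cong) (auto simp: lookup_single when_def)
  also have "\<dots> = Poly_Mapping.lookup p k" by (simp add: in_keys_iff)
  finally show "Poly_Mapping.lookup p k = Poly_Mapping.lookup (\<Sum>k\<in>Poly_Mapping.keys p. Poly_Mapping.single k (Poly_Mapping.lookup p k)) k"
    by (simp add: lookup_sum)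
qed

lemma eval_one_mult: "eval_one (p * q) = eval_one p * eval_one q"
proof -
  have "p * q = (\<Sum>k\<in>Poly_Mapping.keys p. \<Sum>l\<in>Poly_Mapping.keys q. Poly_Mapping.single (k + l) (Poly_Mapping.lookup p k * Poly_Mapping.lookup q l))"
    using poly_mapping_sum_single[of p] poly_mapping_sum_single[of q]
    by (metis (no_types, lifting) sum.cong sum_product mult_single)
  then have "eval_one (p * q) = (\<Sum>k\<in>Poly_Mapping.keys p. \<Sum>l\<in>Poly_Mapping.keys q. Poly_Mapping.lookup p k * Poly_Mapping.lookup q l)"
    by (simp add: eval_one_sum)
  then show ?thesis by (simp add: eval_one_def sum_product)
qed

interpretation eval_one: comm_ring_hom eval_one
proof
  show "eval_one 0 = 0" by (simp add: eval_one_def)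
  show "eval_one 1 = 1" using eval_one_single[of 0 1] by simp
qed (simp_all add: eval_one_add eval_one_mult)

lemma eval_one_qpar: "eval_one qpar = 0"
proof -
  have "eval_one (v_pow (-1)) = eval_one (qpar + v_pow 1)" by (simp add: qpar_def)
  then show ?thesis by (simp add: eval_one_add v_pow_def)
qed

context finite_coxeter_group
begin

text \<open>At \<open>v = 1\<close> the parameter \<open>v\<^sup>-\<^sup>1 - v\<close> vanishes and the operators become translations of the group.\<close>

lemma eval_one_left_ops:
  assumes "u \<in> lists S" "w \<in> carrier W"
  shows "eval_one (left_ops u m w) = eval_one (m (inv (word_prod W u) \<otimes> w))"
  using assms(2,1)
proof (induction u arbitrary: w)
  case (Cons s u)
  then have c: "s \<in> S" "s \<in> carrier W" "u \<in> lists S" "word_prod W u \<in> carrier W" "s \<otimes> w \<in> carrier W"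
    using S_carrier by auto
  have "eval_one (left_ops (s # u) m w) = eval_one (left_ops u m (s \<otimes> w))"
    using Cons.prems by (simp add: left_op_def eval_one_add eval_one_mult eval_one_qpar)
  also have "\<dots> = eval_one (m (inv (word_prod W u) \<otimes> (s \<otimes> w)))" using Cons.IH c by blast
  also have "inv (word_prod W u) \<otimes> (s \<otimes> w) = inv (word_prod W (s # u)) \<otimes> w"
    using c Cons.prems by (simp add: inv_mult_group S_inv m_assoc)
  finally show ?case .
qed auto

lemma eval_one_B_mult:
  assumes "u \<in> carrier W" "w \<in> carrier W" "y \<in> carrier H"
  shows "eval_one (coord (B u \<star> y) w) = eval_one (coord y (inv u \<otimes> w))"
proof -
  obtain r where r: "reduced W S r u" using reduced_exists assms(1) by blast
  have "coord (B u \<star> y) = left_ops r (coord y)"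
    using assms r by (simp add: coord_mult B_reduced[OF r] hact_word reducedD(1)[OF r] coord_on_group)
  then show ?thesis using eval_one_left_ops[OF reducedD(1)[OF r] assms(2)] reducedD(2)[OF r] by simp
qed

definition casimir_elt :: "'w hecke" where
  "casimir_elt = (\<Oplus>\<^bsub>H\<^esub>w\<in>carrier W. B w \<star> B (inv w))"

lemma casimir_elt_closed [simp]: "casimir_elt \<in> carrier H"
  unfolding casimir_elt_def by (intro H.finsum_closed) auto

lemma eval_one_casimir:
  assumes "u \<in> carrier W" "w \<in> carrier W"
  shows "eval_one (coord (B u \<star> casimir_elt) w) = (if u = w then int (card (carrier W)) else 0)"
proof -
  have "eval_one (coord (B u \<star> casimir_elt) w) = eval_one (coord casimir_elt (inv u \<otimes> w))"
    by (rule eval_one_B_mult) (use assms in auto)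
  also have "coord casimir_elt (inv u \<otimes> w) = (\<Sum>y\<in>carrier W. coord (B y \<star> B (inv y)) (inv u \<otimes> w))"
    unfolding casimir_elt_def by (rule additive_finsum) (auto simp: finite_W coord_add)
  also have "eval_one \<dots> = (\<Sum>y\<in>carrier W. of_bool (u = w))"
    unfolding eval_one_sum
  proof (rule sum.cong[OF HOL.refl])
    fix y assume y: "y \<in> carrier W"
    have "eval_one (coord (B y \<star> B (inv y)) (inv u \<otimes> w)) = eval_one (delta (inv y) (inv y \<otimes> (inv u \<otimes> w)))"
      using eval_one_B_mult[of y "inv u \<otimes> w" "B (inv y)"] y assms by (simp add: coord_B)
    also have "\<dots> = of_bool (inv u \<otimes> w = \<one>)" using y assms by (simp add: delta_def)
    also have "(inv u \<otimes> w = \<one>) = (u = w)"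
      using assms by (metis inv_closed inv_inv l_inv inv_equality r_inv)
    finally show "eval_one (coord (B y \<star> B (inv y)) (inv u \<otimes> w)) = of_bool (u = w)" .
  qed
  finally show ?thesis by simp
qed

lemma coord_inject:
  assumes "x \<in> carrier H" "y \<in> carrier H" "\<And>w. w \<in> carrier W \<Longrightarrow> coord x w = coord y w" shows "x = y"
proof -
  have "coord x w = coord y w" for w
    using assms(3) coord_on_group[of x] coord_on_group[of y] by (cases "w \<in> carrier W") (auto simp: on_group_def)
  then have "coord x = coord y" by (rule ext)
  then show ?thesis using lincomb_coord assms(1,2) by metis
qed

text \<open>The matrix \<open>Z\<close> of right multiplication by the Casimir element is \<open>|W|\<close> times the identity at \<open>v = 1\<close>, so its
  determinant \<open>D\<close> is nonzero. The column of the adjugate that belongs to \<open>1\<close> gives the coordinates of \<open>y\<close>.\<close>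

lemma casimir_elt_invertible:
  "\<exists>D y. D \<noteq> 0 \<and> y \<in> carrier H \<and> y \<star> casimir_elt = sc D"
proof -
  let ?N = "card (carrier W)"
  obtain e where e: "bij_betw e {..<?N} (carrier W)" using ex_bij_betw_nat_finite[OF finite_W] lessThan_atLeast0 by metis
  have eW: "e i \<in> carrier W" if "i < ?N" for i using e that unfolding bij_betw_def by auto
  have einj: "e i = e j \<longleftrightarrow> i = j" if "i < ?N" "j < ?N" for i j using e that unfolding bij_betw_def inj_on_def by auto
  define Z where "Z = mat ?N ?N (\<lambda>(i, j). coord (B (e j) \<star> casimir_elt) (e i))"
  have Z: "Z \<in> carrier_mat ?N ?N" by (simp add: Z_def)
  define D where "D = det Z"
  have "map_mat eval_one Z = of_nat ?N \<cdot>\<^sub>m 1\<^sub>m ?N"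
    by (rule eq_matI) (use einj in \<open>auto simp: Z_def eval_one_casimir eW\<close>)
  then have "eval_one D = (of_nat ?N) ^ ?N" unfolding D_def eval_one.hom_det[symmetric] by (simp add: det_smult)
  moreover have "?N > 0" using finite_W one_closed card_gt_0_iff by blast
  ultimately have D0: "D \<noteq> 0" by (auto simp: eval_one_def)
  obtain j1 where j1: "j1 < ?N" "e j1 = \<one>" using e one_closed unfolding bij_betw_def by (metis imageE lessThan_iff)
  define c where "c w = (if w \<in> carrier W then adj_mat Z $$ (the_inv_into {..<?N} e w, j1) else 0)" for w
  have c: "on_group c" by (simp add: on_group_def c_def)
  have ce: "c (e j) = adj_mat Z $$ (j, j1)" if "j < ?N" for j
    using that eW e the_inv_into_f_f[of e "{..<?N}" j] by (simp add: c_def bij_betw_def)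
  let ?y = "lincomb c"
  have "?y \<star> casimir_elt = sc D"
  proof (rule coord_inject)
    fix w assume "w \<in> carrier W"
    then obtain i where i: "i < ?N" "w = e i" using e unfolding bij_betw_def by blast
    have "coord (?y \<star> casimir_elt) w = (\<Sum>u\<in>carrier W. coord ?y u * coord (B u \<star> casimir_elt) w)"
      by (rule semilinear_expand[where \<theta> = "\<lambda>r. r"]) (auto simp: H.l_distr coord_add H.m_assoc coord_sc)
    also have "\<dots> = (\<Sum>j<?N. coord ?y (e j) * coord (B (e j) \<star> casimir_elt) w)"
      by (rule sum.reindex_bij_betw[OF e, symmetric])
    also have "\<dots> = (\<Sum>j<?N. Z $$ (i, j) * adj_mat Z $$ (j, j1))"
      using i by (intro sum.cong HOL.refl) (simp add: coord_lincomb[OF c] ce Z_def mult.commute)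
    also have "\<dots> = (Z * adj_mat Z) $$ (i, j1)"
      using mult_mat_index[OF Z adj_mat(1)[OF Z] i(1) j1(1)] by simp
    also have "\<dots> = (if i = j1 then D else 0)" unfolding adj_mat(2)[OF Z] using i j1 by (simp add: D_def)
    also have "\<dots> = coord (sc D) w"
      using coord_sc[of "B \<one>" D w] coord_B[OF one_closed] B_one einj[OF i(1) j1(1)] i j1 by (auto simp: delta_def)
    finally show "coord (?y \<star> casimir_elt) w = coord (sc D) w" .
  qed auto
  then show ?thesis using D0 by (intro exI[of _ D] exI[of _ ?y]) simp
qed

end

section \<open>Schur elements\<close>

context hecke_field
begin

text \<open>The trace of left multiplication by \<open>x\<close> is \<open>\<Sum>\<^sub>w tr (x h\<^sub>w h\<^sub>w\<^sub>')\<close>, by duality of the bases.\<close>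

lemma regular_rep:
  "\<exists>d \<rho>. rep d \<rho> \<and> (\<forall>x\<in>carrier H. character d \<rho> x = \<theta> (tr (x \<star> casimir_elt)))"
proof -
  let ?N = "card (carrier W)"
  obtain e where e: "bij_betw e {..<?N} (carrier W)" using ex_bij_betw_nat_finite[OF finite_W] lessThan_atLeast0 by metis
  have eW [simp]: "e i \<in> carrier W" if "i < ?N" for i using e that unfolding bij_betw_def by auto
  have einj: "e i = e j \<longleftrightarrow> i = j" if "i < ?N" "j < ?N" for i j using e that unfolding bij_betw_def inj_on_def by auto
  define \<rho> where "\<rho> x = mat ?N ?N (\<lambda>(i, j). \<theta> (coord (x \<star> B (e j)) (e i)))" for x
  have c: "\<rho> x \<in> carrier_mat ?N ?N" for x by (simp add: \<rho>_def)
  have "rep ?N \<rho>"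
    unfolding hecke_rep_def
  proof (intro conjI ballI allI)
    show "\<rho> \<one>\<^bsub>H\<^esub> = 1\<^sub>m ?N"
      unfolding \<rho>_def by (rule eq_matI) (auto simp: coord_B delta_def einj)
  next
    fix a show "\<rho> (sc a) = \<theta> a \<cdot>\<^sub>m 1\<^sub>m ?N"
      unfolding \<rho>_def by (rule eq_matI) (auto simp: coord_sc coord_B delta_def einj)
  next
    fix x y assume xy: "x \<in> carrier H" "y \<in> carrier H"
    show "\<rho> (x \<oplus>\<^bsub>H\<^esub> y) = \<rho> x + \<rho> y"
      unfolding \<rho>_def by (rule eq_matI) (auto simp: H.l_distr xy coord_add \<theta>.hom_add)
    show "\<rho> (x \<star> y) = \<rho> x * \<rho> y"
    proof (rule eq_matI)
      fix i j assume "i < dim_row (\<rho> x * \<rho> y)" "j < dim_col (\<rho> x * \<rho> y)"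
      then have ij: "i < ?N" "j < ?N" by (simp_all add: \<rho>_def)
      have "coord (x \<star> (y \<star> B (e j))) (e i)
        = (\<Sum>w\<in>carrier W. coord (y \<star> B (e j)) w * coord (x \<star> B w) (e i))"
        by (rule semilinear_expand[where \<theta> = "\<lambda>r. r"]) (auto simp: H.r_distr coord_add sc_left_commute coord_sc xy ij)
      also have "\<dots> = (\<Sum>k<?N. coord (y \<star> B (e j)) (e k) * coord (x \<star> B (e k)) (e i))"
        by (rule sum.reindex_bij_betw[OF e, symmetric])
      finally have "\<theta> (coord (x \<star> (y \<star> B (e j))) (e i))
        = (\<Sum>k<?N. \<theta> (coord (x \<star> B (e k)) (e i)) * \<theta> (coord (y \<star> B (e j)) (e k)))"
        by (simp add: \<theta>.hom_sum \<theta>.hom_mult mult.commute)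
      then show "\<rho> (x \<star> y) $$ (i, j) = (\<rho> x * \<rho> y) $$ (i, j)"
        using mult_mat_index[OF c c ij] ij xy by (simp add: \<rho>_def H.m_assoc)
    qed (simp_all add: \<rho>_def)
  qed (rule c)
  moreover have "character ?N \<rho> x = \<theta> (tr (x \<star> casimir_elt))" if x: "x \<in> carrier H" for x
  proof -
    have "x \<star> casimir_elt = (\<Oplus>\<^bsub>H\<^esub>w\<in>carrier W. x \<star> (B w \<star> B (inv w)))"
      unfolding casimir_elt_def using x finite_W by (intro H.finsum_rdistr) auto
    then have "tr (x \<star> casimir_elt) = (\<Sum>w\<in>carrier W. tr (x \<star> (B w \<star> B (inv w))))"
      using x by (simp only:) (rule additive_finsum, auto simp: finite_W tr_add)
    also have "\<dots> = (\<Sum>w\<in>carrier W. coord (x \<star> B w) w)"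
      using x by (intro sum.cong HOL.refl) (simp add: tr_mult_B_inv flip: H.m_assoc)
    also have "\<dots> = (\<Sum>i<?N. coord (x \<star> B (e i)) (e i))"
      by (rule sum.reindex_bij_betw[OF e, symmetric])
    finally show ?thesis by (simp add: character_def \<rho>_def \<theta>.hom_sum)
  qed
  ultimately show ?thesis by blast
qed

text \<open>Contract the inner indices in the orthogonality relations.\<close>

lemma rep_casimir_elt:
  assumes "irrep d \<rho>" shows "\<rho> casimir_elt = (of_nat d * pairing_const \<rho>) \<cdot>\<^sub>m 1\<^sub>m d"
proof (rule eq_matI)
  note r = irrepD(1)[OF assms]
  fix i l assume "i < dim_row ((of_nat d * pairing_const \<rho>) \<cdot>\<^sub>m 1\<^sub>m d)" "l < dim_col ((of_nat d * pairing_const \<rho>) \<cdot>\<^sub>m 1\<^sub>m d)"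
  then have il: "i < d" "l < d" by auto
  have "\<rho> casimir_elt $$ (i, l) = (\<Sum>w\<in>carrier W. \<rho> (B w \<star> B (inv w)) $$ (i, l))"
    unfolding casimir_elt_def
    by (rule additive_finsum[where \<phi> = "\<lambda>x. \<rho> x $$ (i, l)"]) (auto simp: finite_W rep_entry_add[OF r il])
  also have "\<dots> = (\<Sum>w\<in>carrier W. \<Sum>j<d. \<rho> (B w) $$ (i, j) * \<rho> (B (inv w)) $$ (j, l))"
    by (intro sum.cong HOL.refl rep_entry_mult[OF r il]) auto
  also have "\<dots> = (\<Sum>j<d. coeff_pairing \<rho> \<rho> i j j l)"
    unfolding coeff_pairing_def by (rule sum.swap)
  also have "\<dots> = (\<Sum>j<d. if i = l then pairing_const \<rho> else 0)"
    using il by (intro sum.cong HOL.refl) (simp add: coeff_pairing_self[OF assms])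
  finally show "\<rho> casimir_elt $$ (i, l) = ((of_nat d * pairing_const \<rho>) \<cdot>\<^sub>m 1\<^sub>m d) $$ (i, l)"
    using il by simp
qed (use repD(1)[OF irrepD(1)[OF assms] casimir_elt_closed] in auto)

text \<open>Apply the character of the regular representation to \<open>x y\<close>, where \<open>y z = D\<close> for the Casimir element \<open>z\<close>. On the one
  hand this is \<open>tr (x y z) = D tr x\<close>; on the other hand it is a sum of irreducible characters, on which \<open>y\<close>
  acts by \<open>D\<close> divided by the scalar of \<open>z\<close>.\<close>

lemma trace_list:
  "\<exists>L. (\<forall>(d, \<rho>)\<in>set L. irrep d \<rho>) \<and>
    (\<forall>x\<in>carrier H. \<theta> (tr x) = (\<Sum>(d, \<rho>)\<leftarrow>L. character d \<rho> x / (of_nat d * pairing_const \<rho>)))"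
proof -
  obtain d \<rho> where reg: "rep d \<rho>" "\<And>x. x \<in> carrier H \<Longrightarrow> character d \<rho> x = \<theta> (tr (x \<star> casimir_elt))"
    using regular_rep by blast
  obtain L where L: "\<forall>(d, \<rho>)\<in>set L. irrep d \<rho>"
    "\<forall>x\<in>carrier H. character d \<rho> x = (\<Sum>(d, \<rho>)\<leftarrow>L. character d \<rho> x)" using composition_series[OF reg(1)] by blast
  obtain D y where D: "D \<noteq> 0" "y \<in> carrier H" "y \<star> casimir_elt = sc D" using casimir_elt_invertible by blast
  have tD: "\<theta> D \<noteq> 0" using D(1) by simp
  have y: "character d \<rho> (x \<star> y) = \<theta> D * (character d \<rho> x / (of_nat d * pairing_const \<rho>))"
    if irr: "irrep d \<rho>" and x: "x \<in> carrier H" for d \<rho> x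
  proof -
    let ?\<omega> = "of_nat d * pairing_const \<rho>"
    note r = irrepD(1)[OF irr] and d = irrepD(2)[OF irr]
    have c: "\<rho> x \<in> carrier_mat d d" "\<rho> y \<in> carrier_mat d d" using repD(1)[OF r] x D by auto
    have "\<rho> y * \<rho> casimir_elt = \<theta> D \<cdot>\<^sub>m 1\<^sub>m d"
      using repD(4)[OF r D(2) casimir_elt_closed] repD(5)[OF r] D(3) by simp
    then have "?\<omega> \<cdot>\<^sub>m \<rho> y = \<theta> D \<cdot>\<^sub>m 1\<^sub>m d"
      unfolding rep_casimir_elt[OF irr] using c by (simp add: mult_smult_distrib[of _ d d _ d])
    then have e: "?\<omega> * \<rho> y $$ (i, j) = (if i = j then \<theta> D else 0)" if "i < d" "j < d" for i j
      using that c by (metis (no_types, lifting) index_smult_mat(1) index_one_mat(1) carrier_matD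
        index_one_mat(2,3) mult.right_neutral mult_zero_right)
    \<comment> \<open>The scalar of z divides D in the field, so it is not zero.\<close>
    have \<omega>: "?\<omega> \<noteq> 0" using e[OF d d] tD by auto
    have e': "\<rho> y $$ (i, j) = (if i = j then \<theta> D / ?\<omega> else 0)" if "i < d" "j < d" for i j
      using e[OF that] \<omega> by (auto simp: field_simps)
    have "\<rho> (x \<star> y) $$ (i, i) = \<rho> x $$ (i, i) * (\<theta> D / ?\<omega>)" if i: "i < d" for i
    proof -
      have "\<rho> (x \<star> y) $$ (i, i) = (\<Sum>l<d. \<rho> x $$ (i, l) * \<rho> y $$ (l, i))"
        by (rule rep_entry_mult[OF r i i x D(2)])
      also have "\<dots> = (\<Sum>l<d. if l = i then \<rho> x $$ (i, i) * (\<theta> D / ?\<omega>) else 0)"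
        using i by (intro sum.cong HOL.refl) (simp add: e')
      finally show ?thesis using i by simp
    qed
    then show ?thesis by (simp add: character_def sum_distrib_left sum_divide_distrib mult_ac)
  qed
  have "\<theta> (tr x) = (\<Sum>(d, \<rho>)\<leftarrow>L. character d \<rho> x / (of_nat d * pairing_const \<rho>))" if x: "x \<in> carrier H" for x
  proof -
    have "sc D \<star> x = (x \<star> y) \<star> casimir_elt"
      using x D by (simp add: H.m_assoc sc_commute)
    then have "\<theta> D * \<theta> (tr x) = character d \<rho> (x \<star> y)"
      using reg(2)[of "x \<star> y"] x D tr_sc[OF x, of D] by (simp add: \<theta>.hom_mult)
    also have "\<dots> = (\<Sum>(d, \<rho>)\<leftarrow>L. character d \<rho> (x \<star> y))" using L(2) x D by simp
    also have "\<dots> = (\<Sum>p\<leftarrow>L. \<theta> D * (case p of (d, \<rho>) \<Rightarrow> character d \<rho> x / (of_nat d * pairing_const \<rho>)))"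
      by (rule arg_cong[of _ _ sum_list], rule map_cong[OF HOL.refl]) (use L(1) y x in auto)
    also have "\<dots> = \<theta> D * (\<Sum>(d, \<rho>)\<leftarrow>L. character d \<rho> x / (of_nat d * pairing_const \<rho>))"
      by (simp add: sum_list_const_mult)
    finally show ?thesis using tD by simp
  qed
  then show ?thesis using L(1) by blast
qed

lemma tr_pairing:
  assumes "rep d \<rho>" shows "(\<Sum>w\<in>carrier W. \<theta> (tr (B w)) * character d \<rho> (B (inv w))) = of_nat d"
proof -
  have "(\<Sum>w\<in>carrier W. \<theta> (tr (B w)) * character d \<rho> (B (inv w))) = (\<Sum>w\<in>carrier W. if w = \<one> then of_nat d else 0)"
    by (intro sum.cong HOL.refl) (auto simp: tr_coord coord_B delta_def B_one character_one[OF assms])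
  then show ?thesis using finite_W by simp
qed

text \<open>The list of the previous lemma is sorted by isomorphism classes, and \<open>t\<close> collects the coefficients of a class.
  Evaluating the trace on the Casimir tensor paired with the character of a class \<open>M\<close> gives \<open>dim M\<close> directly, and
  \<open>t M c\<^sub>M dim M\<close> by orthogonality, where \<open>c\<^sub>M\<close> is the constant in the orthogonality relations. Hence \<open>t M c\<^sub>M = 1\<close>:
  every class occurs in the list, so there are finitely many, and all constants are nonzero.\<close>

lemma trace_characters:
  "finite hclasses \<and> (\<forall>\<Lambda>\<in>hclasses. pairing_const (chosen \<Lambda>) \<noteq> 0) \<and>
    (\<forall>x\<in>carrier H. \<theta> (tr x) = (\<Sum>\<Lambda>\<in>hclasses. 1 / pairing_const (chosen \<Lambda>) * irrep_char \<Lambda> x))"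
proof -
  obtain L where L: "\<forall>(d, \<rho>)\<in>set L. irrep d \<rho>"
    "\<And>x. x \<in> carrier H \<Longrightarrow> \<theta> (tr x) = (\<Sum>(d, \<rho>)\<leftarrow>L. character d \<rho> x / (of_nat d * pairing_const \<rho>))"
    using trace_list by blast
  let ?n = "length L"
  let ?d = "\<lambda>i. fst (L ! i)" and ?\<rho> = "\<lambda>i. snd (L ! i)"
  let ?\<omega> = "\<lambda>i. of_nat (?d i) * pairing_const (?\<rho> i)"
  have irr: "irrep (?d i) (?\<rho> i)" if "i < ?n" for i using L(1) nth_mem[OF that] by (auto simp: split_beta)
  have tr: "\<theta> (tr x) = (\<Sum>i<?n. character (?d i) (?\<rho> i) x / ?\<omega> i)" if "x \<in> carrier H" for x
    unfolding L(2)[OF that] sum_list_sum_nth by (simp add: split_beta lessThan_atLeast0)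
  define cls where "cls i = (SOME \<Lambda>. \<Lambda> \<in> hclasses \<and> ?\<rho> i \<in> \<Lambda>)" for i
  have cls: "cls i \<in> hclasses" "?\<rho> i \<in> cls i" if "i < ?n" for i
    using someI_ex[of "\<lambda>\<Lambda>. \<Lambda> \<in> hclasses \<and> ?\<rho> i \<in> \<Lambda>"] class_exists[OF irr[OF that]] unfolding cls_def by blast+
  have dim: "?d i = cdim (cls i)" if "i < ?n" for i
    using irrep_dim_unique[OF irrepD(1)[OF irr[OF that]] irrepD(1)[OF class_member(1)[OF cls[OF that]]]] .
  have character: "character (?d i) (?\<rho> i) x = irrep_char (cls i) x" if "i < ?n" "x \<in> carrier H" for i x
    using character_iso[OF irrepD(1)[OF class_member(1)[OF cls[OF that(1)]]]
      irrepD(1)[OF chosen_irrep[OF cls(1)[OF that(1)]]] class_member(2)[OF cls[OF that(1)]] that(2)]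
      irrep_char_eq[OF cls(1)[OF that(1)] that(2)] dim[OF that(1)] by simp
  define t where "t \<Lambda> = (\<Sum>i | i < ?n \<and> cls i = \<Lambda>. 1 / ?\<omega> i)" for \<Lambda>
  have key: "t M * pairing_const (chosen M) = 1" if M: "M \<in> hclasses" for M
  proof -
    note rM = irrepD(1)[OF chosen_irrep[OF M]]
    have "of_nat (cdim M) = (\<Sum>w\<in>carrier W. \<theta> (tr (B w)) * irrep_char M (B (inv w)))"
      using tr_pairing[OF rM] M by (simp add: irrep_char_eq)
    also have "\<dots> = (\<Sum>w\<in>carrier W. \<Sum>i<?n. 1 / ?\<omega> i * (irrep_char (cls i) (B w) * irrep_char M (B (inv w))))"
      by (intro sum.cong HOL.refl) (simp add: tr character sum_distrib_right)
    also have "\<dots> = (\<Sum>i<?n. 1 / ?\<omega> i * (\<Sum>w\<in>carrier W. irrep_char (cls i) (B w) * irrep_char M (B (inv w))))"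
      unfolding sum_distrib_left by (rule sum.swap)
    also have "\<dots> = (\<Sum>i<?n. if cls i = M then 1 / ?\<omega> i * (pairing_const (chosen M) * of_nat (cdim M)) else 0)"
      by (intro sum.cong HOL.refl) (simp add: irrep_char_pairing cls M)
    also have "\<dots> = t M * pairing_const (chosen M) * of_nat (cdim M)"
      unfolding t_def by (simp add: sum.If_cases sum_distrib_right mult.assoc Int_def)
    finally have "of_nat (cdim M) = t M * pairing_const (chosen M) * of_nat (cdim M)" .
    then show ?thesis using cdim_nonzero[OF M] by simp
  qed
  have sub: "hclasses \<subseteq> cls ` {..<?n}"
  proof
    fix M assume M: "M \<in> hclasses"
    have "{i. i < ?n \<and> cls i = M} \<noteq> {}" using key[OF M] unfolding t_def by force
    then show "M \<in> cls ` {..<?n}" by blast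
  qed
  then have fin: "finite hclasses" by (rule finite_subset) simp
  have nz: "pairing_const (chosen \<Lambda>) \<noteq> 0" "t \<Lambda> = 1 / pairing_const (chosen \<Lambda>)" if "\<Lambda> \<in> hclasses" for \<Lambda>
  proof -
    show nz: "pairing_const (chosen \<Lambda>) \<noteq> 0" using key[OF that] by auto
    show "t \<Lambda> = 1 / pairing_const (chosen \<Lambda>)" by (rule eq_divide_imp[OF nz key[OF that]])
  qed
  have "\<theta> (tr x) = (\<Sum>\<Lambda>\<in>hclasses. 1 / pairing_const (chosen \<Lambda>) * irrep_char \<Lambda> x)" if x: "x \<in> carrier H" for x
  proof -
    have "\<theta> (tr x) = (\<Sum>i<?n. 1 / ?\<omega> i * irrep_char (cls i) x)" using x by (simp add: tr character)
    also have "\<dots> = (\<Sum>\<Lambda>\<in>hclasses. \<Sum>i | i \<in> {..<?n} \<and> cls i = \<Lambda>. 1 / ?\<omega> i * irrep_char (cls i) x)"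
      by (rule sum.group[symmetric]) (use fin cls in auto)
    also have "\<dots> = (\<Sum>\<Lambda>\<in>hclasses. t \<Lambda> * irrep_char \<Lambda> x)"
      unfolding t_def sum_distrib_right by (intro sum.cong HOL.refl) auto
    finally show ?thesis using nz by simp
  qed
  then show ?thesis using fin nz by blast
qed

abbreviation "schur \<equiv> schur_element W S \<theta>"

text \<open>The same pairing shows that every family of coefficients that expresses the trace is the one just found.\<close>

lemma schur_element_pairing:
  assumes "\<Lambda> \<in> hclasses" shows "schur \<Lambda> = pairing_const (chosen \<Lambda>)"
proof -
  define Q where "Q s \<longleftrightarrow> (\<forall>\<Lambda> \<in> hclasses. s \<Lambda> \<noteq> 0) \<and>
     (\<forall>x\<in>carrier H. \<theta> (tr x) = (\<Sum>\<Lambda> \<in> hclasses. 1 / s \<Lambda> * irrep_char \<Lambda> x))" for s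
  have "Q (\<lambda>\<Lambda>. pairing_const (chosen \<Lambda>))" unfolding Q_def using trace_characters by blast
  then have "Q (SOME s. Q s)" by (rule someI[of Q])
  moreover have "schur = (SOME s. Q s)" unfolding schur_element_def Q_def by (rule HOL.refl)
  ultimately have "Q schur" by (simp only:)
  note P = this[unfolded Q_def]
  note fin = trace_characters[THEN conjunct1]
  note r = irrepD(1)[OF chosen_irrep[OF assms]]
  have "of_nat (cdim \<Lambda>) = (\<Sum>w\<in>carrier W. \<theta> (tr (B w)) * irrep_char \<Lambda> (B (inv w)))"
    using tr_pairing[OF r] assms by (simp add: irrep_char_eq)
  also have "\<dots> = (\<Sum>w\<in>carrier W. \<Sum>M\<in>hclasses. 1 / schur M * (irrep_char M (B w) * irrep_char \<Lambda> (B (inv w))))"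
    using P by (intro sum.cong HOL.refl) (simp add: sum_distrib_right)
  also have "\<dots> = (\<Sum>M\<in>hclasses. 1 / schur M * (\<Sum>w\<in>carrier W. irrep_char M (B w) * irrep_char \<Lambda> (B (inv w))))"
    unfolding sum_distrib_left by (rule sum.swap)
  also have "\<dots> = (\<Sum>M\<in>hclasses. if M = \<Lambda> then 1 / schur \<Lambda> * (pairing_const (chosen \<Lambda>) * of_nat (cdim \<Lambda>)) else 0)"
    using assms by (intro sum.cong HOL.refl) (simp add: irrep_char_pairing)
  also have "\<dots> = 1 / schur \<Lambda> * (pairing_const (chosen \<Lambda>) * of_nat (cdim \<Lambda>))"
    using fin assms by simp
  finally have "schur \<Lambda> * of_nat (cdim \<Lambda>) = pairing_const (chosen \<Lambda>) * of_nat (cdim \<Lambda>)"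
    using P assms by (simp add: field_simps)
  then show ?thesis using cdim_nonzero[OF assms] by simp
qed

lemma finite_classes: "finite hclasses"
  using trace_characters by blast

lemma schur_nonzero: "\<Lambda> \<in> hclasses \<Longrightarrow> schur \<Lambda> \<noteq> 0"
  using trace_characters schur_element_pairing by simp

lemma trace_schur: "x \<in> carrier H \<Longrightarrow> \<theta> (tr x) = (\<Sum>\<Lambda>\<in>hclasses. 1 / schur \<Lambda> * irrep_char \<Lambda> x)"
  using trace_characters schur_element_pairing by simp

lemma schur_orthogonality:
  assumes "\<Lambda> \<in> hclasses" "M \<in> hclasses" "i < cdim \<Lambda>" "j < cdim \<Lambda>" "k < cdim M" "l < cdim M"
  shows "(\<Sum>w\<in>carrier W. chosen \<Lambda> (B w) $$ (i, j) * chosen M (B (inv w)) $$ (k, l)) =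
    (if \<Lambda> = M \<and> i = l \<and> j = k then schur \<Lambda> else 0)"
  using coeff_pairing_classes[OF assms] unfolding schur_element_pairing[OF assms(1)] coeff_pairing_def .

end

section \<open>Triangulations\<close>

locale triangulated =
  fixes \<Sigma> :: surface and T :: "'f triangulation"
  assumes ciliated: "ciliated_surface \<Sigma>" and triangulates: "triangulates T \<Sigma>"
begin

lemma finite_faces: "finite (faces T)" and faces_nonempty: "faces T \<noteq> {}"
  using triangulates by (simp_all add: triangulates_def)

lemma finite_sides: "finite (sides T)"
  using finite_faces by (simp add: sides_def)

lemma glue_sides: "d \<in> sides T \<Longrightarrow> glue T d \<in> sides T"
  and glue_glue: "d \<in> sides T \<Longrightarrow> glue T (glue T d) = d"
  using triangulates by (simp_all add: triangulates_def)

lemma next_side_sides: "d \<in> sides T \<Longrightarrow> next_side d \<in> sides T"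
  by (auto simp: sides_def next_side_def)

lemma next_side_inject:
  assumes "d \<in> sides T" "e \<in> sides T" "next_side d = next_side e" shows "d = e"
proof -
  have *: "m = n" if "(m + 1) mod 3 = (n + 1) mod 3" "m < 3" "n < 3" for m n :: nat
    using that by presburger
  show ?thesis using assms *[of "snd d" "snd e"] by (auto simp: sides_def next_side_def prod_eq_iff)
qed

lemma internal_sides: "d \<in> internal T \<Longrightarrow> d \<in> sides T"
  and external_sides: "d \<in> external T \<Longrightarrow> d \<in> sides T"
  by (simp_all add: internal_def external_def)

lemma internal_glue: "d \<in> internal T \<Longrightarrow> glue T d \<in> internal T"
  using glue_sides glue_glue by (auto simp: internal_def)

lemma sides_cases: "d \<in> sides T \<Longrightarrow> d \<in> external T \<or> d \<in> internal T"
  by (auto simp: internal_def external_def)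

lemma external_internal_disjoint: "d \<in> external T \<Longrightarrow> d \<notin> internal T"
  by (auto simp: internal_def external_def)

lemma oriented_internal: "d \<in> oriented T \<Longrightarrow> d \<in> internal T"
  using triangulates by (auto simp: triangulates_def)

lemma oriented_glue: "d \<in> internal T \<Longrightarrow> (d \<in> oriented T) \<noteq> (glue T d \<in> oriented T)"
  using triangulates unfolding triangulates_def by blast

lemma finite_oriented: "finite (oriented T)"
  using finite_subset[OF _ finite_sides] oriented_internal internal_sides by blast

lemma finite_external: "finite (external T)"
  using finite_subset[OF _ finite_sides] external_sides by blast

lemma glue_inj_oriented: "inj_on (glue T) (oriented T)"
  by (intro inj_onI) (metis glue_glue oriented_internal internal_sides)

lemma sides_partition: "sides T = external T \<union> (oriented T \<union> glue T ` oriented T)"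
proof (intro equalityI subsetI)
  fix d assume d: "d \<in> sides T"
  show "d \<in> external T \<union> (oriented T \<union> glue T ` oriented T)"
  proof (cases "d \<in> external T \<or> d \<in> oriented T")
    case False
    then have i: "d \<in> internal T" using sides_cases d by blast
    then have "glue T d \<in> oriented T" using oriented_glue False by blast
    then have "glue T (glue T d) \<in> glue T ` oriented T" by blast
    then show ?thesis using glue_glue[OF d] by simp
  qed auto
qed (use oriented_internal internal_sides external_sides glue_sides in blast)

lemma prod_sides:
  "(\<Prod>d\<in>sides T. h d) = (\<Prod>d\<in>external T. h d) * (\<Prod>d\<in>oriented T. h d * h (glue T d) :: 'k::comm_monoid_mult)"
proof -
  have "external T \<inter> (oriented T \<union> glue T ` oriented T) = {}"
    using external_internal_disjoint oriented_internal internal_glue by blast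
  moreover have "oriented T \<inter> glue T ` oriented T = {}"
    using oriented_glue oriented_internal by blast
  ultimately show ?thesis
    unfolding sides_partition using finite_external finite_oriented
    by (simp add: prod.union_disjoint prod.reindex[OF glue_inj_oriented] prod.distrib)
qed

lemma card_edges: "card (edges T) = card (external T) + card (oriented T)"
proof -
  have pair: "{d, glue T d} = {e, glue T e} \<longleftrightarrow> d = e"
    if "d \<in> external T \<union> oriented T" "e \<in> external T \<union> oriented T" for d e
  proof
    assume eq: "{d, glue T d} = {e, glue T e}"
    then have "d = e \<or> (d = glue T e \<and> d \<noteq> e)" by blast
    moreover have False if h: "d = glue T e" "d \<noteq> e"
    proof -
      have "e \<in> oriented T" using h \<open>e \<in> external T \<union> oriented T\<close> by (auto simp: external_def)
      then have "d \<in> internal T" "d \<notin> oriented T"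
        using h oriented_glue oriented_internal internal_glue by blast+
      then show False using \<open>d \<in> external T \<union> oriented T\<close> external_internal_disjoint by blast
    qed
    ultimately show "d = e" by blast
  qed simp
  have "edges T = (\<lambda>d. {d, glue T d}) ` (external T \<union> oriented T)"
  proof (intro equalityI subsetI)
    fix E assume "E \<in> edges T"
    then obtain d where d: "d \<in> sides T" "E = {d, glue T d}" by (auto simp: edges_def)
    show "E \<in> (\<lambda>d. {d, glue T d}) ` (external T \<union> oriented T)"
    proof (cases "d \<in> external T \<union> oriented T")
      case False
      then have i: "d \<in> internal T" using sides_cases d by blast
      then have "glue T d \<in> oriented T" using oriented_glue False by blast
      moreover have "E = {glue T d, glue T (glue T d)}" using d glue_glue by auto
      ultimately show ?thesis by blast
    qed (use d in blast)
  qed (use external_sides oriented_internal internal_sides in \<open>auto simp: edges_def\<close>)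
  moreover have "inj_on (\<lambda>d. {d, glue T d}) (external T \<union> oriented T)"
    using pair by (intro inj_onI) blast
  moreover have "external T \<inter> oriented T = {}" using external_internal_disjoint oriented_internal by blast
  ultimately show ?thesis using finite_external finite_oriented by (simp add: card_image card_Un_disjoint)
qed

subsection \<open>Vertices\<close>

text \<open>Turning around the starting point of an internal side to the next corner at the same vertex. This is an injective
  partial map on corners, defined on the internal sides, and vertices are its orbits: cycles at punctures, and
  paths that end in an external side at cilia.\<close>

definition turn :: "'f side \<Rightarrow> 'f side" where "turn d = next_side (glue T d)"

lemma turn_sides: "d \<in> internal T \<Longrightarrow> turn d \<in> sides T"
  unfolding turn_def using next_side_sides glue_sides internal_sides by blast

lemma turn_inject: "d \<in> internal T \<Longrightarrow> e \<in> internal T \<Longrightarrow> turn d = turn e \<Longrightarrow> d = e"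
  unfolding turn_def by (metis next_side_inject glue_sides glue_glue internal_sides)

lemma same_vertex_eq:
  "same_vertex T = ({(d, turn d) | d. d \<in> internal T} \<union> {(d, turn d) | d. d \<in> internal T}\<inverse>)\<^sup>* \<inter> sides T \<times> sides T"
  by (simp add: same_vertex_def turn_def Let_def)

lemma same_vertex_turn: "d \<in> internal T \<Longrightarrow> (d, turn d) \<in> same_vertex T"
  unfolding same_vertex_eq using turn_sides internal_sides by (intro IntI r_into_rtrancl) blast+

lemma same_vertex_equiv: "equiv (sides T) (same_vertex T)"
proof (rule equivI)
  show "same_vertex T \<subseteq> sides T \<times> sides T" by (auto simp: same_vertex_eq)
  show "refl_on (sides T) (same_vertex T)" by (auto simp: same_vertex_eq refl_on_def)
  let ?r = "{(d, turn d) | d. d \<in> internal T} \<union> {(d, turn d) | d. d \<in> internal T}\<inverse>"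
  have "sym (?r\<^sup>*)" by (intro sym_rtrancl sym_Un_converse)
  then show "sym (same_vertex T)" unfolding same_vertex_eq sym_def by blast
  show "trans (same_vertex T)" unfolding same_vertex_eq by (rule transI) (auto intro: rtrancl_trans)
qed

lemma same_vertex_invariant:
  assumes inv: "\<And>d. d \<in> internal T \<Longrightarrow> i d = i (turn d)" and "(d, e) \<in> same_vertex T"
  shows "i d = i e"
proof -
  have "(d, e) \<in> ({(d, turn d) | d. d \<in> internal T} \<union> {(d, turn d) | d. d \<in> internal T}\<inverse>)\<^sup>*"
    using assms(2) by (simp add: same_vertex_eq)
  then show ?thesis by (induction rule: rtrancl_induct) (use inv in auto)
qed

definition reaches :: "'f side \<Rightarrow> 'f side \<Rightarrow> bool" where
  "reaches d e \<longleftrightarrow> (d, e) \<in> {(d, turn d) | d. d \<in> internal T}\<^sup>*"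

lemma external_stuck:
  assumes "reaches d e" "d \<in> external T" shows "e = d"
  using assms external_internal_disjoint unfolding reaches_def by (auto elim: converse_rtranclE)

text \<open>A partial map is confluent, so corners at the same vertex are led to the same external side, if to any. Hence a vertex
  has at most one external side.\<close>

lemma same_vertex_reaches_external:
  assumes "(d, e) \<in> same_vertex T" "a \<in> external T"
  shows "reaches d a \<longleftrightarrow> reaches e a"
proof -
  have step: "reaches d a \<longleftrightarrow> reaches (turn d) a" if d: "d \<in> internal T" for d
  proof
    assume "reaches d a"
    then have "(d, a) \<in> {(d, turn d) | d. d \<in> internal T}\<^sup>*" by (simp only: reaches_def)
    then show "reaches (turn d) a"
    proof (cases rule: converse_rtranclE)
      case base
      then show ?thesis using d assms(2) external_internal_disjoint by blast
    next
      case (step c)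
      then have "c = turn d" by blast
      then show ?thesis using step(2) by (simp add: reaches_def)
    qed
  next
    assume "reaches (turn d) a"
    then show "reaches d a" unfolding reaches_def by (rule converse_rtrancl_into_rtrancl[rotated]) (use d in blast)
  qed
  show ?thesis using same_vertex_invariant[of "\<lambda>d. reaches d a" d e] step assms(1) by blast
qed

lemma same_vertex_external_unique:
  assumes "(d, e) \<in> same_vertex T" "d \<in> external T" "e \<in> external T" shows "d = e"
proof -
  have "reaches d d" by (simp add: reaches_def)
  then have "reaches e d" using same_vertex_reaches_external[OF assms(1,2)] by simp
  then show ?thesis using external_stuck assms(3) by blast
qed

text \<open>The corner \<open>x\<close> after an external side \<open>d\<close> is not a value of \<open>turn\<close>. If its orbit never met an external side, it
  would return to \<open>x\<close> by finiteness and injectivity, so that \<open>x\<close> would be a value after all.\<close>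

lemma external_successor_exists:
  assumes d: "d \<in> external T" shows "\<exists>e\<in>external T. (next_side d, e) \<in> same_vertex T"
proof (rule ccontr)
  let ?x = "next_side d"
  assume none: "\<not> ?thesis"
  have x: "?x \<in> sides T" using d external_sides next_side_sides by blast
  have orbit: "(?x, (turn ^^ n) ?x) \<in> same_vertex T \<and> (turn ^^ n) ?x \<in> internal T" for n
  proof (induction n)
    case 0
    have "(?x, ?x) \<in> same_vertex T" using same_vertex_equiv x by (meson equivE refl_onD)
    then show ?case using none sides_cases[OF x] by auto
  next
    case (Suc n)
    then have "((turn ^^ n) ?x, (turn ^^ Suc n) ?x) \<in> same_vertex T" using same_vertex_turn by simp
    then have *: "(?x, (turn ^^ Suc n) ?x) \<in> same_vertex T"
      using Suc same_vertex_equiv by (meson equivE transD)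
    then have "(turn ^^ Suc n) ?x \<in> sides T" by (auto simp: same_vertex_eq)
    then show ?case using * none sides_cases by blast
  qed
  have "\<not> inj_on (\<lambda>n. (turn ^^ n) ?x) (UNIV :: nat set)"
    using finite_subset[OF _ finite_sides] orbit internal_sides
    by (metis (no_types, lifting) finite_imageD image_subsetI infinite_UNIV_nat)
  then obtain m n where mn: "m < n" "(turn ^^ m) ?x = (turn ^^ n) ?x"
    unfolding inj_on_def by (metis linorder_neqE_nat)
  have "\<exists>k>0. (turn ^^ k) ?x = ?x"
    using mn
  proof (induction m arbitrary: n)
    case 0
    then show ?case by (intro exI[of _ n]) simp
  next
    case (Suc m)
    then obtain n' where n': "n = Suc n'" by (cases n) auto
    have "turn ((turn ^^ m) ?x) = turn ((turn ^^ n') ?x)" using Suc.prems n' by simp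
    then have "(turn ^^ m) ?x = (turn ^^ n') ?x" using turn_inject orbit by blast
    then show ?case using Suc.IH[of n'] Suc.prems n' by simp
  qed
  then obtain k where "(turn ^^ Suc k) ?x = ?x" by (metis gr0_implies_Suc)
  then have t: "turn ((turn ^^ k) ?x) = ?x" by simp
  let ?y = "(turn ^^ k) ?x"
  have y: "?y \<in> internal T" using orbit by blast
  have "glue T ?y = d"
    by (rule next_side_inject[OF glue_sides[OF internal_sides[OF y]] external_sides[OF d]])
      (use t in \<open>simp only: turn_def\<close>)
  then have "?y = glue T d" using glue_glue[OF internal_sides[OF y]] by simp
  also have "\<dots> = d" using d by (simp add: external_def)
  finally have "d \<in> internal T" using y by (simp only:)
  then show False using external_internal_disjoint[OF d] by simp
qed

definition vertex :: "'f side \<Rightarrow> 'f side set" where "vertex d = same_vertex T `` {d}"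

lemma vertex_eq_iff:
  assumes "d \<in> sides T" "e \<in> sides T" shows "vertex d = vertex e \<longleftrightarrow> (d, e) \<in> same_vertex T"
  unfolding vertex_def using eq_equiv_class_iff[OF same_vertex_equiv assms] .

lemma boundary_next:
  assumes d: "d \<in> external T"
  shows "boundary_next T d \<in> external T" "(next_side d, boundary_next T d) \<in> same_vertex T"
proof -
  obtain e where e: "e \<in> external T" "(next_side d, e) \<in> same_vertex T" using external_successor_exists[OF d] by blast
  have "e' = e" if "e' \<in> external T \<and> (next_side d, e') \<in> same_vertex T" for e'
  proof -
    have e': "e' \<in> external T" "(next_side d, e') \<in> same_vertex T" using that by auto
    note nd = next_side_sides[OF external_sides[OF d]]
    have "vertex e' = vertex e"
      using vertex_eq_iff[OF nd external_sides[OF e'(1)]] vertex_eq_iff[OF nd external_sides[OF e(1)]] e'(2) e(2)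
      by simp
    then have "(e', e) \<in> same_vertex T"
      using vertex_eq_iff[OF external_sides[OF e'(1)] external_sides[OF e(1)]] by simp
    then show ?thesis by (rule same_vertex_external_unique[OF _ e'(1) e(1)])
  qed
  then have "boundary_next T d = e" unfolding boundary_next_def using e by (intro the_equality) blast+
  then show "boundary_next T d \<in> external T" "(next_side d, boundary_next T d) \<in> same_vertex T" using e by simp_all
qed

lemma vertex_in: "d \<in> sides T \<Longrightarrow> vertex d \<in> vertices T"
  unfolding vertex_def vertices_def by (rule quotientI)

lemma vertex_turn: "d \<in> internal T \<Longrightarrow> vertex (turn d) = vertex d"
  using vertex_eq_iff same_vertex_turn turn_sides internal_sides by metis

lemma vertices_eq: "vertices T = vertex ` sides T"
  unfolding vertices_def quotient_def vertex_def by blast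

lemma finite_vertices: "finite (vertices T)"
  unfolding vertices_eq using finite_sides by simp

lemma vertex_external_iff:
  assumes "d \<in> sides T" shows "vertex d \<inter> external T = {} \<longleftrightarrow> vertex d \<notin> vertex ` external T"
proof -
  have "e \<in> vertex d \<longleftrightarrow> vertex e = vertex d" if "e \<in> external T" for e
  proof -
    have "e \<in> vertex d \<longleftrightarrow> (d, e) \<in> same_vertex T" by (simp add: vertex_def)
    then show ?thesis using vertex_eq_iff[OF assms external_sides[OF that]] by auto
  qed
  then show ?thesis unfolding image_iff disjoint_iff by metis
qed

definition interior_vertices where "interior_vertices = {V \<in> vertices T. V \<inter> external T = {}}"

lemma vertices_partition:
  "vertices T = interior_vertices \<union> vertex ` external T" "interior_vertices \<inter> vertex ` external T = {}"
  using vertex_external_iff external_sides unfolding interior_vertices_def vertices_eq by blast+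

lemma card_interior_vertices: "card interior_vertices = punctures \<Sigma>"
  using triangulates by (simp add: triangulates_def interior_vertices_def)

lemma seg_bij: "bij_betw (seg T) (segments \<Sigma>) (external T)"
  using triangulates by (simp add: triangulates_def)

lemma seg_external: "e \<in> segments \<Sigma> \<Longrightarrow> seg T e \<in> external T"
  using seg_bij by (auto simp: bij_betw_def)

lemma finite_segments: "finite (segments \<Sigma>)"
  by (simp add: segments_def)

lemma vertex_inj_external: "inj_on vertex (external T)"
  using vertex_eq_iff same_vertex_external_unique external_sides by (intro inj_onI) blast

lemma vertex_seg_bij: "bij_betw (\<lambda>e. vertex (seg T e)) (segments \<Sigma>) (vertex ` external T)"
  using bij_betw_trans[OF seg_bij, of vertex "vertex ` external T"] vertex_inj_external
  by (simp add: bij_betw_def comp_def)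

lemma vertex_next_seg:
  assumes "(a, b) \<in> segments \<Sigma>"
  shows "vertex (next_side (seg T (a, b))) = vertex (seg T (a, (b + 1) mod cilia \<Sigma> ! a))"
proof -
  note s = seg_external[OF assms]
  have "boundary_next T (seg T (a, b)) = seg T (a, (b + 1) mod cilia \<Sigma> ! a)"
    using triangulates assms unfolding triangulates_def by fast
  then show ?thesis
    using boundary_next[OF s] vertex_eq_iff[OF next_side_sides[OF external_sides[OF s]] external_sides[OF boundary_next(1)[OF s]]]
    by simp
qed

text \<open>Vertices are punctures or correspond to external sides, so the external edges cancel in the Euler characteristic.\<close>

lemma euler_exponent:
  "int (card (oriented T)) - int (card (faces T)) = 2 * int (genus \<Sigma>) - 2 + int (punctures \<Sigma>) + int (boundaries \<Sigma>)"
proof -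
  have "card (vertices T) = punctures \<Sigma> + card (external T)"
    unfolding vertices_partition(1) card_interior_vertices[symmetric]
    using vertices_partition finite_vertices card_image[OF vertex_inj_external] finite_external
    by (subst card_Un_disjoint) auto
  moreover have "int (card (vertices T)) - int (card (edges T)) + int (card (faces T))
       = 2 - 2 * int (genus \<Sigma>) - int (boundaries \<Sigma>)"
    using triangulates by (simp add: triangulates_def)
  ultimately show ?thesis using card_edges by linarith
qed

lemma connected_constant:
  assumes "\<And>d. d \<in> sides T \<Longrightarrow> c (next_side d) = c d" "\<And>d. d \<in> sides T \<Longrightarrow> c (glue T d) = c d"
    "d \<in> sides T" "e \<in> sides T"
  shows "c d = c e"
proof -
  have "(d, e) \<in> {(a, b). a \<in> sides T \<and> (b = next_side a \<or> b = glue T a)}\<^sup>*"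
    using triangulates assms(3,4) unfolding triangulates_def by blast
  then show ?thesis
  proof (induction rule: rtrancl_induct)
    case (step a b)
    then have "a \<in> sides T" "b = next_side a \<or> b = glue T a" by simp_all
    then have "c b = c a" using assms(1,2)[of a] by blast
    then show ?case using step.IH by simp
  qed simp
qed

end

section \<open>Traces of products as sums over closed paths\<close>

text \<open>The entry \<open>(x, y)\<close> of the product of the first \<open>p\<close> matrices of size \<open>D\<close>.\<close>

fun chain :: "(nat \<Rightarrow> nat \<Rightarrow> nat \<Rightarrow> 'k::comm_semiring_1) \<Rightarrow> nat \<Rightarrow> nat \<Rightarrow> nat \<Rightarrow> nat \<Rightarrow> 'k" where
  "chain M D 0 x y = of_bool (x = y)"
| "chain M D (Suc p) x y = (\<Sum>z<D. chain M D p x z * M p z y)"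

lemma sum_PiE_lessThan_Suc:
  "(\<Sum>s\<in>{..<Suc p} \<rightarrow>\<^sub>E A. G s) = (\<Sum>z\<in>A. \<Sum>s\<in>{..<p} \<rightarrow>\<^sub>E A. (G (s(p := z)) :: 'k::comm_monoid_add))"
proof -
  have "(\<Sum>s\<in>{..<Suc p} \<rightarrow>\<^sub>E A. G s) = (\<Sum>(z, s)\<in>A \<times> ({..<p} \<rightarrow>\<^sub>E A). G (s(p := z)))"
    unfolding lessThan_Suc PiE_insert_eq
    by (subst sum.reindex) (use inj_combinator[of p "{..<p}" "\<lambda>_. A"] in \<open>simp_all add: split_beta comp_def\<close>)
  then show ?thesis by (simp add: sum.cartesian_product)
qed

lemma chain_eq_sum:
  assumes "x < D" "p > 0"
  shows "chain M D p x y = (\<Sum>s\<in>{..<p} \<rightarrow>\<^sub>E {..<D}. of_bool (s 0 = x) *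
    (\<Prod>b<p. M b (s b) (if Suc b < p then s (Suc b) else y)))"
  using assms(2)
proof (induction p arbitrary: y)
  case (Suc p)
  show ?case
  proof (cases "p = 0")
    case True
    have "(\<Sum>z<D. of_bool (x = z) * M 0 z y) = (\<Sum>z<D. of_bool (z = x) * M 0 z y)"
      by (intro sum.cong) auto
    then show ?thesis unfolding sum_PiE_lessThan_Suc using True by simp
  next
    case False
    have "(\<Prod>b<Suc p. M b ((s(p := z)) b) (if Suc b < Suc p then (s(p := z)) (Suc b) else y))
      = (\<Prod>b<p. M b (s b) (if Suc b < p then s (Suc b) else z)) * M p z y" for s z
      by (auto intro!: arg_cong2[of _ _ _ _ "(*)"] prod.cong)
    moreover have "(s(p := z)) 0 = s 0" for s :: "nat \<Rightarrow> nat" and z using False by simp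
    ultimately have "(\<Sum>s\<in>{..<Suc p} \<rightarrow>\<^sub>E {..<D}. of_bool (s 0 = x) *
        (\<Prod>b<Suc p. M b (s b) (if Suc b < Suc p then s (Suc b) else y)))
      = (\<Sum>z<D. \<Sum>s\<in>{..<p} \<rightarrow>\<^sub>E {..<D}. of_bool (s 0 = x) *
        ((\<Prod>b<p. M b (s b) (if Suc b < p then s (Suc b) else z)) * M p z y))"
      unfolding sum_PiE_lessThan_Suc by (simp only:)
    also have "\<dots> = chain M D (Suc p) x y"
      using Suc.IH False by (simp add: sum_distrib_right mult.assoc)
    finally show ?thesis by simp
  qed
qed simp

text \<open>Both the trace of a face (\<open>p = 3\<close>) and the contraction along a boundary circle have this form.\<close>

lemma chain_trace:
  assumes "p > 0"
  shows "(\<Sum>x<D. chain M D p x x) = (\<Sum>s\<in>{..<p} \<rightarrow>\<^sub>E {..<D}. \<Prod>b<p. M b (s b) (s ((b + 1) mod p)))"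
proof -
  have "(\<Sum>x<D. chain M D p x x) = (\<Sum>x<D. \<Sum>s\<in>{..<p} \<rightarrow>\<^sub>E {..<D}. of_bool (s 0 = x) *
    (\<Prod>b<p. M b (s b) (if Suc b < p then s (Suc b) else x)))"
    using assms by (intro sum.cong HOL.refl chain_eq_sum) auto
  also have "\<dots> = (\<Sum>s\<in>{..<p} \<rightarrow>\<^sub>E {..<D}. \<Sum>x<D. of_bool (s 0 = x) *
    (\<Prod>b<p. M b (s b) (if Suc b < p then s (Suc b) else x)))"
    by (rule sum.swap)
  also have "\<dots> = (\<Sum>s\<in>{..<p} \<rightarrow>\<^sub>E {..<D}. \<Prod>b<p. M b (s b) (s ((b + 1) mod p)))"
  proof (rule sum.cong[OF HOL.refl])
    fix s :: "nat \<Rightarrow> nat" assume s: "s \<in> {..<p} \<rightarrow>\<^sub>E {..<D}"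
    then have s0: "s 0 < D" using assms by auto
    have "(\<Sum>x<D. of_bool (s 0 = x) * (\<Prod>b<p. M b (s b) (if Suc b < p then s (Suc b) else x)))
      = (\<Sum>x<D. if x = s 0 then (\<Prod>b<p. M b (s b) (if Suc b < p then s (Suc b) else s 0)) else 0)"
      by (intro sum.cong) auto
    also have "\<dots> = (\<Prod>b<p. M b (s b) (if Suc b < p then s (Suc b) else s 0))" using s0 by simp
    also have "\<dots> = (\<Prod>b<p. M b (s b) (s ((b + 1) mod p)))"
    proof (rule prod.cong[OF HOL.refl])
      fix b assume "b \<in> {..<p}"
      then have "Suc b < p \<or> Suc b = p" by auto
      then show "M b (s b) (if Suc b < p then s (Suc b) else s 0) = M b (s b) (s ((b + 1) mod p))" by auto
    qed
    finally show "(\<Sum>x<D. of_bool (s 0 = x) * (\<Prod>b<p. M b (s b) (if Suc b < p then s (Suc b) else x)))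
      = (\<Prod>b<p. M b (s b) (s ((b + 1) mod p)))" .
  qed
  finally show ?thesis .
qed

context hecke_field
begin

abbreviation "entry \<Lambda> x i j \<equiv> chosen \<Lambda> x $$ (i, j)"

definition hprod :: "(nat \<Rightarrow> 'w hecke) \<Rightarrow> nat \<Rightarrow> 'w hecke" where
  "hprod x p = foldr (\<lambda>x y. x \<star> y) (map x [0..<p]) \<one>\<^bsub>H\<^esub>"

lemma hprod_0: "hprod x 0 = \<one>\<^bsub>H\<^esub>"
  by (simp add: hprod_def)

lemma foldr_mult_closed: "set xs \<subseteq> carrier H \<Longrightarrow> y \<in> carrier H \<Longrightarrow> foldr (\<lambda>x y. x \<star> y) xs y \<in> carrier H"
  by (induction xs) auto

lemma foldr_mult:
  "set xs \<subseteq> carrier H \<Longrightarrow> y \<in> carrier H \<Longrightarrow>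
   foldr (\<lambda>x y. x \<star> y) xs y = foldr (\<lambda>x y. x \<star> y) xs \<one>\<^bsub>H\<^esub> \<star> y"
  by (induction xs) (auto simp: H.m_assoc foldr_mult_closed)

lemma hprod_closed: "(\<And>b. b < p \<Longrightarrow> x b \<in> carrier H) \<Longrightarrow> hprod x p \<in> carrier H"
  unfolding hprod_def by (rule foldr_mult_closed) auto

lemma hprod_Suc:
  assumes "\<And>b. b < Suc p \<Longrightarrow> x b \<in> carrier H" shows "hprod x (Suc p) = hprod x p \<star> x p"
proof -
  have "set (map x [0..<p]) \<subseteq> carrier H" using assms by auto
  from foldr_mult[OF this, of "x p"] show ?thesis using assms by (simp add: hprod_def)
qed

lemma rep_hprod:
  assumes r: "rep d \<rho>" and x: "\<And>b. b < p \<Longrightarrow> x b \<in> carrier H" and ij: "i < d" "j < d"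
  shows "\<rho> (hprod x p) $$ (i, j) = chain (\<lambda>b i j. \<rho> (x b) $$ (i, j)) d p i j"
  using x ij(2)
proof (induction p arbitrary: j)
  case 0
  then show ?case using ij by (simp add: hprod_0 repD(2)[OF r])
next
  case (Suc p)
  have c: "hprod x p \<in> carrier H" using hprod_closed Suc.prems by simp
  have "\<rho> (hprod x (Suc p)) $$ (i, j) = (\<Sum>z<d. \<rho> (hprod x p) $$ (i, z) * \<rho> (x p) $$ (z, j))"
    using hprod_Suc[of p x] Suc.prems rep_entry_mult[OF r ij(1) _ c] by simp
  then show ?case using Suc.IH Suc.prems by simp
qed

lemma irrep_char_hprod:
  assumes \<Lambda>: "\<Lambda> \<in> hclasses" and p: "p > 0" and x: "\<And>b. b < p \<Longrightarrow> x b \<in> carrier H"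
  shows "irrep_char \<Lambda> (hprod x p) =
    (\<Sum>s\<in>{..<p} \<rightarrow>\<^sub>E {..<cdim \<Lambda>}. \<Prod>b<p. entry \<Lambda> (x b) (s b) (s ((b + 1) mod p)))"
proof -
  have "irrep_char \<Lambda> (hprod x p) = (\<Sum>i<cdim \<Lambda>. entry \<Lambda> (hprod x p) i i)"
    using irrep_char_eq[OF \<Lambda> hprod_closed] x by (simp add: character_def)
  also have "\<dots> = (\<Sum>i<cdim \<Lambda>. chain (\<lambda>b i j. entry \<Lambda> (x b) i j) (cdim \<Lambda>) p i i)"
    using irrepD(1)[OF chosen_irrep[OF \<Lambda>]] x by (intro sum.cong HOL.refl rep_hprod) auto
  finally show ?thesis using chain_trace[OF p] by simp
qed

text \<open>The summation range for a single face: an irreducible class together with a basis index at each corner.\<close>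

definition face_states where
  "face_states = Sigma hclasses (\<lambda>\<Lambda>. {..<3::nat} \<rightarrow>\<^sub>E {..<cdim \<Lambda>})"

lemma face_statesD:
  assumes "q \<in> face_states" shows "fst q \<in> hclasses" "snd q \<in> {..<3} \<rightarrow>\<^sub>E {..<cdim (fst q)}"
  using assms by (cases q; simp add: face_states_def)+

lemma finite_face_states: "finite face_states"
  unfolding face_states_def using finite_classes by (auto intro!: finite_PiE)

lemma face_trace:
  assumes a: "\<And>k. k < 3 \<Longrightarrow> a k \<in> carrier W"
  shows "\<theta> (tr (B (a 0) \<star> B (a 1) \<star> B (a 2))) =
    (\<Sum>q\<in>face_states. 1 / schur (fst q) *
       (\<Prod>k<3. entry (fst q) (B (a k)) (snd q k) (snd q ((k + 1) mod 3))))"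
proof -
  let ?x = "\<lambda>k. B (a k)"
  have c: "?x k \<in> carrier H" if "k < 3" for k using a that by simp
  have "[0..<3] = [0, 1, 2::nat]" by (simp add: upt_rec)
  then have e: "?x 0 \<star> ?x 1 \<star> ?x 2 = hprod ?x 3"
    using c[of 0] c[of 1] c[of 2] by (simp add: hprod_def H.m_assoc)
  have "\<theta> (tr (hprod ?x 3)) = (\<Sum>\<Lambda>\<in>hclasses. 1 / schur \<Lambda> * irrep_char \<Lambda> (hprod ?x 3))"
    using trace_schur[OF hprod_closed] c by simp
  also have "\<dots> = (\<Sum>\<Lambda>\<in>hclasses. \<Sum>s\<in>{..<3} \<rightarrow>\<^sub>E {..<cdim \<Lambda>}.
      1 / schur \<Lambda> * (\<Prod>k<3. entry \<Lambda> (?x k) (s k) (s ((k + 1) mod 3))))"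
    using irrep_char_hprod[of _ 3 ?x] c by (intro sum.cong HOL.refl) (simp add: sum_distrib_left)
  also have "\<dots> = (\<Sum>q\<in>face_states. 1 / schur (fst q) *
       (\<Prod>k<3. entry (fst q) (?x k) (snd q k) (snd q ((k + 1) mod 3))))"
    unfolding face_states_def using finite_classes
    by (subst sum.Sigma) (auto intro!: finite_PiE simp: split_beta)
  finally show ?thesis unfolding e .
qed

end

section \<open>The state sum\<close>

locale labelled_surface = hecke_field W S \<theta> + triangulated \<Sigma> T
  for W :: "('w, 'b) monoid_scheme" (structure) and S :: "'w set" and \<theta> :: "laurent \<Rightarrow> 'k::field"
    and \<Sigma> :: surface and T :: "'f triangulation" +
  fixes l :: "nat \<times> nat \<Rightarrow> 'w hecke"
  assumes labels: "\<forall>e\<in>segments \<Sigma>. l e \<in> carrier (hecke_alg W S)"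
begin

abbreviation colour :: "('f \<Rightarrow> ('w hecke \<Rightarrow> 'k mat) set \<times> (nat \<Rightarrow> nat)) \<Rightarrow> 'f side \<Rightarrow> ('w hecke \<Rightarrow> 'k mat) set" where
  "colour g d \<equiv> fst (g (fst d))"
abbreviation corner :: "('f \<Rightarrow> ('w hecke \<Rightarrow> 'k mat) set \<times> (nat \<Rightarrow> nat)) \<Rightarrow> 'f side \<Rightarrow> nat" where
  "corner g d \<equiv> snd (g (fst d)) (snd d)"

text \<open>A configuration chooses a state for every face. The colour of a side is the class chosen for its face, and its
  corner is the index at the point where it starts.\<close>

definition "confs = faces T \<rightarrow>\<^sub>E face_states"

lemma conf_bounds:
  assumes "g \<in> confs" "d \<in> sides T"
  shows "colour g d \<in> hclasses" "corner g d < cdim (colour g d)"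
proof -
  have "g (fst d) \<in> face_states" "snd d < 3" using assms by (auto simp: confs_def sides_def)
  then show "colour g d \<in> hclasses" "corner g d < cdim (colour g d)" by (auto simp: face_states_def split_beta dest!: PiE_mem)
qed

lemma colour_next_side: "colour g (next_side d) = colour g d"
  by (simp add: next_side_def)

definition "face_weight g = (\<Prod>f\<in>faces T. 1 / schur (fst (g f)))"

lemma prod_faces_expand:
  assumes lab: "\<And>d. d \<in> sides T \<Longrightarrow> lab d \<in> carrier W"
  shows "(\<Prod>f\<in>faces T. \<theta> (tr (B (lab (f, 0)) \<star> B (lab (f, 1)) \<star> B (lab (f, 2))))) =
    (\<Sum>g\<in>confs. face_weight g * (\<Prod>d\<in>sides T. entry (colour g d) (B (lab d)) (corner g d) (corner g (next_side d))))"
proof -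
  have "(\<Prod>f\<in>faces T. \<theta> (tr (B (lab (f, 0)) \<star> B (lab (f, 1)) \<star> B (lab (f, 2))))) =
    (\<Prod>f\<in>faces T. \<Sum>q\<in>face_states. 1 / schur (fst q) *
       (\<Prod>k<3. entry (fst q) (B (lab (f, k))) (snd q k) (snd q ((k + 1) mod 3))))"
    by (intro prod.cong HOL.refl face_trace[where a = "\<lambda>k. lab (_, k)"]) (use lab in \<open>auto simp: sides_def\<close>)
  also have "\<dots> = (\<Sum>g\<in>confs. \<Prod>f\<in>faces T. 1 / schur (fst (g f)) *
       (\<Prod>k<3. entry (fst (g f)) (B (lab (f, k))) (snd (g f) k) (snd (g f) ((k + 1) mod 3))))"
    unfolding confs_def by (rule prod_sum_PiE) (use finite_faces finite_face_states in auto)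
  also have "\<dots> = (\<Sum>g\<in>confs. face_weight g * (\<Prod>d\<in>sides T. entry (colour g d) (B (lab d)) (corner g d) (corner g (next_side d))))"
    unfolding prod.distrib face_weight_def sides_def prod.cartesian_product next_side_def
    by (simp add: split_beta)
  finally show ?thesis .
qed

text \<open>The total contribution of the internal edges after summation over their labels, by the orthogonality relations.\<close>

definition "gluing g = (\<Prod>d\<in>oriented T.
   if colour g d = colour g (glue T d) \<and> corner g d = corner g (turn d) \<and> corner g (next_side d) = corner g (glue T d)
   then schur (colour g d) else 0)"

lemma prod_external_segments: "(\<Prod>d\<in>external T. h d) = (\<Prod>e\<in>segments \<Sigma>. h (seg T e) :: 'k)"
  by (rule prod.reindex_bij_betw[OF seg_bij, symmetric])

lemma side_label_external:
  assumes "e \<in> segments \<Sigma>" shows "side_label W \<Sigma> T b x (seg T e) = b e"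
  unfolding side_label_def using seg_external[OF assms] seg_bij assms
  by (simp add: bij_betw_def the_inv_into_f_f)

lemma side_label_oriented:
  assumes "d \<in> oriented T"
  shows "side_label W \<Sigma> T b x d = x d" "side_label W \<Sigma> T b x (glue T d) = inv (x d)"
proof -
  have i: "d \<in> internal T" "glue T d \<in> internal T" using assms oriented_internal internal_glue by blast+
  then have "d \<notin> external T" "glue T d \<notin> external T" "glue T d \<notin> oriented T"
    using external_internal_disjoint oriented_glue assms by blast+
  then show "side_label W \<Sigma> T b x d = x d" "side_label W \<Sigma> T b x (glue T d) = inv (x d)"
    using assms glue_glue[OF internal_sides[OF i(1)]] by (simp_all add: side_label_def)
qed

lemma side_label_closed:
  assumes "b \<in> segments \<Sigma> \<rightarrow>\<^sub>E carrier W" "x \<in> oriented T \<rightarrow>\<^sub>E carrier W" "d \<in> sides T"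
  shows "side_label W \<Sigma> T b x d \<in> carrier W"
proof -
  consider "d \<in> external T" | "d \<in> oriented T" | d' where "d' \<in> oriented T" "d = glue T d'"
    using assms(3) sides_partition by blast
  then show ?thesis
  proof cases
    case 1
    then have "d \<in> seg T ` segments \<Sigma>" using seg_bij by (simp add: bij_betw_def)
    then obtain e where "e \<in> segments \<Sigma>" "d = seg T e" by blast
    then show ?thesis using side_label_external assms(1) by auto
  next
    case 2
    then show ?thesis using side_label_oriented(1) assms(2) by auto
  next
    case 3
    then show ?thesis using side_label_oriented(2) assms(2) by auto
  qed
qed

lemma invariant_W_expand:
  assumes b: "b \<in> segments \<Sigma> \<rightarrow>\<^sub>E carrier W"
  shows "\<theta> (invariant_W W S \<Sigma> T b) = (\<Sum>g\<in>confs. face_weight g * gluing g *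
    (\<Prod>e\<in>segments \<Sigma>. entry (colour g (seg T e)) (B (b e)) (corner g (seg T e)) (corner g (next_side (seg T e)))))"
proof -
  let ?h = "\<lambda>g lab d. entry (colour g d) (B (lab d)) (corner g d) (corner g (next_side d))"
  let ?X = "oriented T \<rightarrow>\<^sub>E carrier W"
  let ?seg = "\<lambda>g. \<Prod>e\<in>segments \<Sigma>. entry (colour g (seg T e)) (B (b e)) (corner g (seg T e)) (corner g (next_side (seg T e)))"
  let ?or = "\<lambda>g d w. entry (colour g d) (B w) (corner g d) (corner g (next_side d)) *
      entry (colour g (glue T d)) (B (inv w)) (corner g (glue T d)) (corner g (turn d))"
  have "\<theta> (invariant_W W S \<Sigma> T b) =
    (\<Sum>x\<in>?X. \<Sum>g\<in>confs. face_weight g * (\<Prod>d\<in>sides T. ?h g (side_label W \<Sigma> T b x) d))"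
    unfolding invariant_W_def \<theta>.hom_sum \<theta>.hom_prod
    by (intro sum.cong HOL.refl prod_faces_expand side_label_closed[OF b])
  also have "\<dots> = (\<Sum>x\<in>?X. \<Sum>g\<in>confs. face_weight g * (?seg g * (\<Prod>d\<in>oriented T. ?or g d (x d))))"
  proof (intro sum.cong HOL.refl arg_cong2[of _ _ _ _ "(*)"])
    fix x g assume "x \<in> ?X" "g \<in> confs"
    have "(\<Prod>d\<in>external T. ?h g (side_label W \<Sigma> T b x) d) = ?seg g"
      unfolding prod_external_segments by (intro prod.cong HOL.refl) (simp only: side_label_external)
    moreover have "(\<Prod>d\<in>oriented T. ?h g (side_label W \<Sigma> T b x) d * ?h g (side_label W \<Sigma> T b x) (glue T d))
       = (\<Prod>d\<in>oriented T. ?or g d (x d))"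
      by (intro prod.cong HOL.refl) (simp only: side_label_oriented turn_def)
    ultimately show "(\<Prod>d\<in>sides T. ?h g (side_label W \<Sigma> T b x) d) = ?seg g * (\<Prod>d\<in>oriented T. ?or g d (x d))"
      unfolding prod_sides by (simp only:)
  qed
  also have "\<dots> = (\<Sum>g\<in>confs. face_weight g * ?seg g * (\<Sum>x\<in>?X. \<Prod>d\<in>oriented T. ?or g d (x d)))"
    by (subst sum.swap) (simp add: sum_distrib_left mult.assoc)
  also have "\<dots> = (\<Sum>g\<in>confs. face_weight g * gluing g * ?seg g)"
  proof (rule sum.cong[OF HOL.refl])
    fix g assume g: "g \<in> confs"
    have "(\<Sum>x\<in>?X. \<Prod>d\<in>oriented T. ?or g d (x d)) = (\<Prod>d\<in>oriented T. \<Sum>w\<in>carrier W. ?or g d w)"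
      by (rule prod_sum_PiE[symmetric]) (use finite_oriented finite_W in auto)
    also have "\<dots> = gluing g"
      unfolding gluing_def
    proof (rule prod.cong[OF HOL.refl])
      fix d assume "d \<in> oriented T"
      then have d: "d \<in> sides T" "glue T d \<in> sides T" "next_side d \<in> sides T" "turn d \<in> sides T"
        using oriented_internal internal_sides glue_sides next_side_sides turn_sides by blast+
      have "corner g (next_side d) < cdim (colour g d)" "corner g (turn d) < cdim (colour g (glue T d))"
        using conf_bounds(2)[OF g d(3)] conf_bounds(2)[OF g d(4)] by (simp_all add: turn_def colour_next_side)
      from schur_orthogonality[OF conf_bounds(1)[OF g d(1)] conf_bounds(1)[OF g d(2)]
        conf_bounds(2)[OF g d(1)] this(1) conf_bounds(2)[OF g d(2)] this(2)]
      show "(\<Sum>w\<in>carrier W. ?or g d w) = (if colour g d = colour g (glue T d) \<and> corner g d = corner g (turn d) \<and>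
         corner g (next_side d) = corner g (glue T d) then schur (colour g d) else 0)" .
    qed
    finally show "face_weight g * ?seg g * (\<Sum>x\<in>?X. \<Prod>d\<in>oriented T. ?or g d (x d)) = face_weight g * gluing g * ?seg g"
      by (simp add: mult_ac)
  qed
  finally show ?thesis .
qed

lemma invariant_expand:
  "\<theta> (invariant W S \<Sigma> T l) = (\<Sum>g\<in>confs. face_weight g * gluing g *
    (\<Prod>e\<in>segments \<Sigma>. entry (colour g (seg T e)) (l e) (corner g (seg T e)) (corner g (next_side (seg T e)))))"
proof -
  let ?Bd = "segments \<Sigma> \<rightarrow>\<^sub>E carrier W"
  let ?e = "\<lambda>g e x. entry (colour g (seg T e)) x (corner g (seg T e)) (corner g (next_side (seg T e)))"
  have "\<theta> (invariant W S \<Sigma> T l) = (\<Sum>b\<in>?Bd. (\<Prod>e\<in>segments \<Sigma>. \<theta> (hecke_coord W S (l e) (b e))) *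
     (\<Sum>g\<in>confs. face_weight g * gluing g * (\<Prod>e\<in>segments \<Sigma>. ?e g e (B (b e)))))"
    unfolding invariant_def \<theta>.hom_sum \<theta>.hom_mult \<theta>.hom_prod
    by (intro sum.cong HOL.refl arg_cong2[of _ _ _ _ "(*)"] invariant_W_expand)
  also have "\<dots> = (\<Sum>b\<in>?Bd. \<Sum>g\<in>confs. face_weight g * gluing g *
     (\<Prod>e\<in>segments \<Sigma>. \<theta> (hecke_coord W S (l e) (b e)) * ?e g e (B (b e))))"
    by (simp add: sum_distrib_left prod.distrib mult_ac)
  also have "\<dots> = (\<Sum>g\<in>confs. face_weight g * gluing g *
     (\<Sum>b\<in>?Bd. \<Prod>e\<in>segments \<Sigma>. \<theta> (hecke_coord W S (l e) (b e)) * ?e g e (B (b e))))"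
    by (subst sum.swap) (simp add: sum_distrib_left)
  also have "\<dots> = (\<Sum>g\<in>confs. face_weight g * gluing g * (\<Prod>e\<in>segments \<Sigma>. ?e g e (l e)))"
  proof (intro sum.cong HOL.refl arg_cong2[of _ _ _ _ "(*)"])
    fix g assume g: "g \<in> confs"
    have "(\<Sum>b\<in>?Bd. \<Prod>e\<in>segments \<Sigma>. \<theta> (hecke_coord W S (l e) (b e)) * ?e g e (B (b e)))
      = (\<Prod>e\<in>segments \<Sigma>. \<Sum>w\<in>carrier W. \<theta> (hecke_coord W S (l e) w) * ?e g e (B w))"
      by (rule prod_sum_PiE[symmetric]) (use finite_segments finite_W in auto)
    also have "\<dots> = (\<Prod>e\<in>segments \<Sigma>. ?e g e (l e))"
    proof (rule prod.cong[OF HOL.refl])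
      fix e assume e: "e \<in> segments \<Sigma>"
      note s = external_sides[OF seg_external[OF e]]
      note r = irrepD(1)[OF chosen_irrep[OF conf_bounds(1)[OF g s]]]
      have j: "corner g (next_side (seg T e)) < cdim (colour g (seg T e))"
        using conf_bounds(2)[OF g next_side_sides[OF s]] by (simp add: colour_next_side)
      have le: "l e \<in> carrier H" using labels e by blast
      show "(\<Sum>w\<in>carrier W. \<theta> (hecke_coord W S (l e) w) * ?e g e (B w)) = ?e g e (l e)"
        unfolding hecke_coord_eq[OF le]
        by (rule semilinear_expand[symmetric, where \<phi> = "?e g e"])
          (use rep_entry_add[OF r conf_bounds(2)[OF g s] j] rep_entry_sc[OF r conf_bounds(2)[OF g s] j] le in auto)
    qed
    finally show "(\<Sum>b\<in>?Bd. \<Prod>e\<in>segments \<Sigma>. \<theta> (hecke_coord W S (l e) (b e)) * ?e g e (B (b e)))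
      = (\<Prod>e\<in>segments \<Sigma>. ?e g e (l e))" .
  qed
  finally show ?thesis .
qed

definition "glued g \<longleftrightarrow> (\<forall>d\<in>internal T. colour g d = colour g (glue T d) \<and> corner g d = corner g (turn d))"

text \<open>The condition on the end point of an edge is the condition on the starting point of the opposite side.\<close>

lemma gluing_eq: "gluing g = (if glued g then \<Prod>d\<in>oriented T. schur (colour g d) else 0)"
proof (cases "glued g")
  case True
  have "corner g (next_side d) = corner g (glue T d)" if "d \<in> oriented T" for d
  proof -
    have "glue T d \<in> internal T" using that oriented_internal internal_glue by blast
    then have "corner g (glue T d) = corner g (turn (glue T d))" using True unfolding glued_def by blast
    then show ?thesis using glue_glue oriented_internal internal_sides that by (simp add: turn_def)
  qed
  then show ?thesis using True oriented_internal unfolding gluing_def glued_def by (auto intro!: prod.cong)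
next
  case False
  then obtain d where d: "d \<in> internal T" "\<not> (colour g d = colour g (glue T d) \<and> corner g d = corner g (turn d))"
    unfolding glued_def by blast
  have gd: "glue T (glue T d) = d" "glue T d \<in> internal T" using d glue_glue internal_sides internal_glue by blast+
  have "\<exists>e\<in>oriented T. \<not> (colour g e = colour g (glue T e) \<and> corner g e = corner g (turn e) \<and> corner g (next_side e) = corner g (glue T e))"
  proof (cases "d \<in> oriented T")
    case True
    then show ?thesis using d by blast
  next
    case False
    then have "glue T d \<in> oriented T" using oriented_glue d by blast
    then show ?thesis using d gd by (intro bexI[of _ "glue T d"]) (auto simp: turn_def)
  qed
  then have "gluing g = 0" unfolding gluing_def using finite_oriented by (intro prod_zero) auto
  then show ?thesis using False by simp
qed

text \<open>The configuration with constant colour \<open>\<Lambda>\<close> and indices \<open>j\<close> at the vertices.\<close>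

definition conf_of :: "('w hecke \<Rightarrow> 'k mat) set \<Rightarrow> ('f side set \<Rightarrow> nat) \<Rightarrow> 'f \<Rightarrow>
    ('w hecke \<Rightarrow> 'k mat) set \<times> (nat \<Rightarrow> nat)" where
  "conf_of \<Lambda> j = (\<lambda>f\<in>faces T. (\<Lambda>, \<lambda>k\<in>{..<3}. j (vertex (f, k))))"

lemma conf_of_side:
  assumes "d \<in> sides T" shows "colour (conf_of \<Lambda> j) d = \<Lambda>" "corner (conf_of \<Lambda> j) d = j (vertex d)"
  using assms by (auto simp: sides_def conf_of_def)

lemma conf_of_conf:
  assumes "\<Lambda> \<in> hclasses" "j \<in> vertices T \<rightarrow>\<^sub>E {..<cdim \<Lambda>}"
  shows "conf_of \<Lambda> j \<in> confs" "glued (conf_of \<Lambda> j)"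
proof -
  have "j (vertex (f, k)) < cdim \<Lambda>" if "f \<in> faces T" "k < 3" for f k
    using assms(2) vertex_in[of "(f, k)"] that by (auto simp: sides_def)
  then show "conf_of \<Lambda> j \<in> confs" using assms(1) by (auto simp: confs_def conf_of_def face_states_def)
  show "glued (conf_of \<Lambda> j)"
    unfolding glued_def using conf_of_side internal_sides glue_sides turn_sides vertex_turn by simp
qed

text \<open>Glued sides have equal colours, as have the sides of a face, so by connectedness the colour is constant.
  The indices are invariant under \<open>turn\<close>, hence constant on vertices.\<close>

lemma glued_conf_of:
  assumes g: "g \<in> confs" "glued g"
  shows "\<exists>\<Lambda>\<in>hclasses. \<exists>j\<in>vertices T \<rightarrow>\<^sub>E {..<cdim \<Lambda>}. g = conf_of \<Lambda> j"
proof -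
  obtain f0 where f0: "f0 \<in> faces T" using faces_nonempty by blast
  let ?\<Lambda> = "fst (g f0)"
  have s0: "(f0, 0) \<in> sides T" using f0 by (simp add: sides_def)
  have cg: "colour g (glue T d) = colour g d" if "d \<in> sides T" for d
  proof (cases "d \<in> internal T")
    case True
    then show ?thesis using g(2) unfolding glued_def by simp
  next
    case False
    then have "glue T d = d" using that by (simp add: internal_def)
    then show ?thesis by simp
  qed
  have c: "colour g d = ?\<Lambda>" if "d \<in> sides T" for d
    using connected_constant[of "\<lambda>d. colour g d", OF _ cg that s0] by (simp add: colour_next_side)
  have \<Lambda>: "?\<Lambda> \<in> hclasses" using conf_bounds(1)[OF g(1) s0] by simp
  have v: "corner g d = corner g e" if de: "d \<in> sides T" "e \<in> sides T" "vertex d = vertex e" for d e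
  proof -
    have "(d, e) \<in> same_vertex T" using vertex_eq_iff[OF de(1,2)] de(3) by simp
    moreover have "corner g d = corner g (turn d)" if "d \<in> internal T" for d
      using g(2) that unfolding glued_def by blast
    ultimately show ?thesis using same_vertex_invariant[of "\<lambda>d. corner g d" d e] by blast
  qed
  define side where "side V = (SOME d. d \<in> sides T \<and> vertex d = V)" for V
  have side: "side V \<in> sides T \<and> vertex (side V) = V" if "V \<in> vertices T" for V
  proof -
    have "\<exists>d. d \<in> sides T \<and> vertex d = V" using that unfolding vertices_eq by blast
    then show ?thesis unfolding side_def by (rule someI_ex)
  qed
  define j where "j = (\<lambda>V\<in>vertices T. corner g (side V))"
  have jv: "j (vertex d) = corner g d" if "d \<in> sides T" for d
    using v[OF _ that] side vertex_in[OF that] by (simp add: j_def)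
  have j: "j \<in> vertices T \<rightarrow>\<^sub>E {..<cdim ?\<Lambda>}"
  proof (rule PiE_I)
    fix V assume V: "V \<in> vertices T"
    then have "corner g (side V) < cdim (colour g (side V))" using conf_bounds(2)[OF g(1)] side by blast
    then show "j V \<in> {..<cdim ?\<Lambda>}" using V side c by (simp add: j_def)
  qed (simp add: j_def)
  have "g = conf_of ?\<Lambda> j"
  proof
    fix f
    show "g f = conf_of ?\<Lambda> j f"
    proof (cases "f \<in> faces T")
      case True
      have sf: "(f, k) \<in> sides T" if "k < 3" for k using True that by (simp add: sides_def)
      have "g f \<in> face_states" using PiE_mem[OF g(1)[unfolded confs_def] True] .
      then have gE: "snd (g f) \<in> {..<3} \<rightarrow>\<^sub>E {..<cdim (fst (g f))}" by (rule face_statesD)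
      have "snd (g f) k = (\<lambda>k\<in>{..<3}. j (vertex (f, k))) k" for k
        using jv[OF sf[of k]] PiE_arb[OF gE, of k] by (cases "k < 3") simp_all
      then have "snd (g f) = (\<lambda>k\<in>{..<3}. j (vertex (f, k)))" by (rule ext)
      moreover have "fst (g f) = ?\<Lambda>" using c[OF sf[of 0]] by simp
      moreover have "conf_of ?\<Lambda> j f = (?\<Lambda>, \<lambda>k\<in>{..<3}. j (vertex (f, k)))" using True by (simp add: conf_of_def)
      ultimately show ?thesis by (simp only: prod_eq_iff fst_conv snd_conv simp_thms)
    next
      case False
      then show ?thesis using PiE_arb[OF g(1)[unfolded confs_def]] by (simp add: conf_of_def)
    qed
  qed
  then show ?thesis using \<Lambda> j by blast
qed

lemma conf_of_inject:
  assumes "j \<in> vertices T \<rightarrow>\<^sub>E A" "j' \<in> vertices T \<rightarrow>\<^sub>E A'" "conf_of \<Lambda> j = conf_of \<Lambda>' j'"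
  shows "\<Lambda> = \<Lambda>' \<and> j = j'"
proof
  obtain f where f: "f \<in> faces T" using faces_nonempty by blast
  show "\<Lambda> = \<Lambda>'" using fun_cong[OF assms(3), of f] f by (simp add: conf_of_def)
  show "j = j'"
  proof (rule PiE_ext[of _ "vertices T" "\<lambda>_. UNIV"])
    fix V assume "V \<in> vertices T"
    then obtain d where d: "d \<in> sides T" "V = vertex d" unfolding vertices_eq by blast
    have "corner (conf_of \<Lambda> j) d = corner (conf_of \<Lambda>' j') d" using assms(3) by simp
    then show "j V = j' V" unfolding conf_of_side(2)[OF d(1)] d(2) .
  qed (use assms in auto)
qed

lemma sum_glued:
  "(\<Sum>g | g \<in> confs \<and> glued g. F g) = (\<Sum>\<Lambda>\<in>hclasses. \<Sum>j\<in>vertices T \<rightarrow>\<^sub>E {..<cdim \<Lambda>}. F (conf_of \<Lambda> j) :: 'k)"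
proof -
  let ?P = "Sigma hclasses (\<lambda>\<Lambda>. vertices T \<rightarrow>\<^sub>E {..<cdim \<Lambda>})"
  have "{g \<in> confs. glued g} = (\<lambda>(\<Lambda>, j). conf_of \<Lambda> j) ` ?P"
  proof (intro equalityI subsetI)
    fix g assume "g \<in> {g \<in> confs. glued g}"
    then obtain \<Lambda> j where "\<Lambda> \<in> hclasses" "j \<in> vertices T \<rightarrow>\<^sub>E {..<cdim \<Lambda>}" "g = conf_of \<Lambda> j"
      using glued_conf_of by blast
    then show "g \<in> (\<lambda>(\<Lambda>, j). conf_of \<Lambda> j) ` ?P" by (intro image_eqI[of _ _ "(\<Lambda>, j)"]) auto
  next
    fix g assume "g \<in> (\<lambda>(\<Lambda>, j). conf_of \<Lambda> j) ` ?P"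
    then show "g \<in> {g \<in> confs. glued g}" using conf_of_conf by auto
  qed
  moreover have "inj_on (\<lambda>(\<Lambda>, j). conf_of \<Lambda> j) ?P"
  proof (rule inj_onI)
    fix p q assume "p \<in> ?P" "q \<in> ?P" "(\<lambda>(\<Lambda>, j). conf_of \<Lambda> j) p = (\<lambda>(\<Lambda>, j). conf_of \<Lambda> j) q"
    then show "p = q" using conf_of_inject[of "snd p" _ "snd q" _ "fst p" "fst q"]
      by (auto simp: split_beta prod_eq_iff)
  qed
  ultimately have "(\<Sum>g | g \<in> confs \<and> glued g. F g) = sum (F \<circ> (\<lambda>(\<Lambda>, j). conf_of \<Lambda> j)) ?P"
    by (simp only: sum.reindex)
  also have "\<dots> = (\<Sum>(\<Lambda>, j)\<in>?P. F (conf_of \<Lambda> j))"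
    by (simp add: split_beta comp_def)
  also have "\<dots> = (\<Sum>\<Lambda>\<in>hclasses. \<Sum>j\<in>vertices T \<rightarrow>\<^sub>E {..<cdim \<Lambda>}. F (conf_of \<Lambda> j))"
    using finite_classes finite_vertices by (subst sum.Sigma) (auto intro!: finite_PiE)
  finally show ?thesis .
qed

text \<open>The vertices on the boundary correspond to the segments that start there; the indices at the other vertices are free.\<close>

lemma sum_vertices:
  assumes A: "finite A"
  shows "(\<Sum>j\<in>vertices T \<rightarrow>\<^sub>E A. G (\<lambda>e\<in>segments \<Sigma>. j (vertex (seg T e)))) =
    of_nat (card A) ^ punctures \<Sigma> * (\<Sum>s\<in>segments \<Sigma> \<rightarrow>\<^sub>E A. G s :: 'k)"
proof -
  define v where "v e = vertex (seg T e)" for e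
  define I where "I = interior_vertices"
  define unv where "unv = the_inv_into (segments \<Sigma>) v"
  have inj: "inj_on v (segments \<Sigma>)" and im: "v ` segments \<Sigma> = vertex ` external T"
    using vertex_seg_bij unfolding bij_betw_def v_def[abs_def] by simp_all
  have inv: "unv (v e) = e" if "e \<in> segments \<Sigma>" for e using the_inv_into_f_f[OF inj that] unfolding unv_def .
  have vI: "v e \<notin> I" "v e \<in> vertices T" if "e \<in> segments \<Sigma>" for e
  proof -
    have "v e \<in> vertex ` external T" using that im by blast
    then show "v e \<notin> I" "v e \<in> vertices T" using vertices_partition unfolding I_def by blast+
  qed
  have cases: "V \<in> I \<or> (\<exists>e\<in>segments \<Sigma>. V = v e)" if "V \<in> vertices T" for V
  proof -
    have "V \<in> I \<or> V \<in> v ` segments \<Sigma>" using that vertices_partition(1) unfolding im I_def by blast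
    then show ?thesis by blast
  qed
  have Iv: "V \<in> vertices T" if "V \<in> I" for V using that unfolding I_def interior_vertices_def by blast
  have "(\<Sum>j\<in>vertices T \<rightarrow>\<^sub>E A. G (\<lambda>e\<in>segments \<Sigma>. j (v e))) =
    (\<Sum>(m, s)\<in>(I \<rightarrow>\<^sub>E A) \<times> (segments \<Sigma> \<rightarrow>\<^sub>E A). G s)"
  proof (rule sum.reindex_bij_witness[of _
      "\<lambda>(m, s). \<lambda>V\<in>vertices T. if V \<in> I then m V else s (unv V)"
      "\<lambda>j. (restrict j I, \<lambda>e\<in>segments \<Sigma>. j (v e))"])
    fix j assume j: "j \<in> vertices T \<rightarrow>\<^sub>E A"
    show "(case (restrict j I, \<lambda>e\<in>segments \<Sigma>. j (v e)) of
      (m, s) \<Rightarrow> \<lambda>V\<in>vertices T. if V \<in> I then m V else s (unv V)) = j"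
    proof (rule ext)
      fix V
      show "(case (restrict j I, \<lambda>e\<in>segments \<Sigma>. j (v e)) of
        (m, s) \<Rightarrow> \<lambda>V\<in>vertices T. if V \<in> I then m V else s (unv V)) V = j V"
      proof (cases "V \<in> vertices T")
        case True
        from cases[OF True] show ?thesis
        proof
          assume "V \<in> I"
          then show ?thesis using True by simp
        next
          assume "\<exists>e\<in>segments \<Sigma>. V = v e"
          then obtain e where e: "e \<in> segments \<Sigma>" "V = v e" by blast
          then show ?thesis using True vI[OF e(1)] inv[OF e(1)] by simp
        qed
      qed (use PiE_arb[OF j] in simp)
    qed
    show "(restrict j I, \<lambda>e\<in>segments \<Sigma>. j (v e)) \<in> (I \<rightarrow>\<^sub>E A) \<times> (segments \<Sigma> \<rightarrow>\<^sub>E A)"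
      using PiE_mem[OF j] Iv vI by simp
  next
    fix p assume "p \<in> (I \<rightarrow>\<^sub>E A) \<times> (segments \<Sigma> \<rightarrow>\<^sub>E A)"
    then obtain m s where p: "p = (m, s)" "m \<in> I \<rightarrow>\<^sub>E A" "s \<in> segments \<Sigma> \<rightarrow>\<^sub>E A" by blast
    let ?j = "\<lambda>V\<in>vertices T. if V \<in> I then m V else s (unv V)"
    have jm: "restrict ?j I = m"
    proof (rule ext)
      fix V show "restrict ?j I V = m V"
        using Iv[of V] PiE_arb[OF p(2), of V] by (cases "V \<in> I") simp_all
    qed
    have js: "(\<lambda>e\<in>segments \<Sigma>. ?j (v e)) = s"
    proof (rule ext)
      fix e show "(\<lambda>e\<in>segments \<Sigma>. ?j (v e)) e = s e"
        using vI[of e] inv[of e] PiE_arb[OF p(3), of e] by (cases "e \<in> segments \<Sigma>") simp_all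
    qed
    show "(restrict (case p of (m, s) \<Rightarrow> \<lambda>V\<in>vertices T. if V \<in> I then m V else s (unv V)) I,
        \<lambda>e\<in>segments \<Sigma>. (case p of (m, s) \<Rightarrow> \<lambda>V\<in>vertices T. if V \<in> I then m V else s (unv V)) (v e)) = p"
      unfolding p(1) prod.case jm js by (rule HOL.refl)
    show "(case p of (m, s) \<Rightarrow> \<lambda>V\<in>vertices T. if V \<in> I then m V else s (unv V)) \<in> vertices T \<rightarrow>\<^sub>E A"
      unfolding p(1) prod.case
    proof (rule PiE_I)
      fix V assume V: "V \<in> vertices T"
      from cases[OF V] show "?j V \<in> A"
      proof
        assume "V \<in> I"
        then show ?thesis using V PiE_mem[OF p(2)] by simp
      next
        assume "\<exists>e\<in>segments \<Sigma>. V = v e"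
        then obtain e where e: "e \<in> segments \<Sigma>" "V = v e" by blast
        then show ?thesis using V vI[OF e(1)] inv[OF e(1)] PiE_mem[OF p(3) e(1)] by simp
      qed
    qed simp
  qed simp
  also have "\<dots> = (\<Sum>m\<in>I \<rightarrow>\<^sub>E A. \<Sum>s\<in>segments \<Sigma> \<rightarrow>\<^sub>E A. G s)"
    by (rule sum.cartesian_product[symmetric])
  also have "card (I \<rightarrow>\<^sub>E A) = card A ^ punctures \<Sigma>"
    using finite_subset[OF _ finite_vertices, of I] Iv card_interior_vertices unfolding I_def
    by (subst card_PiE) (auto simp: subset_iff)
  then have "(\<Sum>m\<in>I \<rightarrow>\<^sub>E A. \<Sum>s\<in>segments \<Sigma> \<rightarrow>\<^sub>E A. G s) =
     of_nat (card A) ^ punctures \<Sigma> * (\<Sum>s\<in>segments \<Sigma> \<rightarrow>\<^sub>E A. G s)" by simp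
  finally show ?thesis unfolding v_def .
qed

lemma sum_segments:
  "(\<Sum>s\<in>segments \<Sigma> \<rightarrow>\<^sub>E A. \<Prod>(a, b)\<in>segments \<Sigma>. h (a, b) (s (a, b)) (s (a, (b + 1) mod cilia \<Sigma> ! a))) =
   (\<Prod>a<boundaries \<Sigma>. \<Sum>r\<in>{..<cilia \<Sigma> ! a} \<rightarrow>\<^sub>E A. \<Prod>b<cilia \<Sigma> ! a. (h (a, b) (r b) (r ((b + 1) mod cilia \<Sigma> ! a)) :: 'k))"
  if A: "finite A"
proof -
  let ?p = "\<lambda>a. cilia \<Sigma> ! a" and ?n = "boundaries \<Sigma>"
  let ?P = "PiE {..<?n} (\<lambda>a. {..<?p a} \<rightarrow>\<^sub>E A)"
  have seg: "(a, b) \<in> segments \<Sigma> \<longleftrightarrow> a < ?n \<and> b < ?p a" for a b by (simp add: segments_def)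
  have "(\<Prod>a<?n. \<Sum>r\<in>{..<?p a} \<rightarrow>\<^sub>E A. \<Prod>b<?p a. h (a, b) (r b) (r ((b + 1) mod ?p a))) =
     (\<Sum>g\<in>?P. \<Prod>a<?n. \<Prod>b<?p a. h (a, b) (g a b) (g a ((b + 1) mod ?p a)))"
    by (rule prod_sum_PiE) (auto intro!: finite_PiE A)
  also have "\<dots> = (\<Sum>s\<in>segments \<Sigma> \<rightarrow>\<^sub>E A. \<Prod>(a, b)\<in>segments \<Sigma>. h (a, b) (s (a, b)) (s (a, (b + 1) mod ?p a)))"
  proof (rule sum.reindex_bij_witness[of _ "\<lambda>s. \<lambda>a\<in>{..<?n}. \<lambda>b\<in>{..<?p a}. s (a, b)"
      "\<lambda>g. \<lambda>e\<in>segments \<Sigma>. g (fst e) (snd e)"])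
    fix g assume g: "g \<in> ?P"
    have ga: "g a \<in> {..<?p a} \<rightarrow>\<^sub>E A" if "a < ?n" for a using g that by auto
    show "(\<lambda>a\<in>{..<?n}. \<lambda>b\<in>{..<?p a}. (\<lambda>e\<in>segments \<Sigma>. g (fst e) (snd e)) (a, b)) = g"
    proof (intro ext)
      fix a b show "(\<lambda>a\<in>{..<?n}. \<lambda>b\<in>{..<?p a}. (\<lambda>e\<in>segments \<Sigma>. g (fst e) (snd e)) (a, b)) a b = g a b"
        using PiE_arb[OF g, of a] PiE_arb[OF ga, of a b] by (cases "a < ?n"; cases "b < ?p a") (auto simp: seg)
    qed
    show "(\<lambda>e\<in>segments \<Sigma>. g (fst e) (snd e)) \<in> segments \<Sigma> \<rightarrow>\<^sub>E A"
      using PiE_mem[OF ga] by (intro PiE_I) (auto simp: seg)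
    have m: "(b + 1) mod ?p a < ?p a" if "b < ?p a" for a b using that by (intro mod_less_divisor) auto
    have "(\<Prod>(a, b)\<in>segments \<Sigma>. h (a, b) ((\<lambda>e\<in>segments \<Sigma>. g (fst e) (snd e)) (a, b))
        ((\<lambda>e\<in>segments \<Sigma>. g (fst e) (snd e)) (a, (b + 1) mod ?p a))) =
      (\<Prod>(a, b)\<in>segments \<Sigma>. h (a, b) (g a b) (g a ((b + 1) mod ?p a)))"
      using m by (intro prod.cong HOL.refl) (auto simp: seg)
    also have "\<dots> = (\<Prod>a<?n. \<Prod>b<?p a. h (a, b) (g a b) (g a ((b + 1) mod ?p a)))"
      unfolding segments_def by (rule prod.Sigma[symmetric]) auto
    finally show "(\<Prod>(a, b)\<in>segments \<Sigma>. h (a, b) ((\<lambda>e\<in>segments \<Sigma>. g (fst e) (snd e)) (a, b))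
        ((\<lambda>e\<in>segments \<Sigma>. g (fst e) (snd e)) (a, (b + 1) mod ?p a))) =
      (\<Prod>a<?n. \<Prod>b<?p a. h (a, b) (g a b) (g a ((b + 1) mod ?p a)))" .
  next
    fix s assume s: "s \<in> segments \<Sigma> \<rightarrow>\<^sub>E A"
    show "(\<lambda>e\<in>segments \<Sigma>. (\<lambda>a\<in>{..<?n}. \<lambda>b\<in>{..<?p a}. s (a, b)) (fst e) (snd e)) = s"
    proof (rule ext)
      fix e show "(\<lambda>e\<in>segments \<Sigma>. (\<lambda>a\<in>{..<?n}. \<lambda>b\<in>{..<?p a}. s (a, b)) (fst e) (snd e)) e = s e"
        using PiE_arb[OF s, of e] seg[of "fst e" "snd e"] by (cases "e \<in> segments \<Sigma>") auto
    qed
    show "(\<lambda>a\<in>{..<?n}. \<lambda>b\<in>{..<?p a}. s (a, b)) \<in> ?P"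
      using s by (auto simp: seg PiE_iff)
  qed
  finally show ?thesis by (rule HOL.sym)
qed

lemma cilia_pos: assumes "a < boundaries \<Sigma>" shows "cilia \<Sigma> ! a > 0"
proof -
  have "\<forall>p\<in>set (cilia \<Sigma>). p \<ge> 1" using ciliated by (simp add: ciliated_surface_def Let_def)
  moreover have "cilia \<Sigma> ! a \<in> set (cilia \<Sigma>)" using assms by (simp add: boundaries_def)
  ultimately show ?thesis by fastforce
qed

lemma boundary_label_hprod: "boundary_label W S \<Sigma> l a = hprod (\<lambda>b. l (a, b)) (cilia \<Sigma> ! a)"
  by (simp add: boundary_label_def hprod_def)

text \<open>A segment ends where the next one along its circle starts, so the sum over the indices at the cilia is the
  product over the boundary circles of the sums in \<open>chain_trace\<close>.\<close>

lemma sum_boundary: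
  assumes \<Lambda>: "\<Lambda> \<in> hclasses"
  shows "(\<Sum>j\<in>vertices T \<rightarrow>\<^sub>E {..<cdim \<Lambda>}. \<Prod>e\<in>segments \<Sigma>.
      entry \<Lambda> (l e) (j (vertex (seg T e))) (j (vertex (next_side (seg T e))))) =
    of_nat (cdim \<Lambda>) ^ punctures \<Sigma> * (\<Prod>a<boundaries \<Sigma>. irrep_char \<Lambda> (boundary_label W S \<Sigma> l a))"
proof -
  let ?G = "\<lambda>s. \<Prod>(a, b)\<in>segments \<Sigma>. entry \<Lambda> (l (a, b)) (s (a, b)) (s (a, (b + 1) mod cilia \<Sigma> ! a))"
  have "(\<Sum>j\<in>vertices T \<rightarrow>\<^sub>E {..<cdim \<Lambda>}. \<Prod>e\<in>segments \<Sigma>.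
      entry \<Lambda> (l e) (j (vertex (seg T e))) (j (vertex (next_side (seg T e))))) =
    (\<Sum>j\<in>vertices T \<rightarrow>\<^sub>E {..<cdim \<Lambda>}. ?G (\<lambda>e\<in>segments \<Sigma>. j (vertex (seg T e))))"
  proof (intro sum.cong HOL.refl prod.cong)
    fix j e assume e: "e \<in> segments \<Sigma>"
    obtain a b where ab: "e = (a, b)" by (cases e)
    have "(a, (b + 1) mod cilia \<Sigma> ! a) \<in> segments \<Sigma>"
      using e cilia_pos unfolding ab by (simp add: segments_def)
    then show "entry \<Lambda> (l e) (j (vertex (seg T e))) (j (vertex (next_side (seg T e)))) =
      (case e of (a, b) \<Rightarrow> entry \<Lambda> (l (a, b)) ((\<lambda>e\<in>segments \<Sigma>. j (vertex (seg T e))) (a, b))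
        ((\<lambda>e\<in>segments \<Sigma>. j (vertex (seg T e))) (a, (b + 1) mod cilia \<Sigma> ! a)))"
      using e vertex_next_seg[of a b] unfolding ab by simp
  qed
  also have "\<dots> = of_nat (cdim \<Lambda>) ^ punctures \<Sigma> * (\<Sum>s\<in>segments \<Sigma> \<rightarrow>\<^sub>E {..<cdim \<Lambda>}. ?G s)"
    using sum_vertices[of "{..<cdim \<Lambda>}" ?G] by simp
  also have "(\<Sum>s\<in>segments \<Sigma> \<rightarrow>\<^sub>E {..<cdim \<Lambda>}. ?G s) = (\<Prod>a<boundaries \<Sigma>. \<Sum>r\<in>{..<cilia \<Sigma> ! a} \<rightarrow>\<^sub>E {..<cdim \<Lambda>}.
     \<Prod>b<cilia \<Sigma> ! a. entry \<Lambda> (l (a, b)) (r b) (r ((b + 1) mod cilia \<Sigma> ! a)))"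
    by (rule sum_segments[of "{..<cdim \<Lambda>}" "\<lambda>e i j. entry \<Lambda> (l e) i j"]) simp
  also have "\<dots> = (\<Prod>a<boundaries \<Sigma>. irrep_char \<Lambda> (boundary_label W S \<Sigma> l a))"
  proof (rule prod.cong[OF HOL.refl])
    fix a assume a: "a \<in> {..<boundaries \<Sigma>}"
    have "l (a, b) \<in> carrier H" if "b < cilia \<Sigma> ! a" for b using labels a that by (simp add: segments_def)
    then show "(\<Sum>r\<in>{..<cilia \<Sigma> ! a} \<rightarrow>\<^sub>E {..<cdim \<Lambda>}.
     \<Prod>b<cilia \<Sigma> ! a. entry \<Lambda> (l (a, b)) (r b) (r ((b + 1) mod cilia \<Sigma> ! a))) = irrep_char \<Lambda> (boundary_label W S \<Sigma> l a)"
      unfolding boundary_label_hprod using irrep_char_hprod[OF \<Lambda> cilia_pos, of a "\<lambda>b. l (a, b)"] a by simp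
  qed
  finally show ?thesis .
qed

theorem invariant_formula:
  "\<theta> (invariant W S \<Sigma> T l) =
    (\<Sum>\<Lambda>\<in>hclasses. of_nat (cdim \<Lambda>) ^ punctures \<Sigma> *
       schur \<Lambda> powi (2 * int (genus \<Sigma>) - 2 + int (punctures \<Sigma>) + int (boundaries \<Sigma>)) *
       (\<Prod>i<boundaries \<Sigma>. irrep_char \<Lambda> (boundary_label W S \<Sigma> l i)))"
proof -
  let ?seg = "\<lambda>g. \<Prod>e\<in>segments \<Sigma>. entry (colour g (seg T e)) (l e) (corner g (seg T e)) (corner g (next_side (seg T e)))"
  have fin: "finite confs" unfolding confs_def using finite_faces finite_face_states by (intro finite_PiE) auto
  have "\<theta> (invariant W S \<Sigma> T l) = (\<Sum>g\<in>confs. if glued g then face_weight g * (\<Prod>d\<in>oriented T. schur (colour g d)) * ?seg g else 0)"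
    unfolding invariant_expand by (intro sum.cong HOL.refl) (simp add: gluing_eq)
  also have "\<dots> = (\<Sum>g | g \<in> confs \<and> glued g. face_weight g * (\<Prod>d\<in>oriented T. schur (colour g d)) * ?seg g)"
    using fin by (simp add: sum.If_cases Int_def)
  also have "\<dots> = (\<Sum>\<Lambda>\<in>hclasses. \<Sum>j\<in>vertices T \<rightarrow>\<^sub>E {..<cdim \<Lambda>}.
     face_weight (conf_of \<Lambda> j) * (\<Prod>d\<in>oriented T. schur (colour (conf_of \<Lambda> j) d)) * ?seg (conf_of \<Lambda> j))"
    by (rule sum_glued)
  also have "\<dots> = (\<Sum>\<Lambda>\<in>hclasses. of_nat (cdim \<Lambda>) ^ punctures \<Sigma> *
       schur \<Lambda> powi (2 * int (genus \<Sigma>) - 2 + int (punctures \<Sigma>) + int (boundaries \<Sigma>)) *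
       (\<Prod>i<boundaries \<Sigma>. irrep_char \<Lambda> (boundary_label W S \<Sigma> l i)))"
  proof (rule sum.cong[OF HOL.refl])
    fix \<Lambda> assume \<Lambda>: "\<Lambda> \<in> hclasses"
    let ?j = "\<lambda>j. \<Prod>e\<in>segments \<Sigma>. entry \<Lambda> (l e) (j (vertex (seg T e))) (j (vertex (next_side (seg T e))))"
    have w: "face_weight (conf_of \<Lambda> j) = (1 / schur \<Lambda>) ^ card (faces T)" for j
      unfolding face_weight_def by (simp add: conf_of_def)
    have o: "(\<Prod>d\<in>oriented T. schur (colour (conf_of \<Lambda> j) d)) = schur \<Lambda> ^ card (oriented T)" for j
      using conf_of_side(1) oriented_internal internal_sides by simp
    have s: "?seg (conf_of \<Lambda> j) = ?j j" for j
      by (intro prod.cong HOL.refl) (simp add: conf_of_side external_sides[OF seg_external] next_side_sides)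
    have "(1 / schur \<Lambda>) ^ card (faces T) * schur \<Lambda> ^ card (oriented T) =
        schur \<Lambda> powi (int (card (oriented T)) - int (card (faces T)))"
      using schur_nonzero[OF \<Lambda>] by (simp add: power_int_diff power_one_over field_simps)
    then have e: "(1 / schur \<Lambda>) ^ card (faces T) * schur \<Lambda> ^ card (oriented T) =
       schur \<Lambda> powi (2 * int (genus \<Sigma>) - 2 + int (punctures \<Sigma>) + int (boundaries \<Sigma>))"
      unfolding euler_exponent .
    show "(\<Sum>j\<in>vertices T \<rightarrow>\<^sub>E {..<cdim \<Lambda>}.
       face_weight (conf_of \<Lambda> j) * (\<Prod>d\<in>oriented T. schur (colour (conf_of \<Lambda> j) d)) * ?seg (conf_of \<Lambda> j)) =
      of_nat (cdim \<Lambda>) ^ punctures \<Sigma> *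
       schur \<Lambda> powi (2 * int (genus \<Sigma>) - 2 + int (punctures \<Sigma>) + int (boundaries \<Sigma>)) *
       (\<Prod>i<boundaries \<Sigma>. irrep_char \<Lambda> (boundary_label W S \<Sigma> l i))"
      unfolding w o s e sum_distrib_left[symmetric] sum_boundary[OF \<Lambda>] by (simp only: mult_ac)
  qed
  finally show ?thesis .
qed

end

theorem theorem5:
  fixes W :: "('w, 'b) monoid_scheme" and S :: "'w set"
    and \<theta> :: "laurent \<Rightarrow> 'k::field"
    and \<Sigma> :: surface and T :: "'f triangulation"
    and l :: "nat \<times> nat \<Rightarrow> 'w hecke"
  assumes "coxeter_system W S" and "finite (carrier W)"
    and "splitting_field W S \<theta>"
    and "ciliated_surface \<Sigma>" and "triangulates T \<Sigma>"
    and "\<forall>e\<in>segments \<Sigma>. l e \<in> carrier (hecke_alg W S)"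
  shows "\<theta> (invariant W S \<Sigma> T l) =
    (\<Sum>\<Lambda> \<in> irrep_classes W S \<theta>.
       of_nat (irrep_dim W S \<Lambda>) ^ punctures \<Sigma>
       * schur_element W S \<theta> \<Lambda>
           powi (2 * int (genus \<Sigma>) - 2 + int (punctures \<Sigma>) + int (boundaries \<Sigma>))
       * (\<Prod>i<boundaries \<Sigma>. irrep_char \<Lambda> (boundary_label W S \<Sigma> l i)))"
proof -
  interpret group W using assms(1) by (simp add: coxeter_system_def)
  interpret labelled_surface W S \<theta> \<Sigma> T l
    by unfold_locales (use assms in auto)
  show ?thesis by (rule invariant_formula)
qed

end
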